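(* Let $G$ be a topological space with Borel $\sigma$-field $\mathcal{B}(G)$, let $\gamma$ be a (nonnegative measure) kernel on $G$, $f:[0,1]\times G^2\to[0,\infty)$ measurable, and suppose that $P_u(x,A)=\int_Af(u,x,y)\gamma(x,dy)$, $u\in[0,1]$, are Markov kernels on $G$. Let $k\ge1$ be an integer and $V_0\le V_1\le\cdots\le V_k$ measurable functions $G\to[1,\infty)$ such that: (B1) each $P_u$ has a unique invariant probability measure $\mu_u$, $\int V_k\,d\mu_u<\infty$, and for every $\ell=0,\ldots,k$ there is $\kappa_\ell\in(0,1)$ with $\sup_{u\in[0,1]}\sup_{x\in G}\frac{\|\delta_xP_u^n-\mu_u\|_\ell}{V_\ell(x)}=O(\kappa_\ell^n)$ as $n\to\infty$; (B2) for all $(x,y)\in G^2$, $u\mapsto f(u,x,y)$ is $k$-times continuously differentiable on $[0,1]$, with derivative of order $\ell$ denoted $\partial_1^{(\ell)}f$; (B3) there is $C>0$ such that for all integers $0\le s\le s+\ell\le k$ and all $x\in G$, $\sup_{u\in[0,1]}\int|\partial_1^{(\ell)}f(u,x,y)|V_s(y)\gamma(x,dy)\le CV_{s+\ell}(x)$; and for all $u\in[0,1]$, $x\in G$ and $0\le s\le k$, $\lim_{h\to0}\int|\partial_1^{(k-s)}f(u+h,x,y)-\partial_1^{(k-s)}f(u,x,y)|V_s(y)\gamma(x,dy)=0$. Set $T_u\mu=\mu P_u$ and, for $1\le\ell\le k$ and $\mu\in F_\ell$, let $T_u^{(\ell)}\mu$ be the signed measure $(T_u^{(\ell)}\mu)(dy)=\int\mu(dx)\,\partial_1^{(\ell)}f(u,x,y)\gamma(x,dy)$;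 put $T_u^{(0)}=T_u$. Then the following hold. (A1) $T_uF_\ell\subset F_\ell$ for all $0\le\ell\le k$; for each $\ell$ there exist an integer $m_\ell\ge1$ and $\kappa'_\ell\in(0,1)$ with $\sup_u\|T_u^{m_\ell}\|_{0,\ell,\ell}\le\kappa'_\ell$ and $\sup_u\|T_u\|_{\ell,\ell}<\infty$; and for each $\mu\in F_\ell$, $u\mapsto T_u\mu$ is continuous from $[0,1]$ to $F_\ell$. (A2) For $1\le\ell\le k$, $T_u^{(\ell)}:F_\ell\to F_0$ is a continuous linear operator, and whenever $0\le s\le s+\ell\le k$: $T_u^{(\ell)}F_{s+\ell}\subset F_s$, $\sup_u\|T_u^{(\ell)}\|_{s+\ell,s}<\infty$, and for $\mu\in F_{s+\ell}$ the function $u\mapsto T_u^{(\ell-1)}\mu$ is differentiable from $[0,1]$ to $F_s$ with continuous derivative $u\mapsto T_u^{(\ell)}\mu$. Moreover: 1. For $u\in[0,1]$ and $0\le\ell\le k$, $I-T_u$ is an isomorphism of $(F_{0,\ell},\|\cdot\|_\ell)$ with inverse $\sum_{i\ge0}T_u^i$; $\max_{0\le\ell\le k}\sup_u\|(I-T_u)^{-1}\|_{0,\ell,\ell}<\infty$; for $\mu\in F_{0,\ell}$, $u\mapsto(I-T_u)^{-1}\mu$ is continuous from $[0,1]$ to $F_\ell$; and for $0\le\ell\le k-1$, $\mu\in F_{0,\ell+1}$, the map $u\mapsto(I-T_u)^{-1}\mu$ is differentiable from $[0,1]$ to $F_\ell$ with derivative $(I-T_u)^{-1}T_u^{(1)}(I-T_u)^{-1}\mu$.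 2. For each $u$, $\mu_u$ is the unique probability measure with $T_u\mu_u=\mu_u$, and $\mu_u\in F_k$. 3. The map $g:[0,1]\to F_k$, $g(u)=\mu_u$, is continuous, and there exist $g^{(0)}=g,g^{(1)},\ldots,g^{(k)}$ such that for $1\le\ell\le k$, $g^{(\ell)}:[0,1]\to F_{0,k-\ell}$ is continuous, $\lim_{h\to0}\left\|\frac{g^{(\ell-1)}(u+h)-g^{(\ell-1)}(u)}{h}-g^{(\ell)}(u)\right\|_{k-\ell}=0$ for all $u\in[0,1]$, and $g^{(\ell)}(u)=\sum_{s=1}^\ell\binom{\ell}{s}(I-T_u)^{-1}T_u^{(s)}g^{(\ell-s)}(u)$.
   Context: For a measurable $V:G\to[1,\infty)$, $\mathcal{M}_V(G)$ is the Banach space of signed measures $\mu$ on $G$ with $\|\mu\|_V:=\int V\,d|\mu|<\infty$. For $0\le\ell\le k$, put $F_\ell=\mathcal{M}_{V_\ell}(G)$, $\|\cdot\|_\ell=\|\cdot\|_{V_\ell}$, and $F_{0,\ell}=\{\mu\in F_\ell:\mu(G)=0\}$. For $0\le i\le j\le k$ and a linear operator $T$ from $F_j$ to $F_i$ (or, for the second norm, defined at least on $F_{0,j}$), $\|T\|_{j,i}=\sup\{\|T\mu\|_i:\mu\in F_j,\|\mu\|_j\le1\}$ and $\|T\|_{0,j,i}=\sup\{\|T\mu\|_i:\mu\in F_{0,j},\|\mu\|_j\le1\}$. $\mu P_u(A)=\int\mu(dx)P_u(x,A)$, and $\delta_x$ is the Dirac mass at $x$. Limits as $h\to0$ and derivatives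 on $[0,1]$ are one-sided at the endpoints. *)

theory Defs
  imports "HOL-Probability.Probability"
begin

section \<open>Finite signed Borel measures\<close>

text \<open>
  A finite signed measure is a countably additive real set function on the Borel sets, extended by
  \<open>0\<close> to the other sets so that equality is equality on Borel sets.  Finiteness loses nothing, as
  a signed measure of finite \<open>V\<close>-norm is finite when \<open>V \<ge> 1\<close>.
\<close>

typedef (overloaded) 'a signed_measure =
  "{m :: 'a::topological_space set \<Rightarrow> real.
      (\<forall>A. A \<notin> sets borel \<longrightarrow> m A = 0) \<and>
      (\<forall>A :: nat \<Rightarrow> 'a set. range A \<subseteq> sets borel \<longrightarrow> disjoint_family A \<longrightarrow>
         (\<lambda>i. m (A i)) sums m (\<Union>i. A i))}"
  morphisms sval Abs_signed_measure
  by (rule exI[of _ "\<lambda>_. 0"]) simp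

setup_lifting type_definition_signed_measure

instantiation signed_measure :: (topological_space) real_vector
begin

lift_definition zero_signed_measure :: "'a signed_measure" is "\<lambda>_. 0"
  by simp

lift_definition plus_signed_measure ::
  "'a signed_measure \<Rightarrow> 'a signed_measure \<Rightarrow> 'a signed_measure" is "\<lambda>m n A. m A + n A"
  by (auto intro!: sums_add)

lift_definition uminus_signed_measure ::
  "'a signed_measure \<Rightarrow> 'a signed_measure" is "\<lambda>m A. - m A"
  by (auto intro!: sums_minus)

lift_definition minus_signed_measure ::
  "'a signed_measure \<Rightarrow> 'a signed_measure \<Rightarrow> 'a signed_measure" is "\<lambda>m n A. m A - n A"
  by (auto intro!: sums_diff)

lift_definition scaleR_signed_measure ::
  "real \<Rightarrow> 'a signed_measure \<Rightarrow> 'a signed_measure" is "\<lambda>c m A. c * m A"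
  by (auto intro!: sums_mult)

instance
  by standard (transfer; simp add: fun_eq_iff algebra_simps)+

end

text \<open>Only meaningful for finite measures on the Borel sets.\<close>

definition of_measure :: "'a::topological_space measure \<Rightarrow> 'a signed_measure" where
  "of_measure N = Abs_signed_measure (\<lambda>A. measure N A)"

abbreviation dirac :: "'a::topological_space \<Rightarrow> 'a signed_measure" where
  "dirac x \<equiv> of_measure (return borel x)"

text \<open>
  Jordan decomposition: \<open>m\<^sup>+(A) = sup {m(B) | B \<subseteq> A}\<close>, where negative values are cut off at \<open>0\<close>
  by \<^const>\<open>ennreal\<close>; this does not change the supremum, since \<open>m({}) = 0\<close>.
\<close>

definition pos_part :: "'a::topological_space signed_measure \<Rightarrow> 'a measure" where
  "pos_part m = measure_of UNIV (sets borel)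
     (\<lambda>A. SUP B\<in>{B \<in> sets borel. B \<subseteq> A}. ennreal (sval m B))"

definition neg_part :: "'a::topological_space signed_measure \<Rightarrow> 'a measure" where
  "neg_part m = pos_part (- m)"

definition variation :: "'a::topological_space signed_measure \<Rightarrow> 'a measure" where
  "variation m = measure_of UNIV (sets borel)
     (\<lambda>A. emeasure (pos_part m) A + emeasure (neg_part m) A)"

definition signed_integral :: "'a::topological_space signed_measure \<Rightarrow> ('a \<Rightarrow> real) \<Rightarrow> real" where
  "signed_integral m g = (\<integral>x. g x \<partial>pos_part m) - (\<integral>x. g x \<partial>neg_part m)"

section \<open>Weighted norms and operators\<close>

text \<open>
  Norms and operator norms take values in \<^typ>\<open>ennreal\<close>, so that suprema always exist and
  finiteness is an honest assertion.
\<close>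

definition vnorm :: "('a::topological_space \<Rightarrow> real) \<Rightarrow> 'a signed_measure \<Rightarrow> ennreal" where
  "vnorm V m = (\<integral>\<^sup>+x. ennreal (V x) \<partial>variation m)"

definition MV :: "('a::topological_space \<Rightarrow> real) \<Rightarrow> 'a signed_measure set" where
  "MV V = {m. vnorm V m < \<infinity>}"

definition MV0 :: "('a::topological_space \<Rightarrow> real) \<Rightarrow> 'a signed_measure set" where
  "MV0 V = {m \<in> MV V. sval m UNIV = 0}"

text \<open>
  \<open>opnorm V W T\<close> is the norm of \<open>T\<close> from \<open>MV V\<close> to \<open>MV W\<close>, and \<open>opnorm0\<close> that of its restriction
  to the measures of total mass \<open>0\<close>.
\<close>

definition opnorm :: "('a::topological_space \<Rightarrow> real) \<Rightarrow> ('a \<Rightarrow> real) \<Rightarrow>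
    ('a signed_measure \<Rightarrow> 'a signed_measure) \<Rightarrow> ennreal" where
  "opnorm V W T = (SUP m\<in>{m \<in> MV V. vnorm V m \<le> 1}. vnorm W (T m))"

definition opnorm0 :: "('a::topological_space \<Rightarrow> real) \<Rightarrow> ('a \<Rightarrow> real) \<Rightarrow>
    ('a signed_measure \<Rightarrow> 'a signed_measure) \<Rightarrow> ennreal" where
  "opnorm0 V W T = (SUP m\<in>{m \<in> MV0 V. vnorm V m \<le> 1}. vnorm W (T m))"

definition linear_map_on :: "'a::topological_space signed_measure set \<Rightarrow>
    ('a signed_measure \<Rightarrow> 'a signed_measure) \<Rightarrow> bool" where
  "linear_map_on S T \<longleftrightarrow>
     (\<forall>m\<in>S. \<forall>n\<in>S. T (m + n) = T m + T n) \<and> (\<forall>c. \<forall>m\<in>S. T (c *\<^sub>R m) = c *\<^sub>R T m)"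

definition continuous_map_on :: "('a::topological_space \<Rightarrow> real) \<Rightarrow> ('a \<Rightarrow> real) \<Rightarrow>
    'a signed_measure set \<Rightarrow> ('a signed_measure \<Rightarrow> 'a signed_measure) \<Rightarrow> bool" where
  "continuous_map_on V W S T \<longleftrightarrow>
     (\<forall>m\<in>S. \<forall>e::real. e > 0 \<longrightarrow> (\<exists>d::real. d > 0 \<and>
        (\<forall>n\<in>S. vnorm V (n - m) < ennreal d \<longrightarrow> vnorm W (T n - T m) < ennreal e)))"

text \<open>Isomorphism of the normed space \<open>S\<close>, with norm \<open>vnorm V\<close>, onto itself.\<close>

definition isomorphism_on :: "('a::topological_space \<Rightarrow> real) \<Rightarrow> 'a signed_measure set \<Rightarrow>
    ('a signed_measure \<Rightarrow> 'a signed_measure) \<Rightarrow> bool" where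
  "isomorphism_on V S T \<longleftrightarrow>
     linear_map_on S T \<and> bij_betw T S S \<and>
     continuous_map_on V V S T \<and> continuous_map_on V V S (inv_into S T)"

section \<open>Paths of measures over the unit interval\<close>

text \<open>
  Increments \<open>h\<close> are restricted to \<open>u + h \<in> [0,1]\<close>, so limits are one-sided at the endpoints.
\<close>

abbreviation increments :: "real \<Rightarrow> real filter" where
  "increments u \<equiv> at 0 within {h. u + h \<in> {0..1}}"

definition continuous_path :: "('a::topological_space \<Rightarrow> real) \<Rightarrow> 'a signed_measure set \<Rightarrow>
    (real \<Rightarrow> 'a signed_measure) \<Rightarrow> bool" where
  "continuous_path V S g \<longleftrightarrow>
     (\<forall>u\<in>{0..1}. g u \<in> S \<and> ((\<lambda>h. vnorm V (g (u + h) - g u)) \<longlongrightarrow> 0) (increments u))"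

definition path_deriv :: "('a::topological_space \<Rightarrow> real) \<Rightarrow>
    (real \<Rightarrow> 'a signed_measure) \<Rightarrow> (real \<Rightarrow> 'a signed_measure) \<Rightarrow> bool" where
  "path_deriv V g g' \<longleftrightarrow>
     (\<forall>u\<in>{0..1}. ((\<lambda>h. vnorm V ((g (u + h) - g u) /\<^sub>R h - g' u)) \<longlongrightarrow> 0) (increments u))"

definition differentiable_path :: "('a::topological_space \<Rightarrow> real) \<Rightarrow> 'a signed_measure set \<Rightarrow>
    (real \<Rightarrow> 'a signed_measure) \<Rightarrow> (real \<Rightarrow> 'a signed_measure) \<Rightarrow> bool" where
  "differentiable_path V S g g' \<longleftrightarrow>
     (\<forall>u\<in>{0..1}. g u \<in> S \<and> g' u \<in> S) \<and> path_deriv V g g'"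

section \<open>Kernels\<close>

definition measure_kernel :: "('a::topological_space \<Rightarrow> 'a measure) \<Rightarrow> bool" where
  "measure_kernel K \<longleftrightarrow>
     (\<forall>x. sets (K x) = sets borel) \<and>
     (\<forall>A\<in>sets borel. (\<lambda>x. emeasure (K x) A) \<in> borel_measurable borel)"

definition invariant_prob :: "('a::topological_space \<Rightarrow> 'a measure) \<Rightarrow> 'a measure \<Rightarrow> bool" where
  "invariant_prob K N \<longleftrightarrow> N \<in> space (prob_algebra borel) \<and> N \<bind> K = N"

text \<open>
  The signed measure \<open>A \<mapsto> \<integral> Q(x,A) m(dx)\<close>, for a kernel \<open>Q\<close> and a signed measure \<open>m\<close> for which
  this expression is a signed measure.
\<close>

definition kernel_op ::
  "('a::topological_space \<Rightarrow> 'a set \<Rightarrow> real) \<Rightarrow> 'a signed_measure \<Rightarrow> 'a signed_measure" where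
  "kernel_op Q m = Abs_signed_measure
     (\<lambda>A. if A \<in> sets borel then signed_integral m (\<lambda>x. Q x A) else 0)"

end

theory Submission
  imports Defs
begin

text \<open>
  Norms of signed measures are computed by duality with bounded test functions, so that
  \<open>\<mu>P\<^sub>u\<close> and \<open>T\<^sub>u\<^sup>(\<^sup>l\<^sup>)\<mu>\<close> are estimated through the kernels against which \<open>\<mu>\<close> is integrated;
  dominated convergence then turns the pointwise conditions (B3) into strong continuity and
  differentiability. Condition (B1) makes \<open>T\<^sub>u\<^sup>n\<close> decay geometrically on measures of mass zero, uniformly
  in \<open>u\<close>, whence \<open>(I - T\<^sub>u)\<^sup>-\<^sup>1\<close> is a uniformly bounded Neumann series. Continuity and
  differentiability of the resolvent follow from the resolvent identity, and those of the
  derivatives of \<open>u \<mapsto> \<mu>\<^sub>u\<close> from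
  \<open>(I - T\<^sub>u\<^sub>+\<^sub>h) (g\<^sub>l(u+h) - g\<^sub>l(u)) = r\<^sub>l(u+h) - r\<^sub>l(u) + (T\<^sub>u\<^sub>+\<^sub>h - T\<^sub>u) g\<^sub>l(u)\<close>
  with \<open>r\<^sub>l = (I - T) g\<^sub>l\<close>, by induction on \<open>l\<close> and Leibniz' rule.
\<close>

section \<open>Jordan decomposition\<close>

text \<open>(B1) speaks of Dirac masses only and (B3) of single points x; both have to be integrated
  against an arbitrary signed measure, with a bound by its weighted norm. Bounded test functions
  permit this: they are integrable against every finite signed measure, so integrals can be
  interchanged without regard to the weight, which returns in the final supremum. Every derivative
  in u costs one step of the scale F_0, ..., F_k, since the l-th derivative of T maps F_(s+l) only
  into F_s. Hence I - T is inverted on each level separately, and the inverses are identified across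
  levels by injectivity on the larger space. Operators are never continuous in operator norm here:
  uniform bounds together with convergence at fixed measures carry all limits. The kernel \<gamma>
  is not assumed \<sigma>-finite. This forbids a direct use of Fubini's theorem both for the
  remainders of difference quotients and for the measurability in x of integrals against \<gamma>,
  and it explains two detours: Riemann sums with Fatou's lemma, and the recovery of the relevant
  part of \<gamma> from countably many Markov kernels.\<close>

lemma sval_not_borel: "A \<notin> sets borel \<Longrightarrow> sval m A = 0"
  using sval[of m] by auto

lemma sval_sums:
  "range A \<subseteq> sets borel \<Longrightarrow> disjoint_family A \<Longrightarrow> (\<lambda>i. sval m (A i)) sums sval m (\<Union>i. A i)"
  using sval[of m] by auto

lemma signed_measure_eqI:
  assumes "\<And>A. A \<in> sets borel \<Longrightarrow> sval m A = sval n A"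
  shows "m = n"
proof -
  have "sval m A = sval n A" for A
    using assms sval_not_borel[of A m] sval_not_borel[of A n] by (cases "A \<in> sets borel") auto
  then show ?thesis
    by (metis ext sval_inject)
qed

text \<open>The constant sequence of empty sets is disjoint, so its constant terms are summable and
  must vanish.\<close>

lemma sval_empty [simp]: "sval m {} = 0"
proof -
  have "(\<lambda>i::nat. sval m {}) sums sval m {}"
    using sval_sums[of "\<lambda>_. {}" m] by (auto simp: disjoint_family_on_def)
  then have "summable (\<lambda>i::nat. sval m {})"
    by (rule sums_summable)
  then show ?thesis
    using summable_LIMSEQ_zero LIMSEQ_const_iff by blast
qed

lemma sval_Un:
  assumes "A \<in> sets borel" "B \<in> sets borel" "A \<inter> B = {}"
  shows "sval m (A \<union> B) = sval m A + sval m B"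
proof -
  have "(\<lambda>i. sval m (binaryset A B i)) sums sval m (\<Union>i. binaryset A B i)"
    using assms by (intro sval_sums) (auto simp: range_binaryset_eq disjoint_family_on_def binaryset_def)
  moreover have "(\<lambda>i. sval m (binaryset A B i)) sums (\<Sum>i\<in>{0,1}. sval m (binaryset A B i))"
    by (intro sums_finite) (auto simp: binaryset_def)
  ultimately have "sval m (\<Union>i. binaryset A B i) = (\<Sum>i\<in>{0,1}. sval m (binaryset A B i))"
    by (rule sums_unique2)
  then show ?thesis
    by (simp add: UN_binaryset_eq) (simp add: binaryset_def)
qed

lemma sval_UN_lessThan:
  fixes A :: "nat \<Rightarrow> 'a::topological_space set"
  assumes A: "range A \<subseteq> sets borel" "disjoint_family A"
  shows "sval m (\<Union>j<n. A j) = (\<Sum>j<n. sval m (A j))"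
proof (induction n)
  case (Suc n)
  have "sval m ((\<Union>j<n. A j) \<union> A n) = sval m (\<Union>j<n. A j) + sval m (A n)"
    using A by (intro sval_Un) (auto, metis IntI disjoint_family_onD UNIV_I empty_iff less_irrefl)
  then show ?case
    using Suc by (simp add: lessThan_Suc Un_commute)
qed simp

lemma sval_Diff:
  assumes "A \<in> sets borel" "B \<in> sets borel" "B \<subseteq> A"
  shows "sval m (A - B) = sval m A - sval m B"
proof -
  have "(A - B) \<union> B = A" "(A - B) \<inter> B = {}"
    using assms by auto
  then show ?thesis
    using sval_Un[of "A - B" B m] assms by simp
qed

lemma sval_0 [simp]: "sval 0 A = 0"
  and sval_plus [simp]: "sval (m + n) A = sval m A + sval n A"
  and sval_minus [simp]: "sval (m - n) A = sval m A - sval n A"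
  and sval_uminus [simp]: "sval (- m) A = - sval m A"
  and sval_scaleR [simp]: "sval (c *\<^sub>R m) A = c * sval m A"
  by (transfer; simp)+

lemma sval_sum [simp]: "sval (\<Sum>i\<in>I. m i) A = (\<Sum>i\<in>I. sval (m i) A)"
  by (induction I rule: infinite_finite_induct) auto

text \<open>If the values on subsets of a set were unbounded, they would be unbounded on one piece
  of a suitable splitting, while the other piece has mass of modulus at least 1. Iteration yields
  disjoint pieces whose masses do not tend to 0, against countable additivity.\<close>

lemma sval_bounded: "\<exists>K. \<forall>B. \<bar>sval m B\<bar> \<le> K"
proof (rule ccontr)
  define U where "U E \<longleftrightarrow> E \<in> sets borel \<and> \<not> (\<exists>K. \<forall>B\<in>sets borel. B \<subseteq> E \<longrightarrow> \<bar>sval m B\<bar> \<le> K)" for E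
  assume "\<not> ?thesis"
  moreover have "\<exists>K. \<forall>B. \<bar>sval m B\<bar> \<le> K" if "\<forall>B\<in>sets borel. \<bar>sval m B\<bar> \<le> K" for K
  proof (intro exI[of _ K] allI)
    fix B
    have "0 \<le> K"
      using that[rule_format, of "{}"] by simp
    then show "\<bar>sval m B\<bar> \<le> K"
      using that by (cases "B \<in> sets borel") (auto simp: sval_not_borel)
  qed
  ultimately have "U UNIV"
    unfolding U_def by fastforce
  have step: "\<exists>E'. U E' \<and> E' \<subseteq> E \<and> 1 \<le> \<bar>sval m (E - E')\<bar>" if "U E" for E
  proof -
    \<comment> \<open>The margin \<open>\<bar>sval m E\<bar> + 1\<close> forces modulus at least 1
      on \<open>B\<close> and on \<open>E - B\<close>, so either piece may be the one
      discarded.\<close>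
    obtain B where B: "B \<in> sets borel" "B \<subseteq> E" "\<bar>sval m B\<bar> > \<bar>sval m E\<bar> + 1"
      using \<open>U E\<close> unfolding U_def by (meson not_le)
    have E: "E \<in> sets borel"
      using \<open>U E\<close> by (simp add: U_def)
    have D: "sval m (E - B) = sval m E - sval m B"
      using B E by (intro sval_Diff) auto
    have "U B \<or> U (E - B)"
    proof (rule ccontr)
      assume "\<not> ?thesis"
      moreover have "E - B \<in> sets borel"
        using B E by auto
      ultimately have "\<exists>K. \<forall>C\<in>sets borel. C \<subseteq> B \<longrightarrow> \<bar>sval m C\<bar> \<le> K"
        and "\<exists>K. \<forall>C\<in>sets borel. C \<subseteq> E - B \<longrightarrow> \<bar>sval m C\<bar> \<le> K"
        using B by (simp_all add: U_def)
      then obtain K K' where K: "\<And>C. C \<in> sets borel \<Longrightarrow> C \<subseteq> B \<Longrightarrow> \<bar>sval m C\<bar> \<le> K"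
        and K': "\<And>C. C \<in> sets borel \<Longrightarrow> C \<subseteq> E - B \<Longrightarrow> \<bar>sval m C\<bar> \<le> K'"
        by metis
      have "\<bar>sval m C\<bar> \<le> K + K'" if "C \<in> sets borel" "C \<subseteq> E" for C
      proof -
        have "(C \<inter> B) \<union> (C - B) = C" "(C \<inter> B) \<inter> (C - B) = {}"
          by auto
        then have "sval m C = sval m (C \<inter> B) + sval m (C - B)"
          using sval_Un[of "C \<inter> B" "C - B" m] that B by simp
        moreover have "\<bar>sval m (C \<inter> B)\<bar> \<le> K"
          using that B by (intro K) auto
        moreover have "\<bar>sval m (C - B)\<bar> \<le> K'"
          using that B by (intro K') auto
        ultimately show ?thesis
          by linarith
      qed
      with \<open>U E\<close> show False
        unfolding U_def by blast
    qed
    then show ?thesis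
    proof
      assume "U B"
      moreover have "1 \<le> \<bar>sval m (E - B)\<bar>"
        using B(3) D by linarith
      ultimately show ?thesis
        using B by blast
    next
      assume "U (E - B)"
      moreover have "E - (E - B) = B"
        using B by auto
      moreover have "1 \<le> \<bar>sval m B\<bar>"
        using B by linarith
      ultimately show ?thesis
        by (intro exI[of _ "E - B"]) auto
    qed
  qed
  have "\<exists>E. \<forall>n. U (E n) \<and> (E (Suc n) \<subseteq> E n \<and> 1 \<le> \<bar>sval m (E n - E (Suc n))\<bar>)"
  proof (rule dependent_nat_choice)
    show "\<exists>E. U E"
      using \<open>U UNIV\<close> by (rule exI)
  qed (rule step)
  then obtain E where E': "\<forall>n::nat. U (E n) \<and> (E (Suc n) \<subseteq> E n \<and> 1 \<le> \<bar>sval m (E n - E (Suc n))\<bar>)"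
    by (rule exE)
  have E: "U (E n)" "E (Suc n) \<subseteq> E n" "1 \<le> \<bar>sval m (E n - E (Suc n))\<bar>" for n
    using spec[OF E', of n] by simp_all
  define A where "A n = E n - E (Suc n)" for n
  have "decseq E"
    using E(2) by (rule decseq_SucI)
  have "disjoint_family A"
  proof -
    have "A i \<inter> A j = {}" if "i < j" for i j
      using decseqD[OF \<open>decseq E\<close>, of "Suc i" j] that by (auto simp: A_def)
    then show ?thesis
      unfolding disjoint_family_on_def by (metis Int_commute linorder_neqE_nat)
  qed
  moreover have "range A \<subseteq> sets borel"
    using E(1) by (auto simp: A_def U_def)
  ultimately have "summable (\<lambda>i. sval m (A i))"
    using sval_sums sums_summable by blast
  then have "(\<lambda>i. sval m (A i)) \<longlonglongrightarrow> 0"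
    by (rule summable_LIMSEQ_zero)
  then have "eventually (\<lambda>i. \<bar>sval m (A i)\<bar> < 1) sequentially"
    by (intro order_tendstoD(2)[of _ 0]) (auto intro: tendsto_rabs_zero)
  then obtain i where "\<bar>sval m (A i)\<bar> < 1"
    by (auto simp: eventually_sequentially)
  with E(3)[of i] show False
    by (simp add: A_def)
qed

abbreviation pos_val :: "'a::topological_space signed_measure \<Rightarrow> 'a set \<Rightarrow> ennreal" where
  "pos_val m A \<equiv> (SUP B\<in>{B \<in> sets borel. B \<subseteq> A}. ennreal (sval m B))"

text \<open>Truncation at 0 is subadditive; terms of mixed sign allow no equality.\<close>

lemma ennreal_sum_le: "ennreal (\<Sum>i\<in>I. f i) \<le> (\<Sum>i\<in>I. ennreal (f i))"
proof (induction I rule: infinite_finite_induct)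
  case (insert i I)
  then have "ennreal (sum f (insert i I)) \<le> ennreal (f i) + ennreal (sum f I)"
    by (simp add: ennreal_plus_if ennreal_leI)
  also have "\<dots> \<le> ennreal (f i) + (\<Sum>i\<in>I. ennreal (f i))"
    by (intro add_left_mono insert)
  finally show ?case
    using insert by simp
qed auto

lemma SUP_add_SUP_le_ennreal:
  fixes f g :: "'b \<Rightarrow> ennreal"
  assumes "I \<noteq> {}" "J \<noteq> {}" "\<And>i j. i \<in> I \<Longrightarrow> j \<in> J \<Longrightarrow> f i + g j \<le> c"
  shows "(SUP i\<in>I. f i) + (SUP j\<in>J. g j) \<le> c"
proof -
  have "(SUP i\<in>I. f i) + (SUP j\<in>J. g j) = (SUP i\<in>I. SUP j\<in>J. f i + g j)"
    using assms by (simp add: ennreal_SUP_add_left[symmetric] ennreal_SUP_add_right[symmetric])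
  also have "\<dots> \<le> c"
    using assms by (intro SUP_least) auto
  finally show ?thesis .
qed

lemma pos_val_Un:
  assumes "A \<in> sets borel" "B \<in> sets borel" "A \<inter> B = {}"
  shows "pos_val m A + pos_val m B \<le> pos_val m (A \<union> B)"
proof (rule SUP_add_SUP_le_ennreal)
  fix C D assume C: "C \<in> {B \<in> sets borel. B \<subseteq> A}" and D: "D \<in> {C \<in> sets borel. C \<subseteq> B}"
  have "sval m C \<ge> 0 \<Longrightarrow> sval m D \<ge> 0 \<Longrightarrow> sval m (C \<union> D) = sval m C + sval m D"
    using C D assms by (intro sval_Un) auto
  \<comment> \<open>A set of negative mass contributes 0 and may be dropped: according to the signs,
    the sum is the truncated value at one of the three sets.\<close>
  then have "\<exists>E\<in>{C, D, C \<union> D}. ennreal (sval m C) + ennreal (sval m D) = ennreal (sval m E)"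
    by (cases "sval m C \<ge> 0"; cases "sval m D \<ge> 0") (auto simp: ennreal_neg)
  then show "ennreal (sval m C) + ennreal (sval m D) \<le> pos_val m (A \<union> B)"
    using C D by (auto intro!: SUP_upper)
qed (use assms in auto)

lemma pos_val_mono: "A \<subseteq> B \<Longrightarrow> pos_val m A \<le> pos_val m B"
  by (intro SUP_subset_mono) auto

text \<open>One inequality iterates superadditivity over finite unions. For the other, a competitor
  \<open>B\<close> inside the union is cut along the sets \<open>A i\<close>; the truncated partial
  sums of the masses of the slices converge to the truncated mass of \<open>B\<close>.\<close>

lemma pos_val_countably_additive: "countably_additive (sets borel) (pos_val (m :: 'a::topological_space signed_measure))"
proof (rule countably_additiveI)
  fix A :: "nat \<Rightarrow> 'a set" assume A: "range A \<subseteq> sets borel" "disjoint_family A"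
  show "(\<Sum>i. pos_val m (A i)) = pos_val m (\<Union>i. A i)"
  proof (rule antisym)
    have "(\<Sum>i<n. pos_val m (A i)) \<le> pos_val m (\<Union>i<n. A i)" for n
    proof (induction n)
      case (Suc n)
      have "(\<Sum>i<Suc n. pos_val m (A i)) \<le> pos_val m (\<Union>i<n. A i) + pos_val m (A n)"
        using Suc by (simp add: add_right_mono)
      also have "\<dots> \<le> pos_val m ((\<Union>i<n. A i) \<union> A n)"
        using A by (intro pos_val_Un) (auto, metis IntI disjoint_family_onD UNIV_I empty_iff less_irrefl)
      also have "(\<Union>i<n. A i) \<union> A n = (\<Union>i<Suc n. A i)"
        by (auto simp: lessThan_Suc)
      finally show ?case .
    qed simp
    also have "pos_val m (\<Union>i<n. A i) \<le> pos_val m (\<Union>i. A i)" for n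
      by (rule pos_val_mono) auto
    finally show "(\<Sum>i. pos_val m (A i)) \<le> pos_val m (\<Union>i. A i)"
      by (intro suminf_le_const) auto
  next
    show "pos_val m (\<Union>i. A i) \<le> (\<Sum>i. pos_val m (A i))"
    proof (rule SUP_least)
      fix B assume B: "B \<in> {B \<in> sets borel. B \<subseteq> (\<Union>i. A i)}"
      then have "(\<lambda>i. sval m (B \<inter> A i)) sums sval m (\<Union>i. B \<inter> A i)"
        using A by (intro sval_sums) (auto simp: disjoint_family_on_def)
      moreover have "(\<Union>i. B \<inter> A i) = B"
        using B by auto
      ultimately have "(\<lambda>n. \<Sum>i<n. sval m (B \<inter> A i)) \<longlonglongrightarrow> sval m B"
        by (simp add: sums_def)
      then have "(\<lambda>n. ennreal (\<Sum>i<n. sval m (B \<inter> A i))) \<longlonglongrightarrow> ennreal (sval m B)"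
        by (rule tendsto_ennrealI)
      moreover have "ennreal (\<Sum>i<n. sval m (B \<inter> A i)) \<le> (\<Sum>i. pos_val m (A i))" for n
      proof -
        have "ennreal (\<Sum>i<n. sval m (B \<inter> A i)) \<le> (\<Sum>i<n. ennreal (sval m (B \<inter> A i)))"
          by (rule ennreal_sum_le)
        also have "\<dots> \<le> (\<Sum>i<n. pos_val m (A i))"
          using A B by (intro sum_mono SUP_upper) auto
        also have "\<dots> \<le> (\<Sum>i. pos_val m (A i))"
          by (intro sum_le_suminf) auto
        finally show ?thesis .
      qed
      ultimately show "ennreal (sval m B) \<le> (\<Sum>i. pos_val m (A i))"
        by (intro LIMSEQ_le_const2) auto
    qed
  qed
qed

section \<open>The parts of a signed measure as finite measures, and the Jordan
  decomposition\<close>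

lemma sets_pos_part [simp, measurable_cong]: "sets (pos_part m) = sets borel"
  and sets_neg_part [simp, measurable_cong]: "sets (neg_part m) = sets borel"
  and sets_variation [simp, measurable_cong]: "sets (variation m) = sets borel"
  using sets.sigma_sets_eq[of borel] by (simp_all add: pos_part_def neg_part_def variation_def)

lemma space_pos_part [simp]: "space (pos_part m) = UNIV"
  and space_neg_part [simp]: "space (neg_part m) = UNIV"
  and space_variation [simp]: "space (variation m) = UNIV"
  by (simp_all add: pos_part_def neg_part_def variation_def)

lemma emeasure_pos_part:
  assumes "A \<in> sets borel"
  shows "emeasure (pos_part m) A = pos_val m A"
  unfolding pos_part_def
proof (rule emeasure_measure_of_sigma)
  show "sigma_algebra UNIV (sets borel)"
    using sets.sigma_algebra_axioms[of borel] by simp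
  show "positive (sets borel) (pos_val m)"
  proof -
    have "{B \<in> sets borel. B \<subseteq> {}} = {{}}"
      by auto
    then show ?thesis
      by (auto simp: positive_def)
  qed
qed (use assms pos_val_countably_additive in auto)

lemma emeasure_neg_part:
  "A \<in> sets borel \<Longrightarrow> emeasure (neg_part m) A = (SUP B\<in>{B \<in> sets borel. B \<subseteq> A}. ennreal (- sval m B))"
  unfolding neg_part_def by (simp add: emeasure_pos_part)

lemma finite_measure_pos_part [simp]: "finite_measure (pos_part m)"
proof (rule finite_measureI)
  obtain K where "\<And>B. \<bar>sval m B\<bar> \<le> K"
    using sval_bounded by blast
  then have "sval m B \<le> K" for B
    using abs_le_D1 by blast
  then have "emeasure (pos_part m) UNIV \<le> ennreal K"
    by (auto simp: emeasure_pos_part intro!: SUP_least ennreal_leI)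
  then show "emeasure (pos_part m) (space (pos_part m)) \<noteq> \<infinity>"
    by (auto simp: top_unique)
qed

lemma finite_measure_neg_part [simp]: "finite_measure (neg_part m)"
  by (simp add: neg_part_def)

text \<open>For \<open>B \<subseteq> A\<close> additivity gives m(B) = m(A) - m(A - B), and -m(A -
  B) is at most the negative part of A. The supremum over \<open>B\<close> gives one inequality, the
  same argument with the parts exchanged the other.\<close>

lemma sval_eq_pos_neg: "sval m A = measure (pos_part m) A - measure (neg_part m) A"
proof (cases "A \<in> sets borel")
  case True
  interpret p: finite_measure "pos_part m" by simp
  interpret n: finite_measure "neg_part m" by simp
  have 1: "measure (pos_part m) A \<le> measure (neg_part m) A + sval m A"
  proof -
    have "sval m B \<le> measure (neg_part m) A + sval m A" if "B \<in> sets borel" "B \<subseteq> A" for B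
    proof -
      have "ennreal (- sval m (A - B)) \<le> emeasure (neg_part m) A"
        using True that by (auto simp: emeasure_neg_part intro!: SUP_upper2[of "A - B"])
      then have "- sval m (A - B) \<le> measure (neg_part m) A"
        by (simp add: n.emeasure_eq_measure)
      then show ?thesis
        using sval_Diff[of A B m] True that by simp
    qed
    \<comment> \<open>The choice \<open>B = {}\<close> shows that the bound is nonnegative, so
      passing to \<open>ennreal\<close> and back does not truncate it.\<close>
    moreover from this[of "{}"] have "0 \<le> measure (neg_part m) A + sval m A"
      by simp
    ultimately have "emeasure (pos_part m) A \<le> ennreal (measure (neg_part m) A + sval m A)"
      using True by (auto simp: emeasure_pos_part intro!: SUP_least ennreal_leI)
    then show ?thesis
      using \<open>0 \<le> measure (neg_part m) A + sval m A\<close> by (simp add: p.emeasure_eq_measure)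
  qed
  have 2: "measure (neg_part m) A \<le> measure (pos_part m) A - sval m A"
  proof -
    have "- sval m B \<le> measure (pos_part m) A - sval m A" if "B \<in> sets borel" "B \<subseteq> A" for B
    proof -
      have "ennreal (sval m (A - B)) \<le> emeasure (pos_part m) A"
        using True that by (auto simp: emeasure_pos_part intro!: SUP_upper2[of "A - B"])
      then have "sval m (A - B) \<le> measure (pos_part m) A"
        by (simp add: p.emeasure_eq_measure)
      then show ?thesis
        using sval_Diff[of A B m] True that by simp
    qed
    moreover from this[of "{}"] have "0 \<le> measure (pos_part m) A - sval m A"
      by simp
    ultimately have "emeasure (neg_part m) A \<le> ennreal (measure (pos_part m) A - sval m A)"
      using True by (auto simp: emeasure_neg_part intro!: SUP_least ennreal_leI)
    then show ?thesis
      using \<open>0 \<le> measure (pos_part m) A - sval m A\<close> by (simp add: n.emeasure_eq_measure)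
  qed
  from 1 2 show ?thesis by linarith
qed (simp add: sval_not_borel measure_notin_sets)

section \<open>Sums of measures\<close>

text \<open>The body of \<open>variation\<close> with arbitrary summands, so that facts on sums of
  measures apply to \<open>variation\<close> by unfolding.\<close>

definition add_measure :: "'a::topological_space measure \<Rightarrow> 'a measure \<Rightarrow> 'a measure" where
  "add_measure M N = measure_of UNIV (sets borel) (\<lambda>A. emeasure M A + emeasure N A)"

lemma variation_eq: "variation m = add_measure (pos_part m) (neg_part m)"
  by (simp add: variation_def add_measure_def)

lemma sets_add_measure [simp, measurable_cong]: "sets (add_measure M N) = sets borel"
  using sets.sigma_sets_eq[of borel] by (simp add: add_measure_def)

lemma space_add_measure [simp]: "space (add_measure M N) = UNIV"
  by (simp add: add_measure_def)

lemma emeasure_add_measure: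
  assumes "sets M = sets borel" "sets N = sets borel" "A \<in> sets borel"
  shows "emeasure (add_measure M N) A = emeasure M A + emeasure N A"
  unfolding add_measure_def
proof (rule emeasure_measure_of_sigma)
  show "sigma_algebra UNIV (sets borel)"
    using sets.sigma_algebra_axioms[of borel] by simp
  show "positive (sets borel) (\<lambda>A. emeasure M A + emeasure N A)"
    by (auto simp: positive_def)
  show "countably_additive (sets borel) (\<lambda>A. emeasure M A + emeasure N A)"
    using assms by (auto intro!: countably_additiveI simp: suminf_add[symmetric] suminf_emeasure)
qed fact

lemma nn_integral_add_measure:
  assumes sets [simp, measurable_cong]: "sets M = sets borel" "sets N = sets borel"
    and "\<phi> \<in> borel_measurable borel"
  shows "(\<integral>\<^sup>+x. \<phi> x \<partial>add_measure M N) = (\<integral>\<^sup>+x. \<phi> x \<partial>M) + (\<integral>\<^sup>+x. \<phi> x \<partial>N)"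
  using assms(3)
proof induction
  case (cong f g)
  then show ?case by (auto cong: nn_integral_cong)
next
  case (set A)
  then show ?case by (simp add: emeasure_add_measure)
next
  case (mult u c)
  then show ?case by (simp add: nn_integral_cmult distrib_left)
next
  case (add u v)
  then show ?case by (simp add: nn_integral_add ac_simps)
next
  case (seq U)
  have *: "(\<integral>\<^sup>+x. (SUP i. U i) x \<partial>L) = (SUP i. \<integral>\<^sup>+x. U i x \<partial>L)" if "sets L = sets borel" for L :: "'a measure"
    using seq that unfolding SUP_apply by (intro nn_integral_monotone_convergence_SUP) (auto cong: measurable_cong_sets)
  have "incseq (\<lambda>i. \<integral>\<^sup>+x. U i x \<partial>L)" for L :: "'a measure"
    using seq by (auto simp: incseq_def le_fun_def intro!: nn_integral_mono)
  then show ?case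
    unfolding *[OF sets_add_measure] *[OF sets(1)] *[OF sets(2)] using seq by (simp add: ennreal_SUP_add)
qed

lemma integrable_add_measure_iff:
  fixes \<phi> :: "'a::topological_space \<Rightarrow> real"
  assumes [simp, measurable_cong]: "sets M = sets borel" "sets N = sets borel"
  shows "integrable (add_measure M N) \<phi> \<longleftrightarrow> integrable M \<phi> \<and> integrable N \<phi>"
proof -
  have "\<phi> \<in> borel_measurable borel \<Longrightarrow> (\<integral>\<^sup>+x. ennreal (norm (\<phi> x)) \<partial>add_measure M N)
      = (\<integral>\<^sup>+x. ennreal (norm (\<phi> x)) \<partial>M) + (\<integral>\<^sup>+x. ennreal (norm (\<phi> x)) \<partial>N)"
    by (intro nn_integral_add_measure) auto
  then show ?thesis
    by (auto simp: integrable_iff_bounded measurable_cong_sets[OF assms(1) refl] measurable_cong_sets[OF assms(2) refl] measurable_cong_sets[OF sets_add_measure refl])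
qed

lemma integral_add_measure:
  fixes \<phi> :: "'a::topological_space \<Rightarrow> real"
  assumes [simp, measurable_cong]: "sets M = sets borel" "sets N = sets borel"
    and int: "integrable M \<phi>" "integrable N \<phi>"
  shows "(\<integral>x. \<phi> x \<partial>add_measure M N) = (\<integral>x. \<phi> x \<partial>M) + (\<integral>x. \<phi> x \<partial>N)"
proof -
  have [measurable]: "\<phi> \<in> borel_measurable borel"
    using borel_measurable_integrable[OF int(1)] by simp
  have *: "(\<integral>\<^sup>+x. ennreal (\<phi> x) \<partial>L) < \<infinity>" "(\<integral>\<^sup>+x. ennreal (- \<phi> x) \<partial>L) < \<infinity>" if "integrable L \<phi>" for L
    using that by (auto simp: real_integrable_def less_top)
  show ?thesis
    using int *[OF int(1)] *[OF int(2)] integrable_add_measure_iff[of M N \<phi>]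
    by (simp add: real_lebesgue_integral_def nn_integral_add_measure enn2real_plus)
qed

section \<open>Integration against signed measures\<close>

lemma nn_integral_variation:
  assumes "\<phi> \<in> borel_measurable borel"
  shows "(\<integral>\<^sup>+x. \<phi> x \<partial>variation m) = (\<integral>\<^sup>+x. \<phi> x \<partial>pos_part m) + (\<integral>\<^sup>+x. \<phi> x \<partial>neg_part m)"
  using assms by (simp add: variation_eq nn_integral_add_measure)

lemma integrable_variation_iff:
  "integrable (variation m) \<phi> \<longleftrightarrow> integrable (pos_part m) \<phi> \<and> integrable (neg_part m) (\<phi> :: _ \<Rightarrow> real)"
  by (simp add: variation_eq integrable_add_measure_iff)

lemma finite_measure_variation [simp]: "finite_measure (variation m)"
proof (rule finite_measureI)
  interpret p: finite_measure "pos_part m" by simp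
  interpret n: finite_measure "neg_part m" by simp
  show "emeasure (variation m) (space (variation m)) \<noteq> \<infinity>"
    by (simp add: variation_eq emeasure_add_measure)
qed

lemma integrable_variation_bounded:
  fixes \<phi> :: "'a::topological_space \<Rightarrow> real"
  assumes "\<phi> \<in> borel_measurable borel" "\<And>x. \<bar>\<phi> x\<bar> \<le> K"
  shows "integrable (variation m) \<phi>"
  using assms by (intro finite_measure.integrable_const_bound[of _ _ K])
    (auto simp: measurable_cong_sets[OF sets_variation refl])

text \<open>A function that is not integrable has integral 0, so the bound holds in that case
  too.\<close>

lemma ennreal_abs_integral_le: "ennreal \<bar>\<integral>x. \<phi> x \<partial>M\<bar> \<le> (\<integral>\<^sup>+x. ennreal \<bar>\<phi> x\<bar> \<partial>M)"
  using integral_norm_bound_ennreal[of M \<phi>] by (cases "integrable M \<phi>") (auto simp: not_integrable_integral_eq)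

lemma ennreal_abs_signed_integral_le:
  assumes [measurable]: "\<phi> \<in> borel_measurable borel"
  shows "ennreal \<bar>signed_integral m \<phi>\<bar> \<le> (\<integral>\<^sup>+x. ennreal \<bar>\<phi> x\<bar> \<partial>variation m)"
proof -
  have "ennreal \<bar>signed_integral m \<phi>\<bar> \<le> ennreal (\<bar>\<integral>x. \<phi> x \<partial>pos_part m\<bar> + \<bar>\<integral>x. \<phi> x \<partial>neg_part m\<bar>)"
    unfolding signed_integral_def by (intro ennreal_leI) linarith
  also have "\<dots> \<le> (\<integral>\<^sup>+x. ennreal \<bar>\<phi> x\<bar> \<partial>pos_part m) + (\<integral>\<^sup>+x. ennreal \<bar>\<phi> x\<bar> \<partial>neg_part m)"
    by (simp add: add_mono ennreal_abs_integral_le)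
  finally show ?thesis
    by (simp add: nn_integral_variation)
qed

lemma signed_integral_indicator:
  assumes "A \<in> sets borel"
  shows "signed_integral m (indicator A) = sval m A"
  using assms by (simp add: signed_integral_def sval_eq_pos_neg[of m])

lemma signed_integral_add:
  "integrable (variation m) \<phi> \<Longrightarrow> integrable (variation m) \<psi> \<Longrightarrow>
    signed_integral m (\<lambda>x. \<phi> x + \<psi> x) = signed_integral m \<phi> + signed_integral m \<psi>"
  by (simp add: signed_integral_def integrable_variation_iff)

lemma signed_integral_diff:
  "integrable (variation m) \<phi> \<Longrightarrow> integrable (variation m) \<psi> \<Longrightarrow>
    signed_integral m (\<lambda>x. \<phi> x - \<psi> x) = signed_integral m \<phi> - signed_integral m \<psi>"
  by (simp add: signed_integral_def integrable_variation_iff)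

lemma signed_integral_cmult: "signed_integral m (\<lambda>x. c * \<phi> x) = c * signed_integral m \<phi>"
  by (simp add: signed_integral_def right_diff_distrib)

lemma signed_integral_const: "signed_integral m (\<lambda>x. c) = c * sval m UNIV"
  using signed_integral_cmult[of m c "indicator UNIV"] signed_integral_indicator[of UNIV m] by simp

lemma signed_integral_LIMSEQ:
  fixes \<phi> :: "nat \<Rightarrow> 'a::topological_space \<Rightarrow> real"
  assumes "\<And>n. \<phi> n \<in> borel_measurable borel" "\<psi> \<in> borel_measurable borel"
    and w: "integrable (variation m) w" and "\<And>n x. \<bar>\<phi> n x\<bar> \<le> w x" "\<And>x. (\<lambda>n. \<phi> n x) \<longlonglongrightarrow> \<psi> x"
  shows "(\<lambda>n. signed_integral m (\<phi> n)) \<longlonglongrightarrow> signed_integral m \<psi>"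
  unfolding signed_integral_def using assms
  by (intro tendsto_diff integral_dominated_convergence[where w=w])
    (auto simp: integrable_variation_iff measurable_cong_sets[OF sets_pos_part refl] measurable_cong_sets[OF sets_neg_part refl])

text \<open>Any representation as a difference of finite measures computes the integral: equality on
  Borel sets rearranges to an identity between the positive measures
  \<open>add_measure (pos_part m) N\<close> and \<open>add_measure (neg_part m) M\<close>, against
  which \<phi> is then integrated.\<close>

lemma signed_integral_eqI:
  assumes [simp, measurable_cong]: "sets M = sets borel" "sets N = sets borel"
    and fin: "finite_measure M" "finite_measure N"
    and eq: "\<And>A. A \<in> sets borel \<Longrightarrow> sval m A = measure M A - measure N A"
    and int: "integrable M \<phi>" "integrable N \<phi>" "integrable (variation m) \<phi>"
  shows "signed_integral m \<phi> = (\<integral>x. \<phi> x \<partial>M) - (\<integral>x. \<phi> x \<partial>N)"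
proof -
  interpret p: finite_measure "pos_part m" by simp
  interpret n: finite_measure "neg_part m" by simp
  interpret M: finite_measure M by fact
  interpret N: finite_measure N by fact
  have "add_measure (pos_part m) N = add_measure (neg_part m) M"
  proof (rule measure_eqI)
    fix A assume "A \<in> sets (add_measure (pos_part m) N)"
    then have A: "A \<in> sets borel"
      by simp
    have "measure (pos_part m) A + measure N A = measure (neg_part m) A + measure M A"
      using eq[OF A] sval_eq_pos_neg[of m A] by simp
    then show "emeasure (add_measure (pos_part m) N) A = emeasure (add_measure (neg_part m) M) A"
      using A by (simp add: emeasure_add_measure p.emeasure_eq_measure n.emeasure_eq_measure
          M.emeasure_eq_measure N.emeasure_eq_measure flip: ennreal_plus)
  qed simp
  then have "(\<integral>x. \<phi> x \<partial>add_measure (pos_part m) N) = (\<integral>x. \<phi> x \<partial>add_measure (neg_part m) M)"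
    by simp
  then show ?thesis
    using int by (simp add: integral_add_measure integrable_variation_iff signed_integral_def)
qed

section \<open>Subadditivity of the variation and linearity of the integral in the signed
  measure\<close>

lemma variation_plus_le: "variation (m + n) \<le> add_measure (variation m) (variation n)"
proof -
  \<comment> \<open>Subadditivity of truncation passes to the supremum; applied to the sum and to
    its negative it bounds both halves of the variation.\<close>
  have pos: "pos_val (m' + n') A \<le> pos_val m' A + pos_val n' A" for m' n' :: "'a signed_measure" and A
  proof (rule SUP_least)
    fix B assume B: "B \<in> {B \<in> sets borel. B \<subseteq> A}"
    have "ennreal (sval (m' + n') B) \<le> ennreal (sval m' B) + ennreal (sval n' B)"
      by (simp add: ennreal_plus_if ennreal_leI)
    also have "\<dots> \<le> pos_val m' A + pos_val n' A"
      using B by (intro add_mono SUP_upper) auto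
    finally show "ennreal (sval (m' + n') B) \<le> \<dots>" .
  qed
  have "emeasure (variation (m + n)) A \<le> emeasure (add_measure (variation m) (variation n)) A"
    if "A \<in> sets borel" for A
  proof -
    have "emeasure (variation (m + n)) A = pos_val (m + n) A + pos_val (- m + - n) A"
      using that by (simp add: variation_eq emeasure_add_measure emeasure_pos_part neg_part_def)
    also have "\<dots> \<le> (pos_val m A + pos_val n A) + (pos_val (- m) A + pos_val (- n) A)"
      by (intro add_mono pos)
    also have "\<dots> = (pos_val m A + pos_val (- m) A) + (pos_val n A + pos_val (- n) A)"
      by (simp only: ac_simps)
    also have "\<dots> = emeasure (add_measure (variation m) (variation n)) A"
      using that by (simp add: variation_eq emeasure_add_measure emeasure_pos_part neg_part_def)
    finally show ?thesis .
  qed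
  then have "emeasure (variation (m + n)) A \<le> emeasure (add_measure (variation m) (variation n)) A" for A
    by (cases "A \<in> sets borel") (auto simp: emeasure_notin_sets)
  then show ?thesis
    by (simp add: le_measure_iff le_fun_def)
qed

lemma variation_uminus: "variation (- m) = variation m"
  by (simp add: variation_eq neg_part_def add_measure_def add.commute)

lemma variation_scaleR: "variation (c *\<^sub>R m) = scale_measure (ennreal \<bar>c\<bar>) (variation m)"
proof -
  have pos: "variation (a *\<^sub>R m') = scale_measure (ennreal a) (variation m')" if "a \<ge> 0" for a and m' :: "'a signed_measure"
  proof (rule measure_eqI)
    fix A assume "A \<in> sets (variation (a *\<^sub>R m'))"
    then have A: "A \<in> sets borel"
      by simp
    have *: "pos_val (a *\<^sub>R n) A = ennreal a * pos_val n A" for n :: "'a signed_measure"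
      using that by (simp add: ennreal_mult' SUP_mult_left_ennreal)
    show "emeasure (variation (a *\<^sub>R m')) A = emeasure (scale_measure (ennreal a) (variation m')) A"
      using A *[of m'] *[of "- m'"]
      by (simp add: variation_eq emeasure_add_measure emeasure_pos_part neg_part_def distrib_left del: sval_scaleR sval_uminus)
  qed simp
  show ?thesis
  proof (cases "c \<ge> 0")
    case True
    then show ?thesis by (simp add: pos)
  next
    case False
    then have "variation ((- c) *\<^sub>R m) = scale_measure (ennreal \<bar>c\<bar>) (variation m)"
      using pos[of "- c" m] by simp
    then show ?thesis
      using variation_uminus[of "c *\<^sub>R m"] by simp
  qed
qed

lemma integrable_variation_plus:
  fixes \<phi> :: "'a::topological_space \<Rightarrow> real"
  assumes "integrable (variation m) \<phi>" "integrable (variation n) \<phi>"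
  shows "integrable (variation (m + n)) \<phi>"
proof -
  have "integrable (add_measure (variation m) (variation n)) \<phi>"
    using assms by (simp add: integrable_add_measure_iff)
  moreover have "(\<integral>\<^sup>+x. ennreal (norm (\<phi> x)) \<partial>variation (m + n))
      \<le> (\<integral>\<^sup>+x. ennreal (norm (\<phi> x)) \<partial>add_measure (variation m) (variation n))"
    by (intro nn_integral_mono_measure variation_plus_le) simp
  ultimately show ?thesis
    by (auto simp: integrable_iff_bounded measurable_cong_sets[OF sets_add_measure refl]
        measurable_cong_sets[OF sets_variation refl] intro: le_less_trans)
qed

text \<open>The sums of the positive and of the negative parts represent m + n as a difference of
  measures that need not be its Jordan decomposition, since mass may cancel;
  \<open>signed_integral_eqI\<close> accepts such a representation.\<close>

lemma signed_integral_plus_measure: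
  assumes "integrable (variation m) \<phi>" "integrable (variation n) \<phi>"
  shows "signed_integral (m + n) \<phi> = signed_integral m \<phi> + signed_integral n \<phi>"
proof -
  interpret p: finite_measure "pos_part m" by simp
  interpret n: finite_measure "neg_part m" by simp
  interpret p': finite_measure "pos_part n" by simp
  interpret n': finite_measure "neg_part n" by simp
  have "signed_integral (m + n) \<phi> = (\<integral>x. \<phi> x \<partial>add_measure (pos_part m) (pos_part n))
      - (\<integral>x. \<phi> x \<partial>add_measure (neg_part m) (neg_part n))"
  proof (rule signed_integral_eqI)
    show "finite_measure (add_measure (pos_part m) (pos_part n))"
      "finite_measure (add_measure (neg_part m) (neg_part n))"
      by (auto intro!: finite_measureI simp: emeasure_add_measure)
    show "sval (m + n) A = measure (add_measure (pos_part m) (pos_part n)) A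
        - measure (add_measure (neg_part m) (neg_part n)) A" if "A \<in> sets borel" for A
      using that sval_eq_pos_neg[of m A] sval_eq_pos_neg[of n A]
      by (simp add: Sigma_Algebra.measure_def emeasure_add_measure enn2real_plus
          p.emeasure_finite[unfolded infinity_ennreal_def less_top] n.emeasure_finite[unfolded infinity_ennreal_def less_top]
          p'.emeasure_finite[unfolded infinity_ennreal_def less_top] n'.emeasure_finite[unfolded infinity_ennreal_def less_top])
  qed (use assms in \<open>auto simp: integrable_add_measure_iff integrable_variation_plus integrable_variation_iff[symmetric]
        dest: integrable_variation_iff[THEN iffD1]\<close>)
  then show ?thesis
    using assms by (simp add: integral_add_measure integrable_variation_iff signed_integral_def)
qed

lemma signed_integral_uminus_measure: "signed_integral (- m) \<phi> = - signed_integral m \<phi>"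
  by (simp add: signed_integral_def neg_part_def)

lemma signed_integral_diff_measure:
  assumes "integrable (variation m) \<phi>" "integrable (variation n) \<phi>"
  shows "signed_integral (m - n) \<phi> = signed_integral m \<phi> - signed_integral n \<phi>"
  using signed_integral_plus_measure[of m \<phi> "- n"] assms
  by (simp add: variation_uminus signed_integral_uminus_measure)

lemma signed_integral_scaleR_measure:
  assumes "integrable (variation m) \<phi>"
  shows "signed_integral (c *\<^sub>R m) \<phi> = c * signed_integral m \<phi>"
proof -
  have pos: "signed_integral (a *\<^sub>R m) \<phi> = a * signed_integral m \<phi>" if "a \<ge> 0" for a
  proof -
    interpret p: finite_measure "pos_part m" by simp
    interpret n: finite_measure "neg_part m" by simp
    have [measurable]: "\<phi> \<in> borel_measurable borel"
      using borel_measurable_integrable[OF assms] by simp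
    have d: "integral\<^sup>L (density L (\<lambda>_. ennreal a)) \<phi> = a * integral\<^sup>L L \<phi>"
      "integrable L \<phi> \<Longrightarrow> integrable (density L (\<lambda>_. ennreal a)) \<phi>"
      if "sets L = sets borel" for L :: "'a measure"
      using that \<open>a \<ge> 0\<close> by (simp_all add: integral_density integrable_density measurable_cong_sets[OF that refl])
    have "signed_integral (a *\<^sub>R m) \<phi> = (\<integral>x. \<phi> x \<partial>density (pos_part m) (\<lambda>_. ennreal a))
        - (\<integral>x. \<phi> x \<partial>density (neg_part m) (\<lambda>_. ennreal a))"
    proof (rule signed_integral_eqI)
      show "finite_measure (density (pos_part m) (\<lambda>_. ennreal a))"
        "finite_measure (density (neg_part m) (\<lambda>_. ennreal a))"
        by (auto intro!: finite_measureI simp: emeasure_density nn_integral_cmult ennreal_mult_eq_top_iff)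
      show "sval (a *\<^sub>R m) A = measure (density (pos_part m) (\<lambda>_. ennreal a)) A
          - measure (density (neg_part m) (\<lambda>_. ennreal a)) A" if "A \<in> sets borel" for A
        using that \<open>a \<ge> 0\<close> sval_eq_pos_neg[of m A]
        by (simp add: Sigma_Algebra.measure_def emeasure_density_const enn2real_mult right_diff_distrib)
      show "integrable (variation (a *\<^sub>R m)) \<phi>"
        using assms by (auto simp: variation_scaleR integrable_iff_bounded nn_integral_scale_measure
          ennreal_mult_less_top measurable_cong_sets[OF sets_scale_measure refl])
    qed (use assms d in \<open>auto simp: integrable_variation_iff\<close>)
    then show ?thesis
      by (simp add: d signed_integral_def right_diff_distrib)
  qed
  show ?thesis
  proof (cases "c \<ge> 0")
    case False
    then have "signed_integral ((- c) *\<^sub>R m) \<phi> = - c * signed_integral m \<phi>"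
      by (intro pos) simp
    then show ?thesis
      by (simp add: signed_integral_uminus_measure)
  qed (simp add: pos)
qed

section \<open>The weighted norm\<close>

lemma vnorm_0 [simp]: "vnorm W 0 = 0"
proof -
  have "variation (0 :: 'a signed_measure) = scale_measure 0 (variation 0)"
    using variation_scaleR[of 0 "0 :: 'a signed_measure"] by simp
  then have "variation (0 :: 'a signed_measure) = null_measure (variation 0)"
    by simp
  then show ?thesis
    unfolding vnorm_def by (metis nn_integral_null_measure)
qed

lemma vnorm_triangle:
  assumes [measurable]: "W \<in> borel_measurable borel"
  shows "vnorm W (m + n) \<le> vnorm W m + vnorm W n"
proof -
  have "vnorm W (m + n) \<le> (\<integral>\<^sup>+x. ennreal (W x) \<partial>add_measure (variation m) (variation n))"
    unfolding vnorm_def by (intro nn_integral_mono_measure variation_plus_le) simp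
  then show ?thesis
    by (simp add: vnorm_def nn_integral_add_measure)
qed

lemma vnorm_scaleR: "W \<in> borel_measurable borel \<Longrightarrow> vnorm W (c *\<^sub>R m) = ennreal \<bar>c\<bar> * vnorm W m"
  by (simp add: vnorm_def variation_scaleR nn_integral_scale_measure measurable_cong_sets[OF sets_variation refl])

lemma vnorm_uminus [simp]: "vnorm W (- m) = vnorm W m"
  by (simp add: vnorm_def variation_uminus)

lemma vnorm_minus_commute: "vnorm W (m - n) = vnorm W (n - m)"
  using vnorm_uminus[of W "m - n"] by simp

lemma vnorm_diff_le: "W \<in> borel_measurable borel \<Longrightarrow> vnorm W (m - n) \<le> vnorm W m + vnorm W n"
  using vnorm_triangle[of W m "- n"] by simp

lemma vnorm_mono: "(\<And>x. V x \<le> W x) \<Longrightarrow> vnorm V m \<le> vnorm W m"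
  unfolding vnorm_def by (intro nn_integral_mono ennreal_leI)

lemma MV_mono: "(\<And>x. V x \<le> W x) \<Longrightarrow> MV W \<subseteq> MV V"
  using vnorm_mono[of V W] by (auto simp: MV_def intro: le_less_trans)

lemma MV_plus: "W \<in> borel_measurable borel \<Longrightarrow> m \<in> MV W \<Longrightarrow> n \<in> MV W \<Longrightarrow> m + n \<in> MV W"
  using vnorm_triangle[of W m n] by (auto simp: MV_def intro: le_less_trans)

lemma MV_minus: "W \<in> borel_measurable borel \<Longrightarrow> m \<in> MV W \<Longrightarrow> n \<in> MV W \<Longrightarrow> m - n \<in> MV W"
  using vnorm_diff_le[of W m n] by (auto simp: MV_def intro: le_less_trans)

lemma MV_scaleR: "W \<in> borel_measurable borel \<Longrightarrow> m \<in> MV W \<Longrightarrow> c *\<^sub>R m \<in> MV W"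
  by (simp add: MV_def vnorm_scaleR ennreal_mult_less_top)

lemma zero_in_MV [simp]: "0 \<in> MV W"
  by (simp add: MV_def)

lemma MV_sum: "W \<in> borel_measurable borel \<Longrightarrow> (\<And>i. i \<in> I \<Longrightarrow> m i \<in> MV W) \<Longrightarrow> (\<Sum>i\<in>I. m i) \<in> MV W"
  by (induction I rule: infinite_finite_induct) (auto intro: MV_plus)

lemma MV0_I: "m \<in> MV W \<Longrightarrow> sval m UNIV = 0 \<Longrightarrow> m \<in> MV0 W"
  and MV0_D: "m \<in> MV0 W \<Longrightarrow> m \<in> MV W" "m \<in> MV0 W \<Longrightarrow> sval m UNIV = 0"
  by (auto simp: MV0_def)

lemma MV0_plus: "W \<in> borel_measurable borel \<Longrightarrow> m \<in> MV0 W \<Longrightarrow> n \<in> MV0 W \<Longrightarrow> m + n \<in> MV0 W"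
  and MV0_minus: "W \<in> borel_measurable borel \<Longrightarrow> m \<in> MV0 W \<Longrightarrow> n \<in> MV0 W \<Longrightarrow> m - n \<in> MV0 W"
  and MV0_scaleR: "W \<in> borel_measurable borel \<Longrightarrow> m \<in> MV0 W \<Longrightarrow> c *\<^sub>R m \<in> MV0 W"
  by (auto simp: MV0_def MV_plus MV_minus MV_scaleR)

lemma MV0_sum: "W \<in> borel_measurable borel \<Longrightarrow> (\<And>i. i \<in> I \<Longrightarrow> m i \<in> MV0 W) \<Longrightarrow> (\<Sum>i\<in>I. m i) \<in> MV0 W"
  by (auto simp: MV0_def MV_sum)

lemma MV0_mono: "(\<And>x. V x \<le> W x) \<Longrightarrow> MV0 W \<subseteq> MV0 V"
  using MV_mono[of V W] by (auto simp: MV0_def)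

lemma signed_integral_le_vnorm:
  assumes [measurable]: "\<phi> \<in> borel_measurable borel" and "\<And>x. \<bar>\<phi> x\<bar> \<le> W x"
  shows "ennreal \<bar>signed_integral m \<phi>\<bar> \<le> vnorm W m"
  using ennreal_abs_signed_integral_le[of \<phi> m] assms
  by (auto simp: vnorm_def intro!: nn_integral_mono ennreal_leI elim!: order_trans)

lemma signed_integral_le_cmult_vnorm:
  assumes [measurable]: "\<phi> \<in> borel_measurable borel" "W \<in> borel_measurable borel"
    and "\<And>x. \<bar>\<phi> x\<bar> \<le> C * W x" "0 \<le> C"
  shows "ennreal \<bar>signed_integral m \<phi>\<bar> \<le> ennreal C * vnorm W m"
proof -
  have "ennreal \<bar>signed_integral m \<phi>\<bar> \<le> vnorm (\<lambda>x. C * W x) m"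
    using assms by (intro signed_integral_le_vnorm) auto
  also have "\<dots> = ennreal C * vnorm W m"
    using assms by (simp add: vnorm_def ennreal_mult' nn_integral_cmult measurable_cong_sets[OF sets_variation refl])
  finally show ?thesis .
qed

lemma abs_sval_le_vnorm:
  assumes "\<And>x. 1 \<le> W x"
  shows "ennreal \<bar>sval m A\<bar> \<le> vnorm W m"
proof (cases "A \<in> sets borel")
  case True
  then have "ennreal \<bar>signed_integral m (indicator A)\<bar> \<le> vnorm W m"
    using assms by (intro signed_integral_le_vnorm) (auto simp: indicator_def intro: order_trans[OF zero_le_one])
  then show ?thesis
    using True by (simp add: signed_integral_indicator)
qed (simp add: sval_not_borel)

lemma vnorm_eq_0:
  assumes "\<And>x. 1 \<le> W x" "vnorm W m = 0"
  shows "m = 0"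
proof (rule signed_measure_eqI)
  fix A
  have "ennreal \<bar>sval m A\<bar> \<le> 0"
    using abs_sval_le_vnorm[of W m A] assms by simp
  then show "sval m A = sval 0 A"
    by (simp add: ennreal_eq_0_iff)
qed

lemma integrable_MV:
  assumes [measurable]: "V \<in> borel_measurable borel" "\<phi> \<in> borel_measurable borel"
    and "m \<in> MV V" "\<And>x. \<bar>\<phi> x\<bar> \<le> C * V x" "\<And>x. 0 \<le> V x"
  shows "integrable (variation m) \<phi>"
proof -
  have "integrable (variation m) V"
    using assms by (auto simp: integrable_iff_bounded MV_def vnorm_def measurable_cong_sets[OF sets_variation refl])
  then have "integrable (variation m) (\<lambda>x. C * V x)"
    by simp
  then show ?thesis
    by (rule Bochner_Integration.integrable_bound)
      (simp_all add: measurable_cong_sets[OF sets_variation refl] order_trans[OF assms(4) abs_ge_self])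
qed

text \<open>
  On a Hahn set \<open>Y\<close> of \<open>m\<close> the test functions \<open>\<plusminus> min W n\<close>, with sign given by \<open>Y\<close>, exhaust the norm.
\<close>

lemma vnorm_le_dual:
  assumes [measurable]: "W \<in> borel_measurable borel" and W: "\<And>x. 0 \<le> W x"
    and dual: "\<And>\<phi> K. \<phi> \<in> borel_measurable borel \<Longrightarrow> (\<And>x. \<bar>\<phi> x\<bar> \<le> W x) \<Longrightarrow> (\<And>x. \<bar>\<phi> x\<bar> \<le> K) \<Longrightarrow>
      ennreal \<bar>signed_integral m \<phi>\<bar> \<le> c"
  shows "vnorm W m \<le> c"
proof -
  interpret p: finite_measure "pos_part m" by simp
  interpret n: finite_measure "neg_part m" by simp
  obtain Y where Y [measurable]: "Y \<in> sets borel"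
    and YP: "\<And>X. X \<in> sets borel \<Longrightarrow> X \<subseteq> Y \<Longrightarrow> emeasure (neg_part m) X \<le> emeasure (pos_part m) X"
    and YN: "\<And>X. X \<in> sets borel \<Longrightarrow> X \<inter> Y = {} \<Longrightarrow> emeasure (pos_part m) X \<le> emeasure (neg_part m) X"
    using finite_unsigned_Hahn_decomposition[of "pos_part m" "neg_part m"] by auto
  have "emeasure (neg_part m) Y = 0"
  proof -
    \<comment> \<open>Every Borel subset of \<open>Y\<close> has nonnegative mass, so only zeros
      remain in the supremum that defines the negative part of \<open>Y\<close>.\<close>
    have "sval m B \<ge> 0" if "B \<in> sets borel" "B \<subseteq> Y" for B
      using YP[OF that] sval_eq_pos_neg[of m B] by (simp add: p.emeasure_eq_measure n.emeasure_eq_measure)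
    then have "emeasure (neg_part m) Y \<le> 0"
      unfolding emeasure_neg_part[OF Y] by (intro SUP_least) (simp add: ennreal_neg)
    then show ?thesis by simp
  qed
  then have AEn: "AE x in neg_part m. x \<notin> Y"
    by (intro AE_I[of _ _ Y]) auto
  have "emeasure (pos_part m) (- Y) = 0"
  proof -
    have "sval m B \<le> 0" if "B \<in> sets borel" "B \<subseteq> - Y" for B
      using YN[of B] that sval_eq_pos_neg[of m B] by (auto simp: p.emeasure_eq_measure n.emeasure_eq_measure disjoint_eq_subset_Compl)
    moreover have Y': "- Y \<in> sets borel"
      by measurable
    ultimately have "emeasure (pos_part m) (- Y) \<le> 0"
      unfolding emeasure_pos_part[OF Y'] by (intro SUP_least) (simp add: ennreal_neg)
    then show ?thesis by simp
  qed
  then have AEp: "AE x in pos_part m. x \<in> Y"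
    by (intro AE_I[of _ _ "- Y"]) auto
  \<comment> \<open>Truncation at k keeps the test functions bounded, as \<open>dual\<close>
    demands. The bound k does not enter c, and monotone convergence removes it.\<close>
  define w where "w k x = min (W x) (real k)" for k x
  have w_meas [measurable]: "w k \<in> borel_measurable borel" for k
    unfolding w_def by measurable
  define \<phi> where "\<phi> k x = (if x \<in> Y then w k x else - w k x)" for k x
  have [measurable]: "\<phi> k \<in> borel_measurable borel" for k
    unfolding \<phi>_def by measurable
  have w0: "0 \<le> w k x" "w k x \<le> W x" "w k x \<le> real k" for k x
    using W[of x] by (auto simp: w_def)
  have "(\<integral>\<^sup>+x. ennreal (w k x) \<partial>variation m) \<le> c" for k
  proof -
    have int: "integrable (variation m) (w k)"
      using w0 by (intro integrable_variation_bounded[of _ "real k"]) auto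
    have "signed_integral m (\<phi> k) = (\<integral>x. w k x \<partial>pos_part m) - (\<integral>x. - w k x \<partial>neg_part m)"
      unfolding signed_integral_def
    proof (intro arg_cong2[of _ _ _ _ "(-)"] integral_cong_AE)
      show "AE x in pos_part m. \<phi> k x = w k x"
        using AEp by eventually_elim (simp add: \<phi>_def)
      show "AE x in neg_part m. \<phi> k x = - w k x"
        using AEn by eventually_elim (simp add: \<phi>_def)
    qed auto
    also have "\<dots> = (\<integral>x. w k x \<partial>variation m)"
      by (simp add: variation_eq integral_add_measure int[unfolded integrable_variation_iff])
    also have "ennreal \<dots> = (\<integral>\<^sup>+x. ennreal (w k x) \<partial>variation m)"
      using int w0 by (simp add: nn_integral_eq_integral)
    finally have "(\<integral>\<^sup>+x. ennreal (w k x) \<partial>variation m) = ennreal (signed_integral m (\<phi> k))"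
      by simp
    also have "\<dots> \<le> ennreal \<bar>signed_integral m (\<phi> k)\<bar>"
      by (intro ennreal_leI) simp
    also have "\<dots> \<le> c"
      using w0 by (intro dual[of _ "real k"]) (auto simp: \<phi>_def)
    finally show ?thesis .
  qed
  moreover have "vnorm W m = (SUP k. \<integral>\<^sup>+x. ennreal (w k x) \<partial>variation m)"
  proof -
    have "ennreal (W x) = (SUP k. ennreal (w k x))" for x
    proof -
      obtain k where "W x \<le> real k"
        using real_arch_simple by blast
      then have "w k x = W x"
        by (simp add: w_def)
      then show ?thesis
        using w0 by (intro antisym SUP_upper2[of k] SUP_least ennreal_leI) auto
    qed
    then have "vnorm W m = (\<integral>\<^sup>+x. (SUP k. ennreal (w k x)) \<partial>variation m)"
      by (simp add: vnorm_def)
    also have "\<dots> = (SUP k. \<integral>\<^sup>+x. ennreal (w k x) \<partial>variation m)"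
      by (intro nn_integral_monotone_convergence_SUP)
        (auto simp: incseq_def le_fun_def w_def intro!: ennreal_leI min.mono)
    finally show ?thesis .
  qed
  ultimately show ?thesis
    by (auto intro: SUP_least)
qed

text \<open>Each Jordan part is at most c on the whole space, whence the factor 2.\<close>

lemma total_variation_le:
  assumes "\<And>A. A \<in> sets borel \<Longrightarrow> \<bar>sval m A\<bar> \<le> c"
  shows "vnorm (\<lambda>_. 1) m \<le> ennreal (2 * c)"
proof -
  have "0 \<le> c"
    using assms[of "{}"] by simp
  have "emeasure (pos_part m) UNIV \<le> ennreal c" "emeasure (neg_part m) UNIV \<le> ennreal c"
    using assms by (auto simp: emeasure_pos_part emeasure_neg_part abs_le_iff intro!: SUP_least ennreal_leI)
  then have "emeasure (pos_part m) UNIV + emeasure (neg_part m) UNIV \<le> ennreal c + ennreal c"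
    by (rule add_mono)
  also have "\<dots> = ennreal (2 * c)"
    using \<open>0 \<le> c\<close> by (simp flip: ennreal_plus)
  finally show ?thesis
    by (simp add: vnorm_def variation_eq emeasure_add_measure)
qed

text \<open>Completeness of the weighted spaces in the form used for the Neumann series. A
  norm-dominated series converges on every set, and its setwise sum is again a signed measure.
  Setwise estimates control only the total variation of the remainders; their weighted norm is
  reached by duality.\<close>

lemma vnorm_series:
  fixes X :: "nat \<Rightarrow> 'a::topological_space signed_measure"
  assumes [measurable]: "W \<in> borel_measurable borel" and W: "\<And>x. 1 \<le> W x"
    and a: "summable a" "\<And>n. 0 \<le> a n" "\<And>n. vnorm W (X n) \<le> ennreal (a n)"
  shows "\<exists>s. (\<forall>A. (\<lambda>i. sval (X i) A) sums sval s A) \<and>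
    (\<forall>n. vnorm W (s - (\<Sum>i<n. X i)) \<le> ennreal (\<Sum>i. a (i + n)))"
proof -
  have sval_le: "\<bar>sval (X n) A\<bar> \<le> a n" for n A
    using order_trans[OF abs_sval_le_vnorm[OF W] a(3)] a(2) by simp
  have summable: "summable (\<lambda>i. sval (X i) A)" for A
    using a(1) sval_le by (auto intro: summable_comparison_test'[of a 0])
  have ca: "(\<lambda>j. \<Sum>i. sval (X i) (A j)) sums (\<Sum>i. sval (X i) (\<Union>j. A j))"
    if "range A \<subseteq> sets borel" "disjoint_family A" for A :: "nat \<Rightarrow> 'a set"
  proof -
    note fin = sval_UN_lessThan[OF that, symmetric]
    \<comment> \<open>Countable additivity of the sum is an exchange of two limits, justified
      because the masses of finite unions obey the same domination by \<open>a\<close>.\<close>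
    have "(\<lambda>n. \<Sum>i. \<Sum>j<n. sval (X i) (A j)) \<longlonglongrightarrow> (\<Sum>i. sval (X i) (\<Union>j. A j))"
    proof (rule tannerys_theorem[where M = a, THEN conjunct2, THEN conjunct2])
      show "(\<lambda>n. \<Sum>j<n. sval (X i) (A j)) \<longlonglongrightarrow> sval (X i) (\<Union>j. A j)" for i
        using sval_sums[OF that, of "X i"] by (simp add: sums_def)
      show "eventually (\<lambda>(i, n). norm (\<Sum>j<n. sval (X i) (A j)) \<le> a i) (at_top \<times>\<^sub>F sequentially)"
        by (intro always_eventually) (simp add: fin sval_le split_beta)
    qed (use a in auto)
    then show ?thesis
      by (simp add: sums_def suminf_sum summable)
  qed
  define s where "s = Abs_signed_measure (\<lambda>A. \<Sum>i. sval (X i) A)"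
  have s: "sval s A = (\<Sum>i. sval (X i) A)" for A
    unfolding s_def by (subst Abs_signed_measure_inverse) (auto simp: sval_not_borel ca)
  have S: "(\<lambda>i. sval (X i) A) sums sval s A" for A
    using summable by (simp add: s summable_sums)
  define tail where "tail n = (\<Sum>i. a (i + n))" for n
  have tail0: "0 \<le> tail n" for n
    unfolding tail_def using a by (intro suminf_nonneg) (auto simp: summable_iff_shift)
  have tail: "tail \<longlonglongrightarrow> 0"
    unfolding tail_def using suminf_exist_split2[OF a(1)] .
  define D where "D n = s - (\<Sum>i<n. X i)" for n
  have tv: "vnorm (\<lambda>_. 1) (D n) \<le> ennreal (2 * tail n)" for n
  proof (rule total_variation_le)
    fix A
    have "sval (D n) A = (\<Sum>i. sval (X (i + n)) A)"
      using suminf_minus_initial_segment[OF summable[of A], of n] by (simp add: D_def s)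
    also have "\<bar>\<dots>\<bar> \<le> tail n"
    proof -
      have "summable (\<lambda>i. \<bar>sval (X (i + n)) A\<bar>)"
        using a(1) sval_le by (auto simp: summable_iff_shift intro: summable_comparison_test'[of "\<lambda>i. a (i + n)" 0])
      then have "\<bar>\<Sum>i. sval (X (i + n)) A\<bar> \<le> (\<Sum>i. \<bar>sval (X (i + n)) A\<bar>)"
        by (rule summable_rabs)
      also have "\<dots> \<le> tail n"
        unfolding tail_def using a(1) \<open>summable (\<lambda>i. \<bar>sval (X (i + n)) A\<bar>)\<close> sval_le
        by (intro suminf_le) (auto simp: summable_iff_shift)
      finally show ?thesis .
    qed
    finally show "\<bar>sval (D n) A\<bar> \<le> tail n" .
  qed
  have "vnorm W (D n) \<le> ennreal (tail n)" for n
  proof (rule vnorm_le_dual)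
    fix \<phi> K assume [measurable]: "\<phi> \<in> borel_measurable borel"
      and \<phi>W: "\<And>x. \<bar>\<phi> x\<bar> \<le> W x" and \<phi>K: "\<And>x. \<bar>\<phi> x\<bar> \<le> K"
    have int: "integrable (variation m) \<phi>" for m :: "'a signed_measure"
      using \<phi>K by (intro integrable_variation_bounded) auto
    have "0 \<le> K"
      using \<phi>K[of undefined] by linarith
    have part: "vnorm W (\<Sum>i\<in>{n..<p}. X i) \<le> ennreal (tail n)" for p
    proof -
      have "vnorm W (\<Sum>i\<in>{n..<p}. X i) \<le> ennreal (\<Sum>i\<in>{n..<p}. a i)"
      proof (induction p)
        case (Suc p)
        have "vnorm W (sum X {n..<p} + X p) \<le> ennreal (sum a {n..<p}) + ennreal (a p)"
          by (rule order_trans[OF vnorm_triangle add_mono[OF Suc a(3)]]) simp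
        then show ?case
          using Suc a(2) by (cases "n \<le> p") (auto simp: sum_nonneg simp flip: ennreal_plus)
      qed simp
      also have "(\<Sum>i\<in>{n..<p}. a i) \<le> tail n"
      proof (cases "n \<le> p")
        case True
        have "(\<Sum>i\<in>{n..<p}. a i) = (\<Sum>i<p - n. a (i + n))"
          using True by (intro sum.reindex_bij_witness[of _ "\<lambda>i. i + n" "\<lambda>i. i - n"]) auto
        also have "\<dots> \<le> tail n"
          unfolding tail_def using a by (intro sum_le_suminf) (auto simp: summable_iff_shift)
        finally show ?thesis .
      qed (simp add: tail0)
      finally show ?thesis
        by (simp add: ennreal_leI)
    qed
    \<comment> \<open>The remainder is split at p. The finite block from n to p obeys the weighted
      bound \<open>tail n\<close>; the rest is estimated crudely through the sup bound K of the test
      function and vanishes as p grows, so K disappears from the result.\<close>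
    have "\<bar>signed_integral (D n) \<phi>\<bar> \<le> 2 * K * tail p + tail n" if "n \<le> p" for p
    proof -
      have "D n = D p + (\<Sum>i\<in>{n..<p}. X i)"
        using that by (simp add: D_def lessThan_atLeast0 flip: sum.atLeastLessThan_concat[of 0 n p])
      then have "signed_integral (D n) \<phi> = signed_integral (D p) \<phi> + signed_integral (\<Sum>i\<in>{n..<p}. X i) \<phi>"
        by (simp add: signed_integral_plus_measure int)
      moreover have "\<bar>signed_integral (\<Sum>i\<in>{n..<p}. X i) \<phi>\<bar> \<le> tail n"
        using order_trans[OF signed_integral_le_vnorm part, of \<phi> p] \<phi>W tail0 by simp
      moreover have "\<bar>signed_integral (D p) \<phi>\<bar> \<le> 2 * K * tail p"
      proof -
        have "ennreal \<bar>signed_integral (D p) \<phi>\<bar> \<le> ennreal K * vnorm (\<lambda>_. 1) (D p)"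
          using \<phi>K \<open>0 \<le> K\<close> by (intro signed_integral_le_cmult_vnorm) auto
        also have "\<dots> \<le> ennreal K * ennreal (2 * tail p)"
          by (intro mult_left_mono tv) simp
        also have "\<dots> = ennreal (2 * K * tail p)"
          using \<open>0 \<le> K\<close> by (simp add: ennreal_mult'[symmetric] ac_simps)
        finally show ?thesis
          using \<open>0 \<le> K\<close> tail0 by simp
      qed
      ultimately show ?thesis
        by linarith
    qed
    moreover have "(\<lambda>p. 2 * K * tail p + tail n) \<longlonglongrightarrow> 2 * K * 0 + tail n"
      by (intro tendsto_intros tail)
    ultimately have "\<bar>signed_integral (D n) \<phi>\<bar> \<le> tail n"
      by (intro LIMSEQ_le_const[of "\<lambda>p. 2 * K * tail p + tail n"]) auto
    then show "ennreal \<bar>signed_integral (D n) \<phi>\<bar> \<le> ennreal (tail n)"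
      by (rule ennreal_leI)
  qed (use W in \<open>auto intro: order_trans[OF zero_le_one]\<close>)
  then show ?thesis
    using S unfolding D_def tail_def by blast
qed

section \<open>Kernels of signed measures\<close>

text \<open>The growth bound makes \<open>sval (q x) A\<close> integrable in x against every measure
  in \<open>MV V\<close>. Bounds in other weights are stated where they are used.\<close>

definition signed_kernel ::
  "('a::topological_space \<Rightarrow> real) \<Rightarrow> ('a \<Rightarrow> 'a signed_measure) \<Rightarrow> bool" where
  "signed_kernel V q \<longleftrightarrow> (\<forall>A\<in>sets borel. (\<lambda>x. sval (q x) A) \<in> borel_measurable borel) \<and>
     (\<exists>C\<ge>0. \<forall>x. vnorm (\<lambda>_. 1) (q x) \<le> ennreal (C * V x))"

abbreviation kop :: "('a::topological_space \<Rightarrow> 'a signed_measure) \<Rightarrow> 'a signed_measure \<Rightarrow> 'a signed_measure" where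
  "kop q \<equiv> kernel_op (\<lambda>x. sval (q x))"

lemma signed_kernel_measurable:
  assumes "signed_kernel V q"
  shows "(\<lambda>x. sval (q x) A) \<in> borel_measurable borel"
  using assms by (cases "A \<in> sets borel") (auto simp: signed_kernel_def sval_not_borel)

lemma signed_kernel_bound:
  fixes q :: "'a::topological_space \<Rightarrow> 'a signed_measure"
  assumes "signed_kernel V q" "\<And>x. 1 \<le> V x"
  obtains C where "0 \<le> C" "\<And>x \<phi> K. \<phi> \<in> borel_measurable borel \<Longrightarrow> (\<And>y. \<bar>\<phi> y\<bar> \<le> K) \<Longrightarrow> \<bar>signed_integral (q x) \<phi>\<bar> \<le> K * C * V x"
proof -
  obtain C where C: "0 \<le> C" "\<And>x. vnorm (\<lambda>_. 1) (q x) \<le> ennreal (C * V x)"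
    using assms(1) by (auto simp: signed_kernel_def)
  have V0: "0 \<le> V x" for x
    using assms(2)[of x] by simp
  show ?thesis
  proof (rule that[OF C(1)])
    fix x \<phi> and K :: real assume \<phi>: "\<phi> \<in> borel_measurable borel" "\<And>y::'a. \<bar>\<phi> y\<bar> \<le> K"
    have K: "0 \<le> K"
      using \<phi>(2)[of undefined] by linarith
    have "ennreal \<bar>signed_integral (q x) \<phi>\<bar> \<le> ennreal K * vnorm (\<lambda>_. 1) (q x)"
      using \<phi> K by (intro signed_integral_le_cmult_vnorm) auto
    also have "\<dots> \<le> ennreal K * ennreal (C * V x)"
      by (intro mult_left_mono C) simp
    also have "\<dots> = ennreal (K * C * V x)"
      using K C(1) V0 by (simp add: ennreal_mult mult.assoc)
    finally show "\<bar>signed_integral (q x) \<phi>\<bar> \<le> K * C * V x"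
      using K C(1) V0 by simp
  qed
qed

text \<open>\<open>kernel_op\<close> goes through \<open>Abs_signed_measure\<close>, which says
  nothing until its argument is known to be countably additive. Dominated convergence, with a
  multiple of V as majorant, provides this.\<close>

lemma sval_kernel_op:
  assumes [measurable]: "V \<in> borel_measurable borel" and V: "\<And>x. 1 \<le> V x"
    and m: "m \<in> MV V" and q: "signed_kernel V q"
  shows "sval (kop q m) A = signed_integral m (\<lambda>x. sval (q x) A)"
proof -
  obtain C where C: "0 \<le> C" "\<And>x \<phi> K. \<phi> \<in> borel_measurable borel \<Longrightarrow> (\<And>y. \<bar>\<phi> y\<bar> \<le> K) \<Longrightarrow> \<bar>signed_integral (q x) \<phi>\<bar> \<le> K * C * V x"
    using signed_kernel_bound[OF q V] by blast
  have [measurable]: "(\<lambda>x. sval (q x) A) \<in> borel_measurable borel" for A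
    using q by (rule signed_kernel_measurable)
  have CV: "\<bar>sval (q x) A\<bar> \<le> C * V x" for x A
    using C(2)[of "indicator A" 1 x] C(1) V[of x]
    by (cases "A \<in> sets borel") (auto simp: signed_integral_indicator sval_not_borel indicator_def)
  have V0: "0 \<le> V x" for x
    using V[of x] by simp
  have int: "integrable (variation m) (\<lambda>x. sval (q x) A)" for A
    using m CV V0 by (intro integrable_MV[of V _ m C]) auto
  have "(\<lambda>j. signed_integral m (\<lambda>x. sval (q x) (A j))) sums signed_integral m (\<lambda>x. sval (q x) (\<Union>j. A j))"
    if A: "range A \<subseteq> sets borel" "disjoint_family A" for A :: "nat \<Rightarrow> 'a set"
  proof -
    note fin = sval_UN_lessThan[OF A]
    have "(\<lambda>k. signed_integral m (\<lambda>x. sval (q x) (\<Union>j<k. A j))) \<longlonglongrightarrow> signed_integral m (\<lambda>x. sval (q x) (\<Union>j. A j))"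
    proof (rule signed_integral_LIMSEQ)
      show "integrable (variation m) (\<lambda>x. C * V x)"
        using m V0 C(1) by (intro integrable_MV[of V _ m C]) (auto simp: abs_mult)
      show "(\<lambda>k. sval (q x) (\<Union>j<k. A j)) \<longlonglongrightarrow> sval (q x) (\<Union>j. A j)" for x
        using sval_sums[OF A, of "q x"] by (simp add: sums_def fin)
    qed (auto simp: CV)
    moreover have "signed_integral m (\<lambda>x. sval (q x) (\<Union>j<k. A j)) = (\<Sum>j<k. signed_integral m (\<lambda>x. sval (q x) (A j)))" for k
    proof -
      have "signed_integral m (\<lambda>x. \<Sum>j<k. sval (q x) (A j)) = (\<Sum>j<k. signed_integral m (\<lambda>x. sval (q x) (A j)))"
        using int by (simp add: signed_integral_def integrable_variation_iff sum_subtractf)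
      then show ?thesis
        by (simp add: fin)
    qed
    ultimately show ?thesis
      by (simp add: sums_def)
  qed
  moreover have "signed_integral m (\<lambda>x. 0) = 0"
    by (simp add: signed_integral_def)
  ultimately have "sval (kop q m) A = (if A \<in> sets borel then signed_integral m (\<lambda>x. sval (q x) A) else 0)"
    unfolding kernel_op_def by (subst Abs_signed_measure_inverse) (auto simp: image_subset_iff)
  then show ?thesis
    by (auto simp: sval_not_borel signed_integral_def)
qed

text \<open>Fubini's identity for signed kernels, by induction over bounded nonnegative functions
  and then by positive and negative parts. Measurability and identity are proved together because
  linearity of the outer integral requires the inner one to be integrable.\<close>

lemma signed_integral_kernel_op:
  assumes [measurable]: "V \<in> borel_measurable borel" and V: "\<And>x. 1 \<le> V x"
    and m: "m \<in> MV V" and q: "signed_kernel V q"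
    and \<phi>: "\<phi> \<in> borel_measurable borel" "\<And>x. \<bar>\<phi> x\<bar> \<le> K"
  shows "(\<lambda>x. signed_integral (q x) \<phi>) \<in> borel_measurable borel" (is "?M \<phi>")
    and "signed_integral (kop q m) \<phi> = signed_integral m (\<lambda>x. signed_integral (q x) \<phi>)" (is "?E \<phi>")
proof -
  obtain C where C: "0 \<le> C" "\<And>x \<phi> K. \<phi> \<in> borel_measurable borel \<Longrightarrow> (\<And>y. \<bar>\<phi> y\<bar> \<le> K) \<Longrightarrow> \<bar>signed_integral (q x) \<phi>\<bar> \<le> K * C * V x"
    using signed_kernel_bound[OF q V] by blast
  have V0: "0 \<le> V x" for x
    using V[of x] by simp
  have intV: "integrable (variation m) (\<lambda>x. c * V x)" for c
    using m V0 by (intro integrable_MV[of V _ m "\<bar>c\<bar>"]) (auto simp: abs_mult)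
  have int: "integrable (variation n) \<psi>" if "\<psi> \<in> borel_measurable borel" "\<And>x. \<bar>\<psi> x\<bar> \<le> L"
    for n :: "'a signed_measure" and \<psi> :: "'a \<Rightarrow> real" and L
    using that by (intro integrable_variation_bounded[of _ L])
  have intq: "integrable (variation m) (\<lambda>x. signed_integral (q x) \<psi>)"
    if "\<psi> \<in> borel_measurable borel" "\<And>x. \<bar>\<psi> x\<bar> \<le> L" "?M \<psi>" for \<psi> L
    using that C(2)[OF that(1,2)] V0 m by (intro integrable_MV[of V _ m "L * C"]) auto
  have main: "?M \<psi> \<and> ?E \<psi>" if "\<psi> \<in> borel_measurable borel" "\<And>x. 0 \<le> \<psi> x" "\<And>x. \<psi> x \<le> L" for \<psi> L
    using that
  proof (induction arbitrary: L rule: borel_measurable_induct_real)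
    case (set A)
    then show ?case
      using signed_kernel_measurable[OF q, of A] sval_kernel_op[OF _ V m q, of A]
      by (simp add: signed_integral_indicator)
  next
    case (mult u c)
    show ?case
    \<comment> \<open>For c = 0 the bound on the product does not bound u, so the induction
      hypothesis is out of reach; both sides are then 0.\<close>
    proof (cases "c = 0")
      case False
      have "u x \<le> L / c" for x
        using mult.prems[of x] mult.hyps False by (simp add: field_simps)
      then have "?M u" "?E u"
        using mult.IH by blast+
      then show ?thesis
        by (simp add: signed_integral_cmult)
    qed (simp add: signed_integral_def)
  next
    case (add u v)
    have b: "u x \<le> L" "v x \<le> L" for x
      using add.prems[of x] add.hyps(2,4)[of x] by auto
    then have uv: "?M u" "?E u" "?M v" "?E v"
      using add.IH by blast+
    have i: "integrable (variation n) u" "integrable (variation n) v" for n :: "'a signed_measure"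
      using add.hyps b by (auto intro!: int[of _ L])
    have "integrable (variation m) (\<lambda>x. signed_integral (q x) u)" "integrable (variation m) (\<lambda>x. signed_integral (q x) v)"
      using add.hyps b uv by (auto intro!: intq[of _ L])
    then show ?case
      using uv i by (simp add: signed_integral_add)
  next
    case (seq U)
    have b: "U i x \<le> L" for i x
    proof -
      have "incseq (\<lambda>i. U i x)"
        using seq.hyps(3) by (auto simp: incseq_def le_fun_def)
      then have "U i x \<le> \<psi> x"
        using seq.hyps(4) by (intro incseq_le) auto
      then show ?thesis
        using seq.prems[of x] by linarith
    qed
    then have bb: "\<bar>U i x\<bar> \<le> L" for i x
      using seq.hyps(2)[of i x] by simp
    have U: "?M (U i)" "?E (U i)" for i
      using seq.IH b by blast+
    have lim: "(\<lambda>i. signed_integral n (U i)) \<longlonglongrightarrow> signed_integral n \<psi>" for n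
      using seq.hyps bb that(1)
      by (intro signed_integral_LIMSEQ[where w = "\<lambda>_. L"] int[of _ "\<bar>L\<bar>"]) auto
    have M: "?M \<psi>"
      by (rule borel_measurable_LIMSEQ_real[OF lim U(1)])
    have "(\<lambda>i. signed_integral m (\<lambda>x. signed_integral (q x) (U i))) \<longlonglongrightarrow> signed_integral m (\<lambda>x. signed_integral (q x) \<psi>)"
      by (rule signed_integral_LIMSEQ[OF U(1) M intV[of "L * C"] C(2)[OF seq.hyps(1) bb] lim])
    moreover have "(\<lambda>i. signed_integral m (\<lambda>x. signed_integral (q x) (U i))) \<longlonglongrightarrow> signed_integral (kop q m) \<psi>"
      using lim[of "kop q m"] U by simp
    ultimately show ?case
      using M by (auto dest: LIMSEQ_unique)
  qed
  define p n where "p x = max 0 (\<phi> x)" and "n x = max 0 (- \<phi> x)" for x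
  have "\<phi> = (\<lambda>x. p x - n x)"
    by (simp add: fun_eq_iff p_def n_def max_def)
  have pm: "p \<in> borel_measurable borel" "n \<in> borel_measurable borel"
    unfolding p_def n_def using \<phi> by measurable
  have pb: "0 \<le> p x" "p x \<le> \<bar>K\<bar>" "0 \<le> n x" "n x \<le> \<bar>K\<bar>" for x
    using \<phi>(2)[of x] by (auto simp: p_def n_def)
  have pn: "?M p" "?E p" "?M n" "?E n"
    using main[OF pm(1) pb(1,2)] main[OF pm(2) pb(3,4)] by auto
  have i: "integrable (variation s) p" "integrable (variation s) n" for s :: "'a signed_measure"
    using pm pb by (auto intro!: int[of _ "\<bar>K\<bar>"])
  have "integrable (variation m) (\<lambda>x. signed_integral (q x) p)" "integrable (variation m) (\<lambda>x. signed_integral (q x) n)"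
    using pm pb pn by (auto intro!: intq[of _ "\<bar>K\<bar>"])
  then show "?M \<phi>" "?E \<phi>"
    unfolding \<open>\<phi> = _\<close> using pn i by (simp_all add: signed_integral_diff)
qed

text \<open>By Fubini's identity a test function below \<open>W\<close> integrates against the image
  measure to an average of its integrals against \<open>q x\<close>, each at most
  \<open>b x\<close>. Duality asks for bounded test functions only, and for these the identity is
  available.\<close>

lemma vnorm_kernel_op:
  assumes V: "V \<in> borel_measurable borel" "\<And>x. 1 \<le> V x"
    and m: "m \<in> MV V" and q: "signed_kernel V q"
    and [measurable]: "W \<in> borel_measurable borel" "b \<in> borel_measurable borel"
    and W: "\<And>x. 0 \<le> W x" and b: "\<And>x. vnorm W (q x) \<le> b x"
  shows "vnorm W (kop q m) \<le> (\<integral>\<^sup>+x. b x \<partial>variation m)"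
proof (rule vnorm_le_dual)
  fix \<phi> K assume \<phi>: "\<phi> \<in> borel_measurable borel" "\<And>x. \<bar>\<phi> x\<bar> \<le> W x" "\<And>x. \<bar>\<phi> x\<bar> \<le> K"
  note qm = signed_integral_kernel_op[OF V m q \<phi>(1,3)]
  have "ennreal \<bar>signed_integral (kop q m) \<phi>\<bar> \<le> (\<integral>\<^sup>+x. ennreal \<bar>signed_integral (q x) \<phi>\<bar> \<partial>variation m)"
    unfolding qm(2) by (rule ennreal_abs_signed_integral_le[OF qm(1)])
  also have "\<dots> \<le> (\<integral>\<^sup>+x. b x \<partial>variation m)"
    using \<phi> by (intro nn_integral_mono order_trans[OF signed_integral_le_vnorm[of \<phi> W] b]) auto
  finally show "ennreal \<bar>signed_integral (kop q m) \<phi>\<bar> \<le> (\<integral>\<^sup>+x. b x \<partial>variation m)" .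
qed (use W in auto)

lemma vnorm_kernel_op_le:
  assumes V: "V \<in> borel_measurable borel" "\<And>x. 1 \<le> V x"
    and m: "m \<in> MV V" and q: "signed_kernel V q"
    and W: "W \<in> borel_measurable borel" "\<And>x. 0 \<le> W x"
    and "0 \<le> C" "\<And>x. vnorm W (q x) \<le> ennreal (C * V x)"
  shows "vnorm W (kop q m) \<le> ennreal C * vnorm V m"
proof -
  have "vnorm W (kop q m) \<le> (\<integral>\<^sup>+x. ennreal (C * V x) \<partial>variation m)"
    using assms by (intro vnorm_kernel_op) auto
  also have "\<dots> = ennreal C * vnorm V m"
    using assms by (simp add: vnorm_def ennreal_mult' nn_integral_cmult measurable_cong_sets[OF sets_variation refl])
  finally show ?thesis .
qed

lemma signed_kernel_weaken:
  assumes "signed_kernel V q" "\<And>x. V x \<le> W x"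
  shows "signed_kernel W q"
proof -
  obtain C where "0 \<le> C" "\<And>x. vnorm (\<lambda>_. 1) (q x) \<le> ennreal (C * V x)"
    using assms by (auto simp: signed_kernel_def)
  moreover have "ennreal (C * V x) \<le> ennreal (C * W x)" for x
    using assms(2) \<open>0 \<le> C\<close> by (intro ennreal_leI mult_left_mono)
  ultimately show ?thesis
    using assms(1) by (auto simp: signed_kernel_def intro: order_trans)
qed

lemma signed_kernel_scaleR:
  assumes "signed_kernel V q"
  shows "signed_kernel V (\<lambda>x. c *\<^sub>R q x)"
proof -
  obtain C where C: "0 \<le> C" "\<And>x. vnorm (\<lambda>_. 1) (q x) \<le> ennreal (C * V x)"
    using assms by (auto simp: signed_kernel_def)
  have "vnorm (\<lambda>_. 1) (c *\<^sub>R q x) \<le> ennreal (\<bar>c\<bar> * C * V x)" for x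
  proof -
    have "vnorm (\<lambda>_. 1) (c *\<^sub>R q x) \<le> ennreal \<bar>c\<bar> * ennreal (C * V x)"
      using C(2)[of x] by (simp add: vnorm_scaleR mult_left_mono)
    then show ?thesis
      by (simp add: ennreal_mult'[symmetric] mult.assoc)
  qed
  then show ?thesis
    using C(1) assms by (auto simp: signed_kernel_def intro!: exI[of _ "\<bar>c\<bar> * C"])
qed

lemma signed_kernel_minus:
  assumes "signed_kernel V p" "signed_kernel V q" and V: "\<And>x. 1 \<le> V x"
  shows "signed_kernel V (\<lambda>x. p x - q x)"
proof -
  obtain B where B: "0 \<le> B" "\<And>x. vnorm (\<lambda>_. 1) (p x) \<le> ennreal (B * V x)"
    using assms(1) by (auto simp: signed_kernel_def)
  obtain C where C: "0 \<le> C" "\<And>x. vnorm (\<lambda>_. 1) (q x) \<le> ennreal (C * V x)"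
    using assms(2) by (auto simp: signed_kernel_def)
  have "vnorm (\<lambda>_. 1) (p x - q x) \<le> ennreal ((B + C) * V x)" for x
  proof -
    have "vnorm (\<lambda>_. 1) (p x - q x) \<le> ennreal (B * V x) + ennreal (C * V x)"
      using B C by (intro order_trans[OF vnorm_diff_le] add_mono) auto
    then show ?thesis
      using B C V[of x] by (simp add: distrib_right)
  qed
  then show ?thesis
    using B C assms by (auto simp: signed_kernel_def intro!: exI[of _ "B + C"] borel_measurable_diff)
qed

lemma integrable_signed_kernel:
  assumes V: "V \<in> borel_measurable borel" "\<And>x. 1 \<le> V x" and m: "m \<in> MV V" and q: "signed_kernel V q"
  shows "integrable (variation m) (\<lambda>x. sval (q x) A)"
proof -
  obtain C where C: "0 \<le> C" "\<And>x. vnorm (\<lambda>_. 1) (q x) \<le> ennreal (C * V x)"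
    using q by (auto simp: signed_kernel_def)
  have V0: "0 \<le> V x" for x
    using V(2)[of x] by simp
  have "\<bar>sval (q x) A\<bar> \<le> C * V x" for x
    using order_trans[OF abs_sval_le_vnorm[of "\<lambda>_. 1" "q x" A] C(2)] C(1) V0[of x] by simp
  then show ?thesis
    using V V0 m signed_kernel_measurable[OF q] by (intro integrable_MV[of V _ m C]) auto
qed

section \<open>Linearity of kernel operators in the measure and in the kernel\<close>

context
  fixes V :: "'a::topological_space \<Rightarrow> real"
  assumes V: "V \<in> borel_measurable borel" "\<And>x. 1 \<le> V x"
begin

lemma kernel_op_plus:
  assumes "signed_kernel V q" "m \<in> MV V" "n \<in> MV V"
  shows "kop q (m + n) = kop q m + kop q n"
  using assms V by (intro signed_measure_eqI)
    (simp add: sval_kernel_op MV_plus signed_integral_plus_measure integrable_signed_kernel)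

lemma kernel_op_scaleR:
  assumes "signed_kernel V q" "m \<in> MV V"
  shows "kop q (c *\<^sub>R m) = c *\<^sub>R kop q m"
  using assms V by (intro signed_measure_eqI)
    (simp add: sval_kernel_op MV_scaleR signed_integral_scaleR_measure integrable_signed_kernel)

lemma kernel_op_scaleR_kernel:
  assumes "signed_kernel V q" "m \<in> MV V"
  shows "kop (\<lambda>x. c *\<^sub>R q x) m = c *\<^sub>R kop q m"
  using assms V by (intro signed_measure_eqI)
    (simp only: sval_kernel_op signed_kernel_scaleR sval_scaleR signed_integral_cmult)

lemma kernel_op_minus_kernel:
  assumes "signed_kernel V p" "signed_kernel V q" "m \<in> MV V"
  shows "kop (\<lambda>x. p x - q x) m = kop p m - kop q m"
  using assms V by (intro signed_measure_eqI)
    (simp only: sval_kernel_op signed_kernel_minus sval_minus signed_integral_diff integrable_signed_kernel)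

end

lemma kernel_op_cong:
  assumes "\<And>x A. A \<in> sets borel \<Longrightarrow> Q x A = Q' x A"
  shows "kernel_op Q = kernel_op Q'"
  unfolding kernel_op_def using assms by (intro ext arg_cong[of _ _ Abs_signed_measure]) auto

section \<open>Resolvents and derivatives of a uniformly ergodic family\<close>

definition vnull :: "real \<Rightarrow> ('a::topological_space \<Rightarrow> real) \<Rightarrow> (real \<Rightarrow> 'a signed_measure) \<Rightarrow> bool" where
  "vnull u W X \<longleftrightarrow> ((\<lambda>h. vnorm W (X h)) \<longlongrightarrow> 0) (increments u)"

section \<open>Families that tend to zero along admissible increments\<close>

lemma eventually_increments: "eventually (\<lambda>h. u + h \<in> {0..1} \<and> h \<noteq> 0) (increments u)"
  by (auto simp: eventually_at_filter)

text \<open>Positive increments are admissible for u < 1, negative ones at u = 1. Nontriviality of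
  the filter is what allows a constant to be bounded by a limit along it.\<close>

lemma increments_neq_bot:
  assumes "u \<in> {0..1}"
  shows "increments u \<noteq> bot"
proof -
  have "(0::real) islimpt {h. u + h \<in> {0..1}}"
  proof (cases "u < 1")
    case True
    have "(0::real) islimpt {0<..<1 - u}"
      using True by (simp add: islimpt_greaterThanLessThan1)
    then show ?thesis
      by (rule islimpt_subset) (use assms in auto)
  next
    case False
    have "(0::real) islimpt {- u<..<0}"
      using False by (simp add: islimpt_greaterThanLessThan2)
    then show ?thesis
      by (rule islimpt_subset) (use assms in auto)
  qed
  then show ?thesis
    by (simp add: trivial_limit_within)
qed

lemma vnull_mono:
  assumes "vnull u W X" and "\<And>h. u + h \<in> {0..1} \<Longrightarrow> h \<noteq> 0 \<Longrightarrow> vnorm W' (Y h) \<le> ennreal C * vnorm W (X h)"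
  shows "vnull u W' Y"
  unfolding vnull_def
proof (rule tendsto_sandwich[OF _ _ tendsto_const])
  show "((\<lambda>h. ennreal C * vnorm W (X h)) \<longlongrightarrow> 0) (increments u)"
    using ennreal_tendsto_cmult[OF _ assms(1)[unfolded vnull_def], of "ennreal C"] by (simp add: less_top[symmetric] del: atLeastAtMost_iff)
  show "eventually (\<lambda>h. vnorm W' (Y h) \<le> ennreal C * vnorm W (X h)) (increments u)"
    using eventually_increments[of u] by eventually_elim (rule assms(2), auto)
qed simp

lemma vnull_add:
  assumes "W \<in> borel_measurable borel" "vnull u W X" "vnull u W Y"
  shows "vnull u W (\<lambda>h. X h + Y h)"
  unfolding vnull_def
proof (rule tendsto_sandwich[OF _ _ tendsto_const])
  show "((\<lambda>h. vnorm W (X h) + vnorm W (Y h)) \<longlongrightarrow> 0) (increments u)"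
    using tendsto_add[OF assms(2,3)[unfolded vnull_def]] by simp
  show "eventually (\<lambda>h. vnorm W (X h + Y h) \<le> vnorm W (X h) + vnorm W (Y h)) (increments u)"
    using assms(1) by (intro always_eventually allI vnorm_triangle)
qed simp

lemma vnull_cong:
  assumes "vnull u W X" "\<And>h. u + h \<in> {0..1} \<Longrightarrow> h \<noteq> 0 \<Longrightarrow> Y h = X h"
  shows "vnull u W Y"
  by (rule vnull_mono[OF assms(1), of _ _ 1]) (simp add: assms(2))

lemma vnull_scaleR:
  assumes "W \<in> borel_measurable borel" "vnull u W X"
  shows "vnull u W (\<lambda>h. c *\<^sub>R X h)"
  by (rule vnull_mono[OF assms(2), of _ _ "\<bar>c\<bar>"]) (simp add: vnorm_scaleR assms(1))

lemma vnull_sum: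
  assumes "W \<in> borel_measurable borel" "\<And>i. i \<in> I \<Longrightarrow> vnull u W (X i)"
  shows "vnull u W (\<lambda>h. \<Sum>i\<in>I. X i h)"
  using assms(2)
proof (induction I rule: infinite_finite_induct)
  case (insert i I)
  then show ?case
    by (simp add: vnull_add[OF assms(1)])
qed (simp_all add: vnull_def)

text \<open>What the perturbation argument uses, stated without kernels or densities.
  \<open>D l\<close> stands for the l-th derivative of \<open>D 0\<close>, and the indices
  \<open>s + l\<close> and \<open>s\<close> record that l derivatives cost l weights. Ergodicity
  appears as decay on measures of mass zero, the form it takes once (B1) has been
  integrated.\<close>

locale ergodic_family =
  fixes V :: "nat \<Rightarrow> 'a::topological_space \<Rightarrow> real" and k :: nat
    and D :: "nat \<Rightarrow> real \<Rightarrow> 'a signed_measure \<Rightarrow> 'a signed_measure"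
    and \<pi> :: "real \<Rightarrow> 'a signed_measure"
  assumes V_meas: "\<And>l. l \<le> k \<Longrightarrow> V l \<in> borel_measurable borel"
    and V_ge1: "\<And>l x. l \<le> k \<Longrightarrow> 1 \<le> V l x"
    and V_mono: "\<And>i j x. i \<le> j \<Longrightarrow> j \<le> k \<Longrightarrow> V i x \<le> V j x"
    and D_linear: "\<And>l u. l \<le> k \<Longrightarrow> u \<in> {0..1} \<Longrightarrow> linear_map_on (MV (V l)) (D l u)"
    and D_bound: "\<exists>C\<ge>0. \<forall>s l u m. s + l \<le> k \<longrightarrow> u \<in> {0..1} \<longrightarrow> m \<in> MV (V (s + l)) \<longrightarrow>
      vnorm (V s) (D l u m) \<le> ennreal C * vnorm (V (s + l)) m"
    and D_cont: "\<And>s l u m. s + l \<le> k \<Longrightarrow> u \<in> {0..1} \<Longrightarrow> m \<in> MV (V (s + l)) \<Longrightarrow>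
      vnull u (V s) (\<lambda>h. D l (u + h) m - D l u m)"
    and D_deriv: "\<And>s l u m. s + Suc l \<le> k \<Longrightarrow> u \<in> {0..1} \<Longrightarrow> m \<in> MV (V (s + Suc l)) \<Longrightarrow>
      vnull u (V s) (\<lambda>h. (D l (u + h) m - D l u m) /\<^sub>R h - D (Suc l) u m)"
    and mass: "\<And>u m. u \<in> {0..1} \<Longrightarrow> m \<in> MV (V 0) \<Longrightarrow> sval (D 0 u m) UNIV = sval m UNIV"
    and ergodic: "\<And>l. l \<le> k \<Longrightarrow> \<exists>c \<kappa> N. 0 < c \<and> 0 < \<kappa> \<and> \<kappa> < 1 \<and>
      (\<forall>n\<ge>N. \<forall>u\<in>{0..1}. \<forall>m\<in>MV0 (V l). vnorm (V l) ((D 0 u ^^ n) m) \<le> ennreal (c * \<kappa> ^ n) * vnorm (V l) m)"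
    and stationary: "\<And>u. u \<in> {0..1} \<Longrightarrow> \<pi> u \<in> MV (V k)" "\<And>u. u \<in> {0..1} \<Longrightarrow> D 0 u (\<pi> u) = \<pi> u"
      "\<And>u. u \<in> {0..1} \<Longrightarrow> sval (\<pi> u) UNIV = 1"
begin

abbreviation T :: "real \<Rightarrow> 'a signed_measure \<Rightarrow> 'a signed_measure" where
  "T \<equiv> D 0"

abbreviation R :: "nat \<Rightarrow> real \<Rightarrow> 'a signed_measure \<Rightarrow> 'a signed_measure" where
  "R l u \<equiv> inv_into (MV0 (V l)) (\<lambda>m. m - T u m)"

section \<open>Mapping properties of the operators and their effect on total mass\<close>

lemma MV_V_mono: "m \<in> MV (V j) \<Longrightarrow> i \<le> j \<Longrightarrow> j \<le> k \<Longrightarrow> m \<in> MV (V i)"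
  using MV_mono[of "V i" "V j"] V_mono[of i j] by blast

lemma MV0_V_mono: "m \<in> MV0 (V j) \<Longrightarrow> i \<le> j \<Longrightarrow> j \<le> k \<Longrightarrow> m \<in> MV0 (V i)"
  using MV0_mono[of "V i" "V j"] V_mono[of i j] by blast

lemma D_mem:
  assumes "s + l \<le> k" "u \<in> {0..1}" "m \<in> MV (V (s + l))"
  shows "D l u m \<in> MV (V s)"
proof -
  obtain C where "vnorm (V s) (D l u m) \<le> ennreal C * vnorm (V (s + l)) m"
    using D_bound assms by blast
  also have "\<dots> < \<infinity>"
    using assms(3) by (simp add: MV_def ennreal_mult_less_top)
  finally show ?thesis
    by (simp add: MV_def)
qed

lemma D_linear':
  assumes "s + l \<le> k" "u \<in> {0..1}" "m \<in> MV (V (s + l))" "n \<in> MV (V (s + l))"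
  shows "D l u (m + n) = D l u m + D l u n" "D l u (m - n) = D l u m - D l u n" "D l u (c *\<^sub>R m) = c *\<^sub>R D l u m"
proof -
  have m: "m \<in> MV (V l)" "n \<in> MV (V l)"
    using assms by (auto intro: MV_V_mono[of _ "s + l"])
  have add: "\<And>m n. m \<in> MV (V l) \<Longrightarrow> n \<in> MV (V l) \<Longrightarrow> D l u (m + n) = D l u m + D l u n"
    and scale: "\<And>m c. m \<in> MV (V l) \<Longrightarrow> D l u (c *\<^sub>R m) = c *\<^sub>R D l u m"
    using D_linear[of l u] assms by (auto simp: linear_map_on_def)
  show "D l u (m + n) = D l u m + D l u n" "D l u (c *\<^sub>R m) = c *\<^sub>R D l u m"
    using m by (auto simp: add scale)
  show "D l u (m - n) = D l u m - D l u n"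
    using add[OF m(1), of "(-1) *\<^sub>R n"] scale[OF m(2), of "-1"] m assms V_meas[of l] by (simp add: MV_scaleR[of _ _ "-1", simplified])
qed

lemma T_mem: "l \<le> k \<Longrightarrow> u \<in> {0..1} \<Longrightarrow> m \<in> MV (V l) \<Longrightarrow> T u m \<in> MV (V l)"
  using D_mem[of l 0 u m] by simp

lemma T_mem0: "l \<le> k \<Longrightarrow> u \<in> {0..1} \<Longrightarrow> m \<in> MV0 (V l) \<Longrightarrow> T u m \<in> MV0 (V l)"
  using T_mem[of l u m] mass[of u m] MV_V_mono[of m l 0] by (auto simp: MV0_def)

lemma T_power_mem0: "l \<le> k \<Longrightarrow> u \<in> {0..1} \<Longrightarrow> m \<in> MV0 (V l) \<Longrightarrow> (T u ^^ n) m \<in> MV0 (V l)"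
  by (induction n) (auto intro: T_mem0)

lemma T_diff_mem0:
  assumes "l \<le> k" "u \<in> {0..1}" "v \<in> {0..1}" "m \<in> MV (V l)"
  shows "T v m - T u m \<in> MV0 (V l)"
  using assms T_mem[of l u m] T_mem[of l v m] mass[of u m] mass[of v m] MV_V_mono[of m l 0]
  by (auto intro!: MV0_I MV_minus V_meas)

text \<open>Total mass is dominated by the norm of the lightest weight, so the masses of the
  difference quotients, all zero, converge to the mass of the derivative.\<close>

lemma D_mass_step:
  assumes "Suc l \<le> k" "u \<in> {0..1}" "m \<in> MV (V (Suc l))"
    and "\<And>v. v \<in> {0..1} \<Longrightarrow> sval (D l v m) UNIV = c"
  shows "sval (D (Suc l) u m) UNIV = 0"
proof -
  have "ennreal \<bar>sval (D (Suc l) u m) UNIV\<bar> \<le> 0"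
  proof (rule tendsto_lowerbound[OF _ _ increments_neq_bot])
    show "((\<lambda>h. vnorm (V 0) ((D l (u + h) m - D l u m) /\<^sub>R h - D (Suc l) u m)) \<longlongrightarrow> 0) (increments u)"
      using D_deriv[of 0 l u m] assms by (simp only: vnull_def add_0)
    show "eventually (\<lambda>h. ennreal \<bar>sval (D (Suc l) u m) UNIV\<bar>
        \<le> vnorm (V 0) ((D l (u + h) m - D l u m) /\<^sub>R h - D (Suc l) u m)) (increments u)"
      using eventually_increments[of u]
    proof eventually_elim
      case (elim h)
      then show ?case
        using abs_sval_le_vnorm[of "V 0" "(D l (u + h) m - D l u m) /\<^sub>R h - D (Suc l) u m" UNIV] V_ge1[of 0] assms(2)
        by (simp add: assms(4))
    qed
  qed fact
  then show ?thesis
    by simp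
qed

lemma D_mass0:
  assumes "Suc l \<le> k" "u \<in> {0..1}" "m \<in> MV (V (Suc l))"
  shows "sval (D (Suc l) u m) UNIV = 0"
  using assms
proof (induction l arbitrary: u)
  case 0
  \<comment> \<open>Order 0 preserves the mass of \<open>m\<close>, which is the constant here; from
    order 1 on the constant is 0.\<close>
  then show ?case
    by (intro D_mass_step[of 0 u m "sval m UNIV"]) (auto intro: mass MV_V_mono)
next
  case (Suc l)
  then have "m \<in> MV (V (Suc l))"
    by (auto intro: MV_V_mono[of m "Suc (Suc l)"])
  with Suc show ?case
    by (intro D_mass_step[of "Suc l" u m 0]) auto
qed

lemma D_mem0:
  assumes l: "s + Suc l \<le> k" and u: "u \<in> {0..1}" and m: "m \<in> MV (V (s + Suc l))"
  shows "D (Suc l) u m \<in> MV0 (V s)"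
proof (rule MV0_I[OF D_mem[OF l u m]])
  have "m \<in> MV (V (Suc l))"
    by (rule MV_V_mono[OF m]) (use l in auto)
  then show "sval (D (Suc l) u m) UNIV = 0"
    using l u by (intro D_mass0) auto
qed

section \<open>Neumann series and resolvents\<close>

lemma vnorm_T_power_summable:
  assumes "l \<le> k"
  shows "\<exists>a. summable a \<and> (\<forall>n. 0 \<le> a n) \<and>
    (\<forall>n. \<forall>u\<in>{0..1}. \<forall>m\<in>MV0 (V l). vnorm (V l) ((T u ^^ n) m) \<le> ennreal (a n) * vnorm (V l) m)"
proof -
  obtain c \<kappa> N where e: "0 < c" "0 < \<kappa>" "\<kappa> < 1" and
    cN: "\<forall>n\<ge>N. \<forall>u\<in>{0..1}. \<forall>m\<in>MV0 (V l). vnorm (V l) ((T u ^^ n) m) \<le> ennreal (c * \<kappa> ^ n) * vnorm (V l) m"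
    using ergodic[OF assms] by blast
  obtain C where "0 \<le> C" "\<forall>s l u m. s + l \<le> k \<longrightarrow> u \<in> {0..1} \<longrightarrow> m \<in> MV (V (s + l)) \<longrightarrow>
      vnorm (V s) (D l u m) \<le> ennreal C * vnorm (V (s + l)) m"
    using D_bound by blast
  note C = this(1) this(2)[rule_format]
  have pow: "vnorm (V l) ((T u ^^ n) m) \<le> ennreal (C ^ n) * vnorm (V l) m" if "u \<in> {0..1}" "m \<in> MV0 (V l)" for n u m
  proof (induction n)
    case (Suc n)
    have "vnorm (V l) ((T u ^^ Suc n) m) \<le> ennreal C * vnorm (V l) ((T u ^^ n) m)"
      using C(2)[of l 0 u "(T u ^^ n) m"] T_power_mem0[OF assms that] assms that by (simp add: MV0_D)
    also have "\<dots> \<le> ennreal C * (ennreal (C ^ n) * vnorm (V l) m)"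
      by (intro mult_left_mono Suc) simp
    finally show ?case
      using C(1) by (simp add: ennreal_mult mult.assoc)
  qed simp
  \<comment> \<open>Decay is known only from \<open>N\<close> on; for the finitely many earlier
    powers the crude bound \<open>C ^ n\<close> does not disturb summability.\<close>
  define a where "a n = (if n < N then C ^ n else c * \<kappa> ^ n)" for n
  show ?thesis
  proof (intro exI[of _ a] conjI allI ballI)
    have "eventually (\<lambda>n. a n = c * \<kappa> ^ n) sequentially"
      unfolding eventually_sequentially a_def by (intro exI[of _ N]) auto
    then show "summable a"
      using e by (simp add: summable_cong summable_mult summable_geometric)
    show "0 \<le> a n" for n
      using e C(1) by (simp add: a_def)
    show "vnorm (V l) ((T u ^^ n) m) \<le> ennreal (a n) * vnorm (V l) m" if "u \<in> {0..1}" "m \<in> MV0 (V l)" for n u m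
      using pow[OF that] cN that by (simp add: a_def)
  qed
qed

lemma T_power_diff0:
  assumes "l \<le> k" "u \<in> {0..1}" "m \<in> MV0 (V l)"
  shows "(\<Sum>i<n. (T u ^^ i) m) - T u (\<Sum>i<n. (T u ^^ i) m) = m - (T u ^^ n) m"
proof (induction n)
  case 0
  have "T u (0 *\<^sub>R m) = 0 *\<^sub>R T u m"
    using assms by (intro D_linear'(3)[of l 0 u m m]) (auto simp: MV0_D)
  then show ?case by simp
next
  case (Suc n)
  have "(\<Sum>i<n. (T u ^^ i) m) \<in> MV (V l)"
    using assms by (intro MV_sum V_meas T_power_mem0[THEN MV0_D(1)])
  then have "T u (\<Sum>i<Suc n. (T u ^^ i) m) = T u (\<Sum>i<n. (T u ^^ i) m) + (T u ^^ Suc n) m"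
    using assms T_power_mem0[OF assms, of n] by (simp add: D_linear'(1)[of l 0] MV0_D)
  then show ?case
    using Suc by (simp add: algebra_simps)
qed

text \<open>The norm of a fixed point is at most \<open>a n\<close> times itself for every n, so it
  vanishes. A solution is the sum of the Neumann series, which \<open>vnorm_series\<close> provides.
  The sequence \<open>a\<close> is chosen before u, which makes all later bounds uniform.\<close>

lemma resolvent:
  assumes "l \<le> k"
  shows "\<exists>a. summable a \<and> (\<forall>n. 0 \<le> a n) \<and>
    (\<forall>u\<in>{0..1}. \<forall>m\<in>MV0 (V l). (T u m = m \<longrightarrow> m = 0) \<and> (\<exists>s\<in>MV0 (V l). s - T u s = m \<and>
      (\<forall>n. vnorm (V l) (s - (\<Sum>i<n. (T u ^^ i) m)) \<le> ennreal (\<Sum>i. a (i + n)) * vnorm (V l) m)))"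
proof -
  note Vm [measurable] = V_meas[OF assms]
  obtain a where "summable a" "\<forall>n. 0 \<le> a n"
    "\<forall>n. \<forall>u\<in>{0..1}. \<forall>m\<in>MV0 (V l). vnorm (V l) ((T u ^^ n) m) \<le> ennreal (a n) * vnorm (V l) m"
    using vnorm_T_power_summable[OF assms] by blast
  note a = this(1) this(2,3)[rule_format]
  obtain C where "0 \<le> C" "\<forall>s l u m. s + l \<le> k \<longrightarrow> u \<in> {0..1} \<longrightarrow> m \<in> MV (V (s + l)) \<longrightarrow>
      vnorm (V s) (D l u m) \<le> ennreal C * vnorm (V (s + l)) m"
    using D_bound by blast
  note C = this(1) this(2)[rule_format]
  have tail: "(\<lambda>n. \<Sum>i. a (i + n)) \<longlonglongrightarrow> 0"
    using suminf_exist_split2[OF a(1)] .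
  have a0: "a \<longlonglongrightarrow> 0"
    using a(1) by (rule summable_LIMSEQ_zero)
  have lim0: "x = 0" if "\<And>n. x \<le> ennreal (b n) * y" "b \<longlonglongrightarrow> 0" "y < \<infinity>" for x y :: ennreal and b
  proof -
    have "(\<lambda>n. y * ennreal (b n)) \<longlonglongrightarrow> y * ennreal 0"
      using that by (intro ennreal_tendsto_cmult tendsto_ennrealI) auto
    then have "x \<le> 0"
      using that by (intro LIMSEQ_le_const[of "\<lambda>n. y * ennreal (b n)" 0]) (auto simp: mult.commute)
    then show ?thesis by simp
  qed
  show ?thesis
  proof (intro exI[of _ a] conjI allI ballI impI a(1,2))
    fix u :: real and m assume u: "u \<in> {0..1}" and m: "m \<in> MV0 (V l)" and "T u m = m"
    then have "(T u ^^ n) m = m" for n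
      by (induction n) auto
    then have "vnorm (V l) m = 0"
      using a(3)[OF u m] m a0 by (intro lim0[of _ a "vnorm (V l) m"]) (auto simp: MV0_def MV_def)
    then show "m = 0"
      using V_ge1[OF assms] by (rule vnorm_eq_0[rotated])
  next
    fix u :: real and m assume u: "u \<in> {0..1}" and m: "m \<in> MV0 (V l)"
    define S where "S n = (\<Sum>i<n. (T u ^^ i) m)" for n
    obtain r where r: "0 \<le> r" "vnorm (V l) m = ennreal r"
      using m by (cases "vnorm (V l) m") (auto simp: MV0_def MV_def)
    obtain s where s: "\<And>A. (\<lambda>i. sval ((T u ^^ i) m) A) sums sval s A"
      and sS: "\<And>n. vnorm (V l) (s - S n) \<le> ennreal (\<Sum>i. a (i + n) * r)"
      using vnorm_series[OF Vm V_ge1[OF assms], of "\<lambda>n. a n * r" "\<lambda>i. (T u ^^ i) m"] a(3)[OF u m] a(1,2) r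
      unfolding S_def by (auto simp: summable_mult2 ennreal_mult)
    have "(\<Sum>i. a (i + n) * r) = (\<Sum>i. a (i + n)) * r" for n
      using a(1) by (intro suminf_mult2[symmetric]) (simp add: summable_iff_shift)
    moreover have sum0: "0 \<le> (\<Sum>i. a (i + n))" for n
      using a by (intro suminf_nonneg) (auto simp: summable_iff_shift)
    ultimately have sS': "vnorm (V l) (s - S n) \<le> ennreal (\<Sum>i. a (i + n)) * vnorm (V l) m" for n
      using sS[of n] r by (simp add: ennreal_mult)
    have S: "S n \<in> MV0 (V l)" for n
      unfolding S_def using assms u m by (intro MV0_sum V_meas T_power_mem0)
    have "vnorm (V l) s < \<infinity>"
      using sS[of 0] by (auto simp: S_def intro: le_less_trans)
    moreover have "sval s UNIV = 0"
    proof -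
      have "(\<lambda>i. sval ((T u ^^ i) m) UNIV) = (\<lambda>i. 0)"
        using T_power_mem0[OF assms u m] by (auto simp: MV0_def)
      then show ?thesis
        using s[of UNIV] sums_unique2[OF sums_zero] by metis
    qed
    ultimately have s0: "s \<in> MV0 (V l)"
      by (simp add: MV0_def MV_def)
    \<comment> \<open>The partial sum \<open>S n\<close> solves the equation up to
      \<open>(T u ^^ n) m\<close>. Replacing \<open>s\<close> by \<open>S n\<close> costs the tail
      once directly and once through \<open>T u\<close>, whose norm is at most C.\<close>
    have "vnorm (V l) (s - T u s - m) \<le> ennreal ((\<Sum>i. a (i + n)) + C * (\<Sum>i. a (i + n)) + a n) * vnorm (V l) m" for n
    proof -
      have "S n - T u (S n) = m - (T u ^^ n) m"
        unfolding S_def by (rule T_power_diff0[OF assms u m])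
      moreover have "T u (s - S n) = T u s - T u (S n)"
        using assms u s0 S by (intro D_linear'(2)[of l 0]) (auto simp: MV0_D)
      moreover have "s - T u s - m = ((s - S n) - (T u s - T u (S n))) + ((S n - T u (S n)) - m)"
        by simp
      ultimately have "s - T u s - m = ((s - S n) - T u (s - S n)) - (T u ^^ n) m"
        by simp
      also have "vnorm (V l) \<dots> \<le> (vnorm (V l) (s - S n) + vnorm (V l) (T u (s - S n))) + vnorm (V l) ((T u ^^ n) m)"
        by (intro order_trans[OF vnorm_diff_le] add_mono order_refl) auto
      also have "\<dots> \<le> (vnorm (V l) (s - S n) + ennreal C * vnorm (V l) (s - S n)) + ennreal (a n) * vnorm (V l) m"
        using C(2)[of l 0 u "s - S n"] assms u s0 S m by (intro add_mono a(3)) (auto simp: MV0_D MV_minus)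
      also have "\<dots> \<le> (ennreal (\<Sum>i. a (i + n)) * vnorm (V l) m + ennreal C * (ennreal (\<Sum>i. a (i + n)) * vnorm (V l) m))
          + ennreal (a n) * vnorm (V l) m"
        by (intro add_mono mult_left_mono sS') auto
      also have "\<dots> = ennreal ((\<Sum>i. a (i + n)) + C * (\<Sum>i. a (i + n)) + a n) * vnorm (V l) m"
        using sum0[of n] C(1) a(2)[of n] by (simp add: ennreal_plus ennreal_mult distrib_right mult.assoc)
      finally show ?thesis .
    qed
    moreover have "(\<lambda>n. (\<Sum>i. a (i + n)) + C * (\<Sum>i. a (i + n)) + a n) \<longlonglongrightarrow> 0 + C * 0 + 0"
      by (intro tendsto_intros tail a0)
    ultimately have "vnorm (V l) (s - T u s - m) = 0"
      using m by (intro lim0[of _ "\<lambda>n. (\<Sum>i. a (i + n)) + C * (\<Sum>i. a (i + n)) + a n" "vnorm (V l) m"])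
        (auto simp: MV0_def MV_def)
    then have "s - T u s - m = 0"
      using V_ge1[OF assms] by (rule vnorm_eq_0[rotated])
    then show "\<exists>s\<in>MV0 (V l). s - T u s = m \<and>
      (\<forall>n. vnorm (V l) (s - (\<Sum>i<n. (T u ^^ i) m)) \<le> ennreal (\<Sum>i. a (i + n)) * vnorm (V l) m)"
      using s0 sS' unfolding S_def by auto
  qed
qed

lemma T_diff_linear:
  assumes "l \<le> k" "u \<in> {0..1}" "m \<in> MV (V l)" "n \<in> MV (V l)"
  shows "(m + n) - T u (m + n) = (m - T u m) + (n - T u n)"
    "(m - n) - T u (m - n) = (m - T u m) - (n - T u n)"
    "c *\<^sub>R m - T u (c *\<^sub>R m) = c *\<^sub>R (m - T u m)"
  using assms by (simp_all add: D_linear'[of l 0 u m n] algebra_simps)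

lemma bij_resolvent:
  assumes "l \<le> k" "u \<in> {0..1}"
  shows "bij_betw (\<lambda>m. m - T u m) (MV0 (V l)) (MV0 (V l))"
proof -
  have a: "\<forall>m\<in>MV0 (V l). \<exists>s\<in>MV0 (V l). s - T u s = m"
    and fix0: "\<And>m. m \<in> MV0 (V l) \<Longrightarrow> T u m = m \<Longrightarrow> m = 0"
    using resolvent[OF assms(1)] assms(2) by blast+
  have "inj_on (\<lambda>m. m - T u m) (MV0 (V l))"
  proof (rule inj_onI)
    fix m n assume mn: "m \<in> MV0 (V l)" "n \<in> MV0 (V l)" "m - T u m = n - T u n"
    then have "(m - n) - T u (m - n) = 0"
      using assms by (simp add: T_diff_linear MV0_D)
    then have "T u (m - n) = m - n"
      by simp
    then have "m - n = 0"
      using mn assms by (intro fix0 MV0_minus V_meas) auto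
    then show "m = n"
      by simp
  qed
  moreover have "(\<lambda>m. m - T u m) ` MV0 (V l) = MV0 (V l)"
  proof (intro equalityI subsetI)
    fix m assume "m \<in> MV0 (V l)"
    then show "m \<in> (\<lambda>m. m - T u m) ` MV0 (V l)"
      using a by force
  qed (use assms in \<open>auto intro!: MV0_minus V_meas T_mem0\<close>)
  ultimately show ?thesis
    by (simp add: bij_betw_def)
qed

lemma
  assumes "l \<le> k" "u \<in> {0..1}" "m \<in> MV0 (V l)"
  shows R_mem0: "R l u m \<in> MV0 (V l)" and R_right: "R l u m - T u (R l u m) = m"
    and R_left: "R l u (m - T u m) = m"
proof -
  note bij = bij_resolvent[OF assms(1,2)]
  show "R l u m \<in> MV0 (V l)"
    using bij_betwE[OF bij_betw_inv_into[OF bij]] assms(3) by auto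
  show "R l u m - T u (R l u m) = m"
    using bij_betw_inv_into_right[OF bij assms(3)] .
  show "R l u (m - T u m) = m"
    using bij_betw_inv_into_left[OF bij assms(3)] .
qed

text \<open>Injectivity makes any solution of mass zero the value of the resolvent. This also
  identifies resolvents across weights: a solution found in a heavier space is one in every lighter
  space.\<close>

lemma R_eqI:
  assumes "l \<le> k" "u \<in> {0..1}" "s \<in> MV0 (V l)" "s - T u s = m"
  shows "R l u m = s"
  using R_left[OF assms(1-3)] assms(4) by simp

lemma R_linear:
  assumes "l \<le> k" "u \<in> {0..1}" "m \<in> MV0 (V l)" "n \<in> MV0 (V l)"
  shows "R l u (m + n) = R l u m + R l u n" "R l u (m - n) = R l u m - R l u n" "R l u (c *\<^sub>R m) = c *\<^sub>R R l u m"
proof -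
  note r = R_mem0[OF assms(1,2,3)] R_mem0[OF assms(1,2,4)] R_right[OF assms(1,2,3)] R_right[OF assms(1,2,4)]
  note lin = T_diff_linear[OF assms(1,2) MV0_D(1)[OF r(1)] MV0_D(1)[OF r(2)]]
  show "R l u (m + n) = R l u m + R l u n" "R l u (m - n) = R l u m - R l u n" "R l u (c *\<^sub>R m) = c *\<^sub>R R l u m"
    using assms r by (auto intro!: R_eqI MV0_plus MV0_minus MV0_scaleR V_meas simp: lin)
qed

lemma R_0: "l \<le> k \<Longrightarrow> u \<in> {0..1} \<Longrightarrow> R l u 0 = 0"
  using R_linear(3)[of l u 0 0 0] by (simp add: MV0_def)

lemma R_sum:
  assumes "l \<le> k" "u \<in> {0..1}" "\<And>i. i \<in> I \<Longrightarrow> m i \<in> MV0 (V l)"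
  shows "R l u (\<Sum>i\<in>I. c i *\<^sub>R m i) = (\<Sum>i\<in>I. c i *\<^sub>R R l u (m i))"
  using assms(3)
proof (induction I rule: infinite_finite_induct)
  case (insert i I)
  have "(\<Sum>i\<in>I. c i *\<^sub>R m i) \<in> MV0 (V l)"
    using assms insert by (intro MV0_sum MV0_scaleR V_meas) auto
  moreover have "m i \<in> MV0 (V l)" "c i *\<^sub>R m i \<in> MV0 (V l)"
    using assms insert by (auto intro!: MV0_scaleR V_meas)
  ultimately show ?case
    using insert assms by (simp add: R_linear)
qed (use assms in \<open>simp_all add: R_0\<close>)

lemma R_series:
  assumes "l \<le> k"
  shows "\<exists>b. b \<longlonglongrightarrow> 0 \<and> (\<forall>n. 0 \<le> b n) \<and> (\<forall>u\<in>{0..1}. \<forall>m\<in>MV0 (V l). \<forall>n.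
      vnorm (V l) ((\<Sum>i<n. (T u ^^ i) m) - R l u m) \<le> ennreal (b n) * vnorm (V l) m)"
proof -
  obtain a where a: "summable a" "\<forall>n. 0 \<le> a n"
    "\<forall>u\<in>{0..1}. \<forall>m\<in>MV0 (V l). (T u m = m \<longrightarrow> m = 0) \<and> (\<exists>s\<in>MV0 (V l). s - T u s = m \<and>
      (\<forall>n. vnorm (V l) (s - (\<Sum>i<n. (T u ^^ i) m)) \<le> ennreal (\<Sum>i. a (i + n)) * vnorm (V l) m))"
    using resolvent[OF assms] by blast
  show ?thesis
  proof (intro exI conjI allI ballI)
    show "(\<lambda>n. \<Sum>i. a (i + n)) \<longlonglongrightarrow> 0"
      using suminf_exist_split2[OF a(1)] .
    show "0 \<le> (\<Sum>i. a (i + n))" for n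
      using a by (intro suminf_nonneg) (auto simp: summable_iff_shift)
    show "vnorm (V l) ((\<Sum>i<n. (T u ^^ i) m) - R l u m) \<le> ennreal (\<Sum>i. a (i + n)) * vnorm (V l) m"
      if um: "u \<in> {0..1}" "m \<in> MV0 (V l)" for u m n
    proof -
      obtain s where s: "s \<in> MV0 (V l)" "s - T u s = m"
        "\<forall>n. vnorm (V l) (s - (\<Sum>i<n. (T u ^^ i) m)) \<le> ennreal (\<Sum>i. a (i + n)) * vnorm (V l) m"
        using a(3)[rule_format, OF um] by blast
      then show ?thesis
        using R_eqI[OF assms um(1) s(1,2)] by (simp add: vnorm_minus_commute)
    qed
  qed
qed

lemma R_bound:
  "\<exists>B\<ge>0. \<forall>l\<le>k. \<forall>u\<in>{0..1}. \<forall>m\<in>MV0 (V l). vnorm (V l) (R l u m) \<le> ennreal B * vnorm (V l) m"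
proof -
  define P where "P l b \<longleftrightarrow> 0 \<le> b \<and> (\<forall>u\<in>{0..1}. \<forall>m\<in>MV0 (V l). vnorm (V l) (R l u m) \<le> ennreal b * vnorm (V l) m)" for l b
  define B where "B l = (SOME b. P l b)" for l
  have "\<exists>b. P l b" if l: "l \<le> k" for l
  proof -
    obtain b where b: "\<forall>n. 0 \<le> b n" "\<forall>u\<in>{0..1}. \<forall>m\<in>MV0 (V l). \<forall>n.
        vnorm (V l) ((\<Sum>i<n. (T u ^^ i) m) - R l u m) \<le> ennreal (b n) * vnorm (V l) m"
      using R_series[OF l] by blast
    \<comment> \<open>The partial sum with n = 0 is empty, so the remainder estimate bounds the
      resolvent itself.\<close>
    have "vnorm (V l) (R l u m) \<le> ennreal (b 0) * vnorm (V l) m" if "u \<in> {0..1}" "m \<in> MV0 (V l)" for u m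
      using b(2)[rule_format, OF that, of 0] by simp
    then show ?thesis
      unfolding P_def by (intro exI[of _ "b 0"] conjI ballI b(1)[rule_format])
  qed
  then have P: "P l (B l)" if "l \<le> k" for l
    unfolding B_def by (rule someI_ex) (fact that)
  \<comment> \<open>The sum of the constants of all levels serves every level, since each of them is
    nonnegative.\<close>
  show ?thesis
  proof (intro exI[of _ "\<Sum>l\<le>k. B l"] conjI allI impI ballI)
    show "0 \<le> (\<Sum>l\<le>k. B l)"
      using P by (intro sum_nonneg) (auto simp: P_def)
    fix l m and u :: real assume l: "l \<le> k" and um: "u \<in> {0..1}" "m \<in> MV0 (V l)"
    have "B l \<le> (\<Sum>l\<le>k. B l)"
      using l P by (intro member_le_sum) (auto simp: P_def)
    then have "ennreal (B l) * vnorm (V l) m \<le> ennreal (\<Sum>l\<le>k. B l) * vnorm (V l) m"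
      by (intro mult_right_mono ennreal_leI) auto
    moreover have "vnorm (V l) (R l u m) \<le> ennreal (B l) * vnorm (V l) m"
      using P[OF l] um unfolding P_def by blast
    ultimately show "vnorm (V l) (R l u m) \<le> ennreal (\<Sum>l\<le>k. B l) * vnorm (V l) m"
      by (rule order_trans[rotated])
  qed
qed

section \<open>Strong continuity, limits and derivatives of the resolvent\<close>

lemma R_continuous:
  assumes "l \<le> k" "u \<in> {0..1}" "m \<in> MV0 (V l)"
  shows "vnull u (V l) (\<lambda>h. R l (u + h) m - R l u m)"
proof -
  obtain B where "\<forall>l\<le>k. \<forall>u\<in>{0..1}. \<forall>m\<in>MV0 (V l). vnorm (V l) (R l u m) \<le> ennreal B * vnorm (V l) m"
    using R_bound by blast
  note B = this[rule_format]
  define r where "r = R l u m"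
  have r: "r \<in> MV0 (V l)" "r - T u r = m"
    using R_mem0[OF assms] R_right[OF assms] by (auto simp: r_def)
  have "vnull u (V l) (\<lambda>h. T (u + h) r - T u r)"
    using D_cont[of l 0 u r] assms r by (simp add: MV0_D)
  then show ?thesis
  proof (rule vnull_mono)
    fix h assume h: "u + h \<in> {0..1}"
    have t: "T (u + h) r - T u r \<in> MV0 (V l)" "r - T (u + h) r \<in> MV0 (V l)"
      using assms h r by (auto intro!: T_diff_mem0 MV0_minus T_mem0 V_meas simp: MV0_D)
    \<comment> \<open>The resolvent identity, arranged with the moving resolvent outermost, where
      its bound is uniform, and the increment of \<open>T\<close> taken at the fixed measure
      \<open>r\<close>. Strong continuity of \<open>T\<close> is therefore enough.\<close>
    have "R l (u + h) m - r = R l (u + h) m - R l (u + h) (r - T (u + h) r)"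
      using R_left[OF assms(1) h r(1)] by simp
    also have "\<dots> = R l (u + h) (m - (r - T (u + h) r))"
      using assms h t by (simp add: R_linear)
    also have "m - (r - T (u + h) r) = T (u + h) r - T u r"
      unfolding r(2)[symmetric] by simp
    finally show "vnorm (V l) (R l (u + h) m - R l u m) \<le> ennreal B * vnorm (V l) (T (u + h) r - T u r)"
      using B[OF assms(1) h t(1)] by (simp add: r_def)
  qed
qed

text \<open>Operator and argument move together: the uniform bound absorbs the change of the
  argument, strong continuity that of the operator at the fixed limit \<open>w\<close>.\<close>

lemma R_tendsto:
  assumes "l \<le> k" "u \<in> {0..1}" "w \<in> MV0 (V l)" "\<And>h. u + h \<in> {0..1} \<Longrightarrow> h \<noteq> 0 \<Longrightarrow> X h \<in> MV0 (V l)"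
    and "vnull u (V l) (\<lambda>h. X h - w)"
  shows "vnull u (V l) (\<lambda>h. R l (u + h) (X h) - R l u w)"
proof -
  obtain B where "\<forall>l\<le>k. \<forall>u\<in>{0..1}. \<forall>m\<in>MV0 (V l). vnorm (V l) (R l u m) \<le> ennreal B * vnorm (V l) m"
    using R_bound by blast
  note B = this[rule_format]
  have "vnull u (V l) (\<lambda>h. R l (u + h) (X h - w))"
    using assms by (intro vnull_mono[OF assms(5) B] MV0_minus V_meas) auto
  from vnull_add[OF V_meas[OF assms(1)] this R_continuous[OF assms(1-3)]] show ?thesis
    by (rule vnull_cong) (use assms in \<open>auto simp: R_linear\<close>)
qed

lemma D_tendsto:
  assumes "s + l \<le> k" "u \<in> {0..1}" "w \<in> MV (V (s + l))" "\<And>h. u + h \<in> {0..1} \<Longrightarrow> h \<noteq> 0 \<Longrightarrow> X h \<in> MV (V (s + l))"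
    and "vnull u (V (s + l)) (\<lambda>h. X h - w)"
  shows "vnull u (V s) (\<lambda>h. D l (u + h) (X h) - D l u w)"
proof -
  obtain C where "\<forall>s l u m. s + l \<le> k \<longrightarrow> u \<in> {0..1} \<longrightarrow> m \<in> MV (V (s + l)) \<longrightarrow>
      vnorm (V s) (D l u m) \<le> ennreal C * vnorm (V (s + l)) m"
    using D_bound by blast
  note C = this[rule_format]
  have sk: "s \<le> k"
    using assms by simp
  have "vnull u (V s) (\<lambda>h. D l (u + h) (X h - w))"
    using assms by (intro vnull_mono[OF assms(5) C] MV_minus V_meas) auto
  from vnull_add[OF V_meas[OF sk] this D_cont[OF assms(1-3)]] show ?thesis
    by (rule vnull_cong) (use assms in \<open>auto simp: D_linear'(2)[of s l]\<close>)
qed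

text \<open>The difference quotient of the argument is taken under \<open>D l (u + h)\<close>, that
  of the operator at the fixed \<open>G u\<close>. The latter loses \<open>Suc l\<close> weights,
  hence the stronger space for \<open>G\<close> than for \<open>G'\<close>.\<close>

lemma D_product_rule:
  assumes l: "s + Suc l \<le> k" and u: "u \<in> {0..1}"
    and G: "\<And>v. v \<in> {0..1} \<Longrightarrow> G v \<in> MV (V (s + Suc l))" and G': "G' \<in> MV (V (s + l))"
    and deriv: "vnull u (V (s + l)) (\<lambda>h. (G (u + h) - G u) /\<^sub>R h - G')"
  shows "vnull u (V s) (\<lambda>h. (D l (u + h) (G (u + h)) - D l u (G u)) /\<^sub>R h - (D (Suc l) u (G u) + D l u G'))"
proof -
  have Gl: "G v \<in> MV (V (s + l))" if "v \<in> {0..1}" for v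
    by (rule MV_V_mono[OF G[OF that]]) (use l in auto)
  have sl: "s + l \<le> k" "s \<le> k"
    using l by auto
  have "vnull u (V s) (\<lambda>h. D l (u + h) ((G (u + h) - G u) /\<^sub>R h) - D l u G')"
    using sl u G' Gl by (intro D_tendsto[OF _ _ _ _ deriv] MV_scaleR MV_minus V_meas) auto
  from vnull_add[OF V_meas[OF sl(2)] this D_deriv[OF l u G[OF u]]] show ?thesis
  proof (rule vnull_cong)
    fix h assume h: "u + h \<in> {0..1}"
    have "D l (u + h) ((G (u + h) - G u) /\<^sub>R h) = (D l (u + h) (G (u + h)) - D l (u + h) (G u)) /\<^sub>R h"
      using Gl[OF u] Gl[OF h] sl h V_meas[of "s + l"]
      by (simp add: D_linear'(2)[OF sl(1) h] D_linear'(3)[OF sl(1) h] MV_minus)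
    then show "(D l (u + h) (G (u + h)) - D l u (G u)) /\<^sub>R h - (D (Suc l) u (G u) + D l u G') =
       D l (u + h) ((G (u + h) - G u) /\<^sub>R h) - D l u G' + ((D l (u + h) (G u) - D l u (G u)) /\<^sub>R h - D (Suc l) u (G u))"
      by (simp add: scaleR_diff_right)
  qed
qed

text \<open>Dividing the resolvent identity by h leaves the moving resolvent applied to the
  difference quotient of \<open>T\<close> at a fixed measure. That quotient converges only in the
  weight \<open>V l\<close>, so the outer resolvent carries the index l.\<close>

lemma R_derivative:
  assumes l: "Suc l \<le> k" and u: "u \<in> {0..1}" and m: "m \<in> MV0 (V (Suc l))"
  shows "vnull u (V l) (\<lambda>h. (R (Suc l) (u + h) m - R (Suc l) u m) /\<^sub>R h - R l u (D 1 u (R (Suc l) u m)))"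
proof -
  define r where "r = R (Suc l) u m"
  have r: "r \<in> MV0 (V (Suc l))" "r - T u r = m"
    using R_mem0[OF l u m] R_right[OF l u m] by (auto simp: r_def)
  have r': "r \<in> MV0 (V l)"
    by (rule MV0_V_mono[OF r(1)]) (use l in auto)
  have lk: "l \<le> k"
    using l by simp
  have "vnull u (V l) (\<lambda>h. R l (u + h) ((T (u + h) r - T u r) /\<^sub>R h) - R l u (D 1 u r))"
  proof (rule R_tendsto[OF lk u])
    show "D 1 u r \<in> MV0 (V l)"
      using D_mem0[of l 0 u r] l u r by (simp add: MV0_D)
    show "(T (u + h) r - T u r) /\<^sub>R h \<in> MV0 (V l)" if "u + h \<in> {0..1}" for h
      using lk u that r' by (intro MV0_scaleR T_diff_mem0 V_meas) (auto simp: MV0_D)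
    show "vnull u (V l) (\<lambda>h. (T (u + h) r - T u r) /\<^sub>R h - D 1 u r)"
      using D_deriv[of l 0 u r] l u r by (simp add: MV0_D)
  qed
  then show ?thesis
  proof (rule vnull_cong)
    fix h assume h: "u + h \<in> {0..1}"
    have t: "T (u + h) r - T u r \<in> MV0 (V l)"
      using lk u h r' by (intro T_diff_mem0) (auto simp: MV0_D)
    \<comment> \<open>The increment of the resolvent of the heavier space solves the equation posed
      in the lighter one.\<close>
    have "R l (u + h) (T (u + h) r - T u r) = R (Suc l) (u + h) m - r"
    proof (rule R_eqI[OF lk h])
      have m': "R (Suc l) (u + h) m \<in> MV0 (V l)"
        by (rule MV0_V_mono[OF R_mem0[OF l h m]]) (use l in auto)
      then show "R (Suc l) (u + h) m - r \<in> MV0 (V l)"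
        using r' lk by (intro MV0_minus V_meas)
      have "R (Suc l) (u + h) m - r - T (u + h) (R (Suc l) (u + h) m - r) = m - (r - T (u + h) r)"
        using T_diff_linear(2)[OF lk h, of "R (Suc l) (u + h) m" r] m' r' R_right[OF l h m] by (simp add: MV0_D)
      then show "R (Suc l) (u + h) m - r - T (u + h) (R (Suc l) (u + h) m - r) = T (u + h) r - T u r"
        unfolding r(2)[symmetric] by simp
    qed
    then show "(R (Suc l) (u + h) m - R (Suc l) u m) /\<^sub>R h - R l u (D 1 u (R (Suc l) u m)) =
        R l (u + h) ((T (u + h) r - T u r) /\<^sub>R h) - R l u (D 1 u r)"
      using R_linear(3)[OF lk h t t] by (simp add: r_def)
  qed
qed

text \<open>
  The derivatives of \<open>\<pi>\<close> come from differentiating \<open>(I - T\<^sub>u) \<pi>\<^sub>u = 0\<close> by Leibniz' rule \<open>l\<close> times.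
\<close>

function g :: "nat \<Rightarrow> real \<Rightarrow> 'a signed_measure" where
  "g 0 u = \<pi> u"
| "g (Suc l) u = (\<Sum>s=1..Suc l. real (Suc l choose s) *\<^sub>R R (k - Suc l) u (D s u (g (Suc l - s) u)))"
  by pat_completeness auto
termination
  by (relation "inv_image less_than fst") auto

text \<open>The right-hand side left by Leibniz' rule of order l when the term with s = 0 is
  combined with the derivative of the identity; it is 0 for l = 0. In \<open>g\<close> the resolvent
  is applied to each summand separately.\<close>

definition rhs :: "nat \<Rightarrow> real \<Rightarrow> 'a signed_measure" where
  "rhs l u = (\<Sum>s=1..l. real (l choose s) *\<^sub>R D s u (g (l - s) u))"

declare g.simps(2) [simp del]

text \<open>Pascal's rule. In the application \<open>A s\<close> is
  \<open>D s u (g (Suc l - s) u)\<close>: then \<open>A (Suc s) + A s\<close> is the derivative of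
  the summand s of order l, and the extra \<open>A 1\<close> comes from differentiating
  \<open>T\<close> at the fixed measure \<open>g l u\<close>.\<close>

lemma leibniz_sum:
  fixes A :: "nat \<Rightarrow> 'b::real_vector"
  shows "(\<Sum>s=1..l. real (l choose s) *\<^sub>R (A (Suc s) + A s)) + A 1 = (\<Sum>s=1..Suc l. real (Suc l choose s) *\<^sub>R A s)"
proof -
  have "(\<Sum>s=1..Suc l. real (Suc l choose s) *\<^sub>R A s) = (\<Sum>s=0..l. real (Suc l choose Suc s) *\<^sub>R A (Suc s))"
    using sum.shift_bounds_cl_Suc_ivl[of "\<lambda>s. real (Suc l choose s) *\<^sub>R A s" 0 l] by simp
  also have "\<dots> = (\<Sum>s=0..l. real (l choose s) *\<^sub>R A (Suc s)) + (\<Sum>s=0..l. real (l choose Suc s) *\<^sub>R A (Suc s))"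
    by (simp add: scaleR_add_left sum.distrib)
  also have "(\<Sum>s=0..l. real (l choose s) *\<^sub>R A (Suc s)) = A 1 + (\<Sum>s=1..l. real (l choose s) *\<^sub>R A (Suc s))"
    by (simp add: sum.atLeast_Suc_atMost)
  also have "(\<Sum>s=0..l. real (l choose Suc s) *\<^sub>R A (Suc s)) = (\<Sum>s=1..Suc l. real (l choose s) *\<^sub>R A s)"
    using sum.shift_bounds_cl_Suc_ivl[of "\<lambda>s. real (l choose s) *\<^sub>R A s" 0 l] by simp
  also have "\<dots> = (\<Sum>s=1..l. real (l choose s) *\<^sub>R A s)"
    by simp
  finally show ?thesis
    by (simp add: scaleR_add_right sum.distrib ac_simps)
qed

text \<open>The stationary measures have mass 1 and lie outside the domain of the resolvent. Their
  difference is admissible and solves an equation whose right-hand side is the increment of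
  \<open>T\<close> at the fixed \<open>\<pi> u\<close>.\<close>

lemma pi_continuous:
  assumes "u \<in> {0..1}"
  shows "vnull u (V k) (\<lambda>h. \<pi> (u + h) - \<pi> u)"
proof -
  have "vnull u (V k) (\<lambda>h. T (u + h) (\<pi> u) - T u (\<pi> u) - 0)"
    using D_cont[of k 0 u "\<pi> u"] assms stationary by simp
  then have "vnull u (V k) (\<lambda>h. R k (u + h) (T (u + h) (\<pi> u) - T u (\<pi> u)) - R k u 0)"
    using assms stationary(1) by (intro R_tendsto T_diff_mem0) (auto simp: MV0_def)
  then show ?thesis
  proof (rule vnull_cong)
    fix h assume h: "u + h \<in> {0..1}"
    note st = stationary[OF assms] stationary[OF h]
    have "\<pi> (u + h) - \<pi> u \<in> MV0 (V k)"
      using st by (auto intro!: MV0_I MV_minus V_meas)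
    moreover have "\<pi> (u + h) - \<pi> u - T (u + h) (\<pi> (u + h) - \<pi> u) = T (u + h) (\<pi> u) - T u (\<pi> u)"
      using T_diff_linear(2)[of k "u + h" "\<pi> (u + h)" "\<pi> u"] h st by simp
    ultimately have "R k (u + h) (T (u + h) (\<pi> u) - T u (\<pi> u)) = \<pi> (u + h) - \<pi> u"
      using h by (intro R_eqI) auto
    then show "\<pi> (u + h) - \<pi> u = R k (u + h) (T (u + h) (\<pi> u) - T u (\<pi> u)) - R k u 0"
      using assms by (simp add: R_0)
  qed
qed

text \<open>Strong induction, since the right-hand side of order l involves all lower orders.
  Continuity and the derivative are carried along with the equation because the next order uses
  them; mass zero is claimed only from order 1 on.\<close>

lemma g_properties:
  assumes "l \<le> k"
  shows "(\<forall>u\<in>{0..1}. g l u \<in> MV (V (k - l)) \<and> vnull u (V (k - l)) (\<lambda>h. g l (u + h) - g l u) \<and>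
      g l u - T u (g l u) = rhs l u \<and>
      (0 < l \<longrightarrow> g l u \<in> MV0 (V (k - l)) \<and> vnull u (V (k - l)) (\<lambda>h. (g (l - 1) (u + h) - g (l - 1) u) /\<^sub>R h - g l u)))"
  using assms
proof (induction l rule: less_induct)
  case (less l)
  show ?case
  proof (cases l)
    case 0
    then show ?thesis
      using stationary pi_continuous by (auto simp: rhs_def simp del: atLeastAtMost_iff)
  next
    case (Suc l')
    \<comment> \<open>The level of the new derivative. The summand with index s takes a measure from
      level j + s and loses exactly s weights, so every summand ends in level j.\<close>
    define j where "j = k - Suc l'"
    have jk: "j \<le> k" "j + Suc l' = k"
      using less.prems Suc by (auto simp: j_def)
    note Vj = V_meas[OF jk(1)]
    have idx: "k - (l' - s) = j + Suc s" "k - (Suc l' - s) = j + s" if "s \<le> l'" for s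
      using that less.prems Suc by (auto simp: j_def)
    have idx': "k - (Suc l' - s) = j + s" if "s \<le> Suc l'" for s
      using that less.prems Suc by (auto simp: j_def)
    have gm: "g (Suc l' - s) u \<in> MV (V (j + s))" "vnull u (V (j + s)) (\<lambda>h. g (Suc l' - s) (u + h) - g (Suc l' - s) u)"
      if "1 \<le> s" "s \<le> Suc l'" "u \<in> {0..1}" for s u
      using less.IH[of "Suc l' - s"] less.prems Suc idx'[of s] that by (auto simp del: atLeastAtMost_iff)
    have gl: "g l' u \<in> MV (V (Suc j))" "g l' u - T u (g l' u) = rhs l' u" if "u \<in> {0..1}" for u
      using less.IH[of l'] less.prems Suc idx[of 0] that by (auto simp del: atLeastAtMost_iff)
    have glj: "g l' u \<in> MV (V j)" if "u \<in> {0..1}" for u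
      by (rule MV_V_mono[OF gl(1)[OF that]]) (use jk in auto)
    have Dm: "D s u (g (Suc l' - s) u) \<in> MV0 (V j)" if "s \<in> {1..Suc l'}" "u \<in> {0..1}" for s u
      using D_mem0[of j "s - 1" u "g (Suc l' - s) u"] gm(1)[of s u] that jk by auto
    have rhs_mem: "rhs (Suc l') u \<in> MV0 (V j)" if "u \<in> {0..1}" for u
      unfolding rhs_def using that by (intro MV0_sum MV0_scaleR Dm Vj)
    have g_eq: "g (Suc l') u = R j u (rhs (Suc l') u)" if "u \<in> {0..1}" for u
      unfolding rhs_def g.simps(2) j_def[symmetric] by (rule R_sum[OF jk(1) that Dm[OF _ that], symmetric])
    have g_mem: "g (Suc l') u \<in> MV0 (V j)" and g_right: "g (Suc l') u - T u (g (Suc l') u) = rhs (Suc l') u"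
      if "u \<in> {0..1}" for u
      using R_mem0[OF jk(1) that rhs_mem[OF that]] R_right[OF jk(1) that rhs_mem[OF that]] that by (simp_all add: g_eq)
    have cont: "vnull u (V j) (\<lambda>h. g (Suc l') (u + h) - g (Suc l') u)" if u: "u \<in> {0..1}" for u
    proof -
      have "vnull u (V j) (\<lambda>h. D s (u + h) (g (Suc l' - s) (u + h)) - D s u (g (Suc l' - s) u))" if "s \<in> {1..Suc l'}" for s
        using that u jk gm[of s] by (intro D_tendsto) auto
      then have "vnull u (V j) (\<lambda>h. \<Sum>s=1..Suc l'. real (Suc l' choose s) *\<^sub>R
          (D s (u + h) (g (Suc l' - s) (u + h)) - D s u (g (Suc l' - s) u)))"
        by (intro vnull_sum vnull_scaleR Vj)
      then have "vnull u (V j) (\<lambda>h. rhs (Suc l') (u + h) - rhs (Suc l') u)"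
        by (simp add: rhs_def sum_subtractf scaleR_diff_right)
      then have "vnull u (V j) (\<lambda>h. R j (u + h) (rhs (Suc l') (u + h)) - R j u (rhs (Suc l') u))"
        using rhs_mem u jk by (intro R_tendsto) auto
      then show ?thesis
        by (rule vnull_cong) (use u in \<open>simp add: g_eq\<close>)
    qed
    have deriv: "vnull u (V j) (\<lambda>h. (g l' (u + h) - g l' u) /\<^sub>R h - g (Suc l') u)" if u: "u \<in> {0..1}" for u
    proof -
      define A where "A s = D s u (g (Suc l' - s) u)" for s
      \<comment> \<open>\<open>W h\<close> is I - T(u + h) applied to the difference quotient of
        \<open>g l'\<close>: the first part is the quotient of the right-hand sides, the second
        corrects for the change of operator.\<close>
      define W where "W h = (rhs l' (u + h) - rhs l' u) /\<^sub>R h + (T (u + h) (g l' u) - T u (g l' u)) /\<^sub>R h" for h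
      have "vnull u (V j) (\<lambda>h. (D s (u + h) (g (l' - s) (u + h)) - D s u (g (l' - s) u)) /\<^sub>R h - (A (Suc s) + A s))"
        if s: "s \<in> {1..l'}" for s
      proof -
        \<comment> \<open>As s is at least 1, the order \<open>Suc (l' - s)\<close> stays below l,
          and the induction hypothesis already supplies it as the derivative of the order
          before.\<close>
        have sl: "Suc l' - s = Suc (l' - s)" "l' - s < l" "Suc (l' - s) < l"
          using s Suc by auto
        have s': "s \<le> l'"
          using s by simp
        have "vnull u (V j) (\<lambda>h. (D s (u + h) (g (l' - s) (u + h)) - D s u (g (l' - s) u)) /\<^sub>R h
            - (D (Suc s) u (g (l' - s) u) + D s u (g (Suc l' - s) u)))"
        proof (rule D_product_rule)
          show "vnull u (V (j + s)) (\<lambda>h. (g (l' - s) (u + h) - g (l' - s) u) /\<^sub>R h - g (Suc l' - s) u)"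
            using less.IH[OF sl(3)] less.prems Suc idx[of s] u s' sl(1) by (auto simp del: atLeastAtMost_iff g.simps)
          show "g (l' - s) v \<in> MV (V (j + Suc s))" if "v \<in> {0..1}" for v
            using less.IH[OF sl(2)] less.prems Suc idx[of s] s' that by (auto simp del: atLeastAtMost_iff)
          show "g (Suc l' - s) u \<in> MV (V (j + s))"
            using gm(1)[of s u] s u by auto
        qed (use jk u s in auto)
        then show ?thesis
          by (simp add: A_def)
      qed
      then have "vnull u (V j) (\<lambda>h. \<Sum>s=1..l'. real (l' choose s) *\<^sub>R
          ((D s (u + h) (g (l' - s) (u + h)) - D s u (g (l' - s) u)) /\<^sub>R h - (A (Suc s) + A s)))"
        by (intro vnull_sum vnull_scaleR Vj)
      moreover have "vnull u (V j) (\<lambda>h. (T (u + h) (g l' u) - T u (g l' u)) /\<^sub>R h - A 1)"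
        using D_deriv[of j 0 u "g l' u"] gl(1)[OF u] jk u by (simp add: A_def)
      ultimately have "vnull u (V j) (\<lambda>h. (\<Sum>s=1..l'. real (l' choose s) *\<^sub>R
          ((D s (u + h) (g (l' - s) (u + h)) - D s u (g (l' - s) u)) /\<^sub>R h - (A (Suc s) + A s)))
          + ((T (u + h) (g l' u) - T u (g l' u)) /\<^sub>R h - A 1))"
        by (rule vnull_add[OF Vj])
      then have "vnull u (V j) (\<lambda>h. W h - rhs (Suc l') u)"
      proof (rule vnull_cong)
        fix h
        have "rhs (Suc l') u = (\<Sum>s=1..l'. real (l' choose s) *\<^sub>R (A (Suc s) + A s)) + A 1"
          unfolding rhs_def A_def[symmetric] leibniz_sum ..
        moreover have "(rhs l' (u + h) - rhs l' u) /\<^sub>R h = (\<Sum>s=1..l'. real (l' choose s) *\<^sub>R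
            ((D s (u + h) (g (l' - s) (u + h)) - D s u (g (l' - s) u)) /\<^sub>R h))"
          by (simp add: rhs_def scaleR_sum_right scaleR_diff_right sum_subtractf mult.commute)
        ultimately show "W h - rhs (Suc l') u = (\<Sum>s=1..l'. real (l' choose s) *\<^sub>R
            ((D s (u + h) (g (l' - s) (u + h)) - D s u (g (l' - s) u)) /\<^sub>R h - (A (Suc s) + A s)))
            + ((T (u + h) (g l' u) - T u (g l' u)) /\<^sub>R h - A 1)"
          by (simp add: W_def sum_subtractf scaleR_diff_right[of "real _"])
      qed
      moreover have inc: "g l' (u + h) - g l' u \<in> MV0 (V j)"
        "g l' (u + h) - g l' u - T (u + h) (g l' (u + h) - g l' u) = h *\<^sub>R W h" if h: "u + h \<in> {0..1}" "h \<noteq> 0" for h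
      proof -
        \<comment> \<open>Mass 1 for the probability measures of order 0, and 0 afterwards; in
          either case it does not depend on v, so increments have mass zero.\<close>
        have "sval (g l' v) UNIV = (if l' = 0 then 1 else 0)" if "v \<in> {0..1}" for v
          using less.IH[of l'] less.prems Suc that stationary(3) by (auto simp: MV0_def simp del: atLeastAtMost_iff)
        then show "g l' (u + h) - g l' u \<in> MV0 (V j)"
          using glj u h Vj by (intro MV0_I MV_minus) auto
        show "g l' (u + h) - g l' u - T (u + h) (g l' (u + h) - g l' u) = h *\<^sub>R W h"
          using T_diff_linear(2)[OF jk(1) h(1) glj[OF h(1)] glj[OF u]] gl(2)[OF u] gl(2)[OF h(1)] h(2)
          by (simp add: W_def scaleR_add_right algebra_simps)
      qed
      \<comment> \<open>Membership is read off from the equation for the increment, whose left-hand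
        side is visibly of mass zero, and not from the two parts of \<open>W h\<close>.\<close>
      moreover have W_mem: "W h \<in> MV0 (V j)" if h: "u + h \<in> {0..1}" "h \<noteq> 0" for h
      proof -
        have "h *\<^sub>R W h \<in> MV0 (V j)"
          unfolding inc(2)[OF h, symmetric]
          by (rule MV0_minus[OF Vj inc(1)[OF h] T_mem0[OF jk(1) h(1) inc(1)[OF h]]])
        then have "(1 / h) *\<^sub>R (h *\<^sub>R W h) \<in> MV0 (V j)"
          by (rule MV0_scaleR[OF Vj])
        then show ?thesis
          using h by simp
      qed
      ultimately have "vnull u (V j) (\<lambda>h. R j (u + h) (W h) - R j u (rhs (Suc l') u))"
        using jk u rhs_mem by (intro R_tendsto) auto
      then show ?thesis
      proof (rule vnull_cong)
        fix h assume h: "u + h \<in> {0..1}" "h \<noteq> 0"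
        have "h *\<^sub>R R j (u + h) (W h) = g l' (u + h) - g l' u"
          using R_left[OF jk(1) h(1) inc(1)[OF h]] R_linear(3)[OF jk(1) h(1) W_mem[OF h] W_mem[OF h]] inc(2)[OF h] by simp
        then have "(g l' (u + h) - g l' u) /\<^sub>R h = R j (u + h) (W h)"
          using h(2) by (simp flip: \<open>h *\<^sub>R R j (u + h) (W h) = _\<close>)
        then show "(g l' (u + h) - g l' u) /\<^sub>R h - g (Suc l') u = R j (u + h) (W h) - R j u (rhs (Suc l') u)"
          by (simp add: g_eq[OF u])
      qed
    qed
    show ?thesis
      unfolding Suc j_def[symmetric] using g_mem g_right cont deriv MV0_D(1)[OF g_mem] by simp
  qed
qed

end

section \<open>Signed measures with a density\<close>

lemma sval_of_measure:
  assumes "finite_measure N" "sets N = sets borel"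
  shows "sval (of_measure N) A = measure N A"
proof -
  interpret finite_measure N by fact
  show ?thesis
    unfolding of_measure_def using assms(2)
    by (subst Abs_signed_measure_inverse) (auto simp: measure_notin_sets intro!: finite_measure_UNION)
qed

lemma signed_integral_of_measure:
  assumes N: "finite_measure N" "sets N = sets borel"
    and \<phi>: "\<phi> \<in> borel_measurable borel" "\<And>x. \<bar>\<phi> x\<bar> \<le> K"
  shows "signed_integral (of_measure N) \<phi> = (\<integral>x. \<phi> x \<partial>N)"
proof -
  have "signed_integral (of_measure N) \<phi> = (\<integral>x. \<phi> x \<partial>N) - (\<integral>x. \<phi> x \<partial>null_measure borel)"
  proof (rule signed_integral_eqI)
    show "finite_measure (null_measure borel)"
      by (rule finite_measureI) simp
    show "integrable N \<phi>"
      using N \<phi> by (intro finite_measure.integrable_const_bound[of N \<phi> K]) (auto simp: measurable_cong_sets[OF N(2) refl])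
    show "integrable (null_measure borel) \<phi>"
      using \<phi> by (auto simp: integrable_iff_bounded)
    show "integrable (variation (of_measure N)) \<phi>"
      using \<phi> by (rule integrable_variation_bounded)
  qed (use N in \<open>auto simp: sval_of_measure\<close>)
  then show ?thesis
    by simp
qed

lemma vnorm_of_measure_le:
  assumes N: "finite_measure N" "sets N = sets borel" and W: "W \<in> borel_measurable borel" "\<And>x. 0 \<le> W x"
  shows "vnorm W (of_measure N) \<le> (\<integral>\<^sup>+x. ennreal (W x) \<partial>N)"
proof (rule vnorm_le_dual[OF W])
  fix \<phi> K assume \<phi>: "\<phi> \<in> borel_measurable borel" "\<And>x. \<bar>\<phi> x\<bar> \<le> W x" "\<And>x. \<bar>\<phi> x\<bar> \<le> K"
  have "ennreal \<bar>\<integral>x. \<phi> x \<partial>N\<bar> \<le> (\<integral>\<^sup>+x. ennreal \<bar>\<phi> x\<bar> \<partial>N)"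
    by (rule ennreal_abs_integral_le)
  also have "\<dots> \<le> (\<integral>\<^sup>+x. ennreal (W x) \<partial>N)"
    using \<phi> by (intro nn_integral_mono ennreal_leI)
  finally show "ennreal \<bar>signed_integral (of_measure N) \<phi>\<bar> \<le> (\<integral>\<^sup>+x. ennreal (W x) \<partial>N)"
    using signed_integral_of_measure[OF N \<phi>(1,3)] by simp
qed

text \<open>\<open>ennreal\<close> cuts off negative values, so the two densities are the positive
  and the negative part of g.\<close>

definition density_measure :: "'a::topological_space measure \<Rightarrow> ('a \<Rightarrow> real) \<Rightarrow> 'a signed_measure" where
  "density_measure M g =
     of_measure (density M (\<lambda>y. ennreal (g y))) - of_measure (density M (\<lambda>y. ennreal (- g y)))"

context
  fixes M :: "'a::topological_space measure" and g :: "'a \<Rightarrow> real"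
  assumes M: "sets M = sets borel" and g: "integrable M g"
begin

lemma density_finite:
  "finite_measure (density M (\<lambda>y. ennreal (g y)))" "finite_measure (density M (\<lambda>y. ennreal (- g y)))"
proof -
  have [measurable]: "g \<in> borel_measurable M"
    using g by simp
  have "(\<integral>\<^sup>+y. ennreal (g y) \<partial>M) < \<infinity>" "(\<integral>\<^sup>+y. ennreal (- g y) \<partial>M) < \<infinity>"
    using g by (auto simp: real_integrable_def less_top)
  then show "finite_measure (density M (\<lambda>y. ennreal (g y)))" "finite_measure (density M (\<lambda>y. ennreal (- g y)))"
    using sets_eq_imp_space_eq[OF M] by (auto intro!: finite_measureI simp: emeasure_density)
qed

lemma signed_integral_density_measure:
  assumes [measurable]: "\<phi> \<in> borel_measurable borel" and \<phi>: "\<And>x. \<bar>\<phi> x\<bar> \<le> K"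
  shows "signed_integral (density_measure M g) \<phi> = (\<integral>y. g y * \<phi> y \<partial>M)"
proof -
  have gM [measurable]: "g \<in> borel_measurable M" "\<phi> \<in> borel_measurable M"
    using g by (auto simp: measurable_cong_sets[OF M refl])
  have int: "integrable M (\<lambda>y. max 0 (g y) * \<phi> y)" "integrable M (\<lambda>y. max 0 (- g y) * \<phi> y)"
  proof -
    have i: "integrable M (\<lambda>y. K * g y)"
      using g by simp
    have "\<bar>max 0 (s * g y) * \<phi> y\<bar> \<le> \<bar>K * g y\<bar>" if "s = 1 \<or> s = -1" for s y
      using \<phi>[of y] that by (auto simp: abs_mult mult.commute intro!: mult_mono)
    from this[of 1] this[of "-1"] show "integrable M (\<lambda>y. max 0 (g y) * \<phi> y)" "integrable M (\<lambda>y. max 0 (- g y) * \<phi> y)"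
      by (auto intro!: Bochner_Integration.integrable_bound[OF i])
  qed
  \<comment> \<open>With the truncation written out as \<open>max 0\<close> the densities are
    nonnegative real functions, as the formula for integrals against a density expects.\<close>
  have dens: "density M (\<lambda>y. ennreal (g y)) = density M (\<lambda>y. ennreal (max 0 (g y)))"
    "density M (\<lambda>y. ennreal (- g y)) = density M (\<lambda>y. ennreal (max 0 (- g y)))"
    by (auto intro!: density_cong simp: max_def ennreal_neg)
  have b: "integrable (variation n) \<phi>" for n :: "'a signed_measure"
    using assms by (intro integrable_variation_bounded)
  have "signed_integral (density_measure M g) \<phi>
      = (\<integral>y. \<phi> y \<partial>density M (\<lambda>y. ennreal (g y))) - (\<integral>y. \<phi> y \<partial>density M (\<lambda>y. ennreal (- g y)))"
    unfolding density_measure_def using density_finite M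
    by (simp add: signed_integral_diff_measure b signed_integral_of_measure[OF _ _ assms])
  also have "\<dots> = (\<integral>y. max 0 (g y) * \<phi> y \<partial>M) - (\<integral>y. max 0 (- g y) * \<phi> y \<partial>M)"
    unfolding dens(1) unfolding dens(2) by (subst (1 2) integral_density) simp_all
  also have "\<dots> = (\<integral>y. max 0 (g y) * \<phi> y - max 0 (- g y) * \<phi> y \<partial>M)"
    using int by simp
  also have "\<dots> = (\<integral>y. g y * \<phi> y \<partial>M)"
    by (intro Bochner_Integration.integral_cong) (auto simp: max_def)
  finally show ?thesis .
qed

lemma sval_density_measure: "A \<in> sets borel \<Longrightarrow> sval (density_measure M g) A = (LINT y:A|M. g y)"
  using signed_integral_density_measure[of "indicator A" 1]
  by (simp add: signed_integral_indicator set_lebesgue_integral_def mult.commute indicator_le_1)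

lemma vnorm_density_measure_le:
  assumes W: "W \<in> borel_measurable borel" "\<And>x. 0 \<le> W x"
  shows "vnorm W (density_measure M g) \<le> (\<integral>\<^sup>+y. ennreal (\<bar>g y\<bar> * W y) \<partial>M)"
proof (rule vnorm_le_dual[OF W])
  fix \<phi> K assume \<phi>: "\<phi> \<in> borel_measurable borel" "\<And>x. \<bar>\<phi> x\<bar> \<le> W x" "\<And>x. \<bar>\<phi> x\<bar> \<le> K"
  have "ennreal \<bar>\<integral>y. g y * \<phi> y \<partial>M\<bar> \<le> (\<integral>\<^sup>+y. ennreal \<bar>g y * \<phi> y\<bar> \<partial>M)"
    by (rule ennreal_abs_integral_le)
  also have "\<dots> \<le> (\<integral>\<^sup>+y. ennreal (\<bar>g y\<bar> * W y) \<partial>M)"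
    using \<phi> by (intro nn_integral_mono ennreal_leI) (auto simp: abs_mult intro!: mult_left_mono)
  finally show "ennreal \<bar>signed_integral (density_measure M g) \<phi>\<bar> \<le> (\<integral>\<^sup>+y. ennreal (\<bar>g y\<bar> * W y) \<partial>M)"
    using signed_integral_density_measure[OF \<phi>(1,3)] by simp
qed

end

lemma density_measure_diff:
  assumes M: "sets M = sets borel" and g: "integrable M g" "integrable M h"
  shows "density_measure M (\<lambda>y. g y - h y) = density_measure M g - density_measure M h"
proof (rule signed_measure_eqI)
  fix A :: "'a set" assume A: "A \<in> sets borel"
  then have "set_integrable M A g" "set_integrable M A h"
    unfolding set_integrable_def using M g by (intro integrable_mult_indicator; simp)+
  then show "sval (density_measure M (\<lambda>y. g y - h y)) A = sval (density_measure M g - density_measure M h) A"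
    using A M g by (simp add: sval_density_measure)
qed

lemma density_measure_scaleR:
  assumes M: "sets M = sets borel" and g: "integrable M g"
  shows "density_measure M (\<lambda>y. c * g y) = c *\<^sub>R density_measure M g"
  by (rule signed_measure_eqI) (use assms in \<open>simp add: sval_density_measure\<close>)

section \<open>Difference quotients\<close>

text \<open>The difference quotient is the mean of the derivative over the segment, here as a limit
  of sums over the starting points of n + 1 equal steps. On each step the mean value inequality
  compares the increment of G with that of its linearization.\<close>

lemma difference_quotient_riemann:
  fixes G g :: "real \<Rightarrow> real"
  assumes u: "u \<in> {0..1}" "u + h \<in> {0..1}" "h \<noteq> 0"
    and deriv: "\<And>v. v \<in> {0..1} \<Longrightarrow> (G has_real_derivative g v) (at v within {0..1})"
    and cont: "continuous_on {0..1} g"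
  shows "(\<lambda>n. (\<Sum>i\<le>n. g (u + h * (real i / real (Suc n)))) / real (Suc n)) \<longlonglongrightarrow> (G (u + h) - G u) / h"
proof (rule LIMSEQ_I)
  fix e :: real assume e: "0 < e"
  have "uniformly_continuous_on {0..1} g"
    using cont by (intro compact_uniformly_continuous) auto
  then obtain d where d: "0 < d" "\<And>x y. x \<in> {0..1} \<Longrightarrow> y \<in> {0..1} \<Longrightarrow> dist y x < d \<Longrightarrow> dist (g y) (g x) < e / 2"
    using e unfolding uniformly_continuous_on_def by (metis half_gt_zero)
  obtain N :: nat where N: "\<bar>h\<bar> / d < real N"
    using reals_Archimedean2 by blast
  show "\<exists>N. \<forall>n\<ge>N. norm ((\<Sum>i\<le>n. g (u + h * (real i / real (Suc n)))) / real (Suc n) - (G (u + h) - G u) / h) < e"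
  proof (intro exI[of _ N] allI impI)
    fix n assume n: "N \<le> n"
    define c where "c = h / real (Suc n)"
    have c: "c * real (Suc n) = h"
      by (simp add: c_def)
    define p where "p i = u + c * real i" for i
    have pI: "p i \<in> {0..1}" if "i \<le> Suc n" for i
    proof -
      define t where "t = real i / real (Suc n)"
      have t: "0 \<le> t" "t \<le> 1"
        using that by (auto simp: t_def)
      have "p i = u + h * t"
        by (simp add: p_def c_def t_def)
      also have "\<dots> = (1 - t) * u + t * (u + h)"
        by (simp add: algebra_simps)
      finally show ?thesis
        using convexD[OF convex_real_interval(5)[of 0 1] u(1,2), of "1 - t" t] t by simp
    qed
    have step: "p (Suc i) - p i = c" for i
      by (simp add: p_def algebra_simps)
    have small: "\<bar>c\<bar> < d"
    proof -
      have "\<bar>h\<bar> < d * real N"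
        using N d(1) by (simp add: field_simps)
      also have "\<dots> \<le> d * real (Suc n)"
        using n d(1) by (intro mult_left_mono) auto
      finally show ?thesis
        by (simp add: c_def abs_divide pos_divide_less_eq del: of_nat_Suc)
    qed
    have inc: "\<bar>G (p (Suc i)) - G (p i) - c * g (p i)\<bar> \<le> e / 2 * \<bar>c\<bar>" if i: "i \<le> n" for i
    proof -
      have pp: "p i \<in> {0..1}" "p (Suc i) \<in> {0..1}"
        using i by (auto intro!: pI simp del: atLeastAtMost_iff)
      have sub: "closed_segment (p i) (p (Suc i)) \<subseteq> {0..1}"
        using pp by (intro closed_segment_subset) auto
      \<comment> \<open>Subtracting the linear function of slope \<open>g (p i)\<close> turns the
        derivative into the oscillation of g over one step, which uniform continuity makes at most e
        / 2.\<close>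
      have "norm ((G (p (Suc i)) - g (p i) * p (Suc i)) - (G (p i) - g (p i) * p i)) \<le> e / 2 * norm (p (Suc i) - p i)"
      proof (rule field_differentiable_bound[where f' = "\<lambda>z. g z - g (p i)"])
        fix z assume z: "z \<in> closed_segment (p i) (p (Suc i))"
        then have zI: "z \<in> {0..1}"
          using sub by blast
        have "(G has_real_derivative g z) (at z within closed_segment (p i) (p (Suc i)))"
          by (rule DERIV_subset[OF deriv[OF zI] sub])
        then show "((\<lambda>z. G z - g (p i) * z) has_real_derivative g z - g (p i)) (at z within closed_segment (p i) (p (Suc i)))"
          by (auto intro!: derivative_eq_intros)
        have "dist z (p i) \<le> dist (p i) (p (Suc i))"
          using dist_in_closed_segment[OF z] by (simp add: dist_commute)
        also have "\<dots> = \<bar>c\<bar>"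
          unfolding step[of i, symmetric] by (simp add: dist_real_def)
        finally show "norm (g z - g (p i)) \<le> e / 2"
          using d(2)[OF pp(1) zI] small by (simp add: dist_real_def)
      qed auto
      also have "(G (p (Suc i)) - g (p i) * p (Suc i)) - (G (p i) - g (p i) * p i)
          = G (p (Suc i)) - G (p i) - (p (Suc i) - p i) * g (p i)"
        by (simp add: algebra_simps)
      finally show ?thesis
        by (simp add: step)
    qed
    have tel: "(\<Sum>i\<le>n. G (p (Suc i)) - G (p i)) = G (u + h) - G u"
      using sum_lessThan_telescope[of "\<lambda>i. G (p i)" "Suc n"] c by (simp add: lessThan_Suc_atMost p_def del: of_nat_Suc)
    have "\<bar>(G (u + h) - G u) - (\<Sum>i\<le>n. c * g (p i))\<bar> \<le> (\<Sum>i\<le>n. e / 2 * \<bar>c\<bar>)"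
      unfolding tel[symmetric] sum_subtractf[symmetric] using inc by (intro order_trans[OF sum_abs] sum_mono) auto
    also have "\<dots> = e / 2 * \<bar>h\<bar>"
      unfolding c[symmetric] abs_mult by simp
    also have "(G (u + h) - G u) - (\<Sum>i\<le>n. c * g (p i))
        = h * ((G (u + h) - G u) / h - (\<Sum>i\<le>n. g (p i)) / real (Suc n))"
    proof -
      have "h * ((G (u + h) - G u) / h) = G (u + h) - G u"
        using u(3) by simp
      moreover have "h * ((\<Sum>i\<le>n. g (p i)) / real (Suc n)) = (\<Sum>i\<le>n. c * g (p i))"
        unfolding sum_distrib_left[symmetric] by (simp add: c_def)
      ultimately show ?thesis
        unfolding right_diff_distrib[of h] by simp
    qed
    finally have "\<bar>h\<bar> * \<bar>(G (u + h) - G u) / h - (\<Sum>i\<le>n. g (p i)) / real (Suc n)\<bar> \<le> \<bar>h\<bar> * (e / 2)"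
      by (simp add: abs_mult mult.commute)
    then have "\<bar>(G (u + h) - G u) / h - (\<Sum>i\<le>n. g (p i)) / real (Suc n)\<bar> \<le> e / 2"
      using u(3) by (simp del: of_nat_Suc)
    moreover have "p i = u + h * (real i / real (Suc n))" for i
      by (simp add: p_def c_def)
    ultimately show "norm ((\<Sum>i\<le>n. g (u + h * (real i / real (Suc n)))) / real (Suc n) - (G (u + h) - G u) / h) < e"
      using e unfolding real_norm_def by (subst abs_minus_commute) (simp del: of_nat_Suc)
  qed
qed

text \<open>
  Riemann sums and Fatou's lemma stand in for Fubini's theorem, which would require \<open>M\<close> to be
  \<open>\<sigma>\<close>-finite.
\<close>

lemma nn_integral_difference_quotient_le:
  fixes G g :: "real \<Rightarrow> 'b \<Rightarrow> real"
  assumes u: "u \<in> {0..1}" "u + h \<in> {0..1}" "h \<noteq> 0"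
    and deriv: "\<And>v y. v \<in> {0..1} \<Longrightarrow> ((\<lambda>v. G v y) has_real_derivative g v y) (at v within {0..1})"
    and cont: "\<And>y. continuous_on {0..1} (\<lambda>v. g v y)"
    and meas: "\<And>v. v \<in> {0..1} \<Longrightarrow> g v \<in> borel_measurable M" "W \<in> borel_measurable M" "\<And>y. 0 \<le> W y"
    and K: "\<And>t. t \<in> {0..1} \<Longrightarrow> (\<integral>\<^sup>+y. ennreal (\<bar>g (u + h * t) y - g u y\<bar> * W y) \<partial>M) \<le> K"
  shows "(\<integral>\<^sup>+y. ennreal (\<bar>(G (u + h) y - G u y) / h - g u y\<bar> * W y) \<partial>M) \<le> K"
proof -
  note [measurable] = meas(2)
  define t where "t n i = real i / real (Suc n)" for n i :: nat
  have t: "t n i \<in> {0..1}" if "i \<le> n" for n i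
    using that by (auto simp: t_def)
  have tI: "u + h * t n i \<in> {0..1}" if "i \<le> n" for n i
  proof -
    have "u + h * t n i = (1 - t n i) * u + t n i * (u + h)"
      by (simp add: algebra_simps)
    then show ?thesis
      using convexD[OF convex_real_interval(5)[of 0 1] u(1,2), of "1 - t n i" "t n i"] t[OF that] by simp
  qed
  have gm [measurable]: "i \<le> n \<Longrightarrow> g (u + h * t n i) \<in> borel_measurable M" "g u \<in> borel_measurable M" for n i
    using tI u by (auto intro!: meas(1) simp del: atLeastAtMost_iff)
  define a where "a n y = \<bar>(\<Sum>i\<le>n. g (u + h * t n i) y) / real (Suc n) - g u y\<bar> * W y" for n y
  have am [measurable]: "a n \<in> borel_measurable M" for n
    unfolding a_def by (intro borel_measurable_times borel_measurable_abs borel_measurable_diff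
        borel_measurable_divide borel_measurable_sum gm meas) auto
  have "(\<lambda>n. ennreal (a n y)) \<longlonglongrightarrow> ennreal (\<bar>(G (u + h) y - G u y) / h - g u y\<bar> * W y)" for y
    unfolding a_def t_def
    by (intro tendsto_ennrealI tendsto_mult tendsto_rabs tendsto_diff tendsto_const
        difference_quotient_riemann u deriv cont)
  then have "liminf (\<lambda>n. ennreal (a n y)) = ennreal (\<bar>(G (u + h) y - G u y) / h - g u y\<bar> * W y)" for y
    by (intro lim_imp_Liminf) auto
  then have "(\<integral>\<^sup>+y. ennreal (\<bar>(G (u + h) y - G u y) / h - g u y\<bar> * W y) \<partial>M) = (\<integral>\<^sup>+y. liminf (\<lambda>n. ennreal (a n y)) \<partial>M)"
    by simp
  also have "\<dots> \<le> liminf (\<lambda>n. \<integral>\<^sup>+y. ennreal (a n y) \<partial>M)"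
    by (intro nn_integral_liminf) auto
  also have "\<dots> \<le> liminf (\<lambda>n. K)"
  proof (intro Liminf_mono always_eventually allI)
    fix n
    \<comment> \<open>The modulus of an average is at most the average of the moduli: each of the n
      + 1 terms has weight 1 / (n + 1) and, without it, integral at most K, so the total is at most
      K again.\<close>
    have "a n y \<le> (\<Sum>i\<le>n. \<bar>g (u + h * t n i) y - g u y\<bar> * W y / real (Suc n))" for y
    proof -
      have "(\<Sum>i\<le>n. g (u + h * t n i) y) / real (Suc n) - g u y = (\<Sum>i\<le>n. g (u + h * t n i) y - g u y) / real (Suc n)"
        by (simp add: sum_subtractf diff_divide_distrib)
      also have "\<bar>\<dots>\<bar> \<le> (\<Sum>i\<le>n. \<bar>g (u + h * t n i) y - g u y\<bar>) / real (Suc n)"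
        by (simp add: abs_divide divide_right_mono sum_abs)
      finally have "a n y \<le> (\<Sum>i\<le>n. \<bar>g (u + h * t n i) y - g u y\<bar>) / real (Suc n) * W y"
        unfolding a_def using meas(3) by (rule mult_right_mono)
      then show ?thesis
        by (simp add: sum_divide_distrib sum_distrib_right)
    qed
    then have "(\<integral>\<^sup>+y. ennreal (a n y) \<partial>M) \<le> (\<integral>\<^sup>+y. (\<Sum>i\<le>n. ennreal (\<bar>g (u + h * t n i) y - g u y\<bar> * W y) * ennreal (1 / real (Suc n))) \<partial>M)"
      using meas(3) by (intro nn_integral_mono) (auto simp: ennreal_mult'[symmetric] intro!: ennreal_leI)
    also have "\<dots> = (\<Sum>i\<le>n. (\<integral>\<^sup>+y. ennreal (\<bar>g (u + h * t n i) y - g u y\<bar> * W y) \<partial>M) * ennreal (1 / real (Suc n)))"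
      using gm meas(2) by (subst nn_integral_sum) (auto simp: nn_integral_multc)
    also have "\<dots> \<le> (\<Sum>i\<le>n. K * ennreal (1 / real (Suc n)))"
      using t by (intro sum_mono mult_right_mono K) (auto simp del: atLeastAtMost_iff)
    also have "\<dots> = K * (ennreal (real (Suc n)) * ennreal (1 / real (Suc n)))"
      by (simp add: ennreal_of_nat_eq_real_of_nat mult.left_commute)
    also have "\<dots> = K"
      by (simp add: ennreal_mult'[symmetric] del: of_nat_Suc)
    finally show "(\<integral>\<^sup>+y. ennreal (a n y) \<partial>M) \<le> K" .
  qed
  also have "\<dots> = K"
    by (simp add: Liminf_const)
  finally show ?thesis .
qed

text \<open>Dominated convergence against \<open>variation m\<close>; the majorant is integrable
  because \<open>m\<close> lies in \<open>MV V\<close>. The limit along increments is tested on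
  sequences, for which that theorem is stated.\<close>

lemma vnull_dominated:
  assumes m: "m \<in> MV V" and V: "V \<in> borel_measurable borel" "\<And>x. 0 \<le> V x" and C: "0 \<le> C"
    and b: "\<And>h. u + h \<in> {0..1} \<Longrightarrow> h \<noteq> 0 \<Longrightarrow> b h \<in> borel_measurable borel"
      "\<And>h x. u + h \<in> {0..1} \<Longrightarrow> h \<noteq> 0 \<Longrightarrow> b h x \<le> ennreal (C * V x)"
      "\<And>x. ((\<lambda>h. b h x) \<longlongrightarrow> 0) (increments u)"
    and X: "\<And>h. u + h \<in> {0..1} \<Longrightarrow> h \<noteq> 0 \<Longrightarrow> vnorm W (X h) \<le> (\<integral>\<^sup>+x. b h x \<partial>variation m)"
  shows "vnull u W X"
proof -
  have lim: "((\<lambda>h. \<integral>\<^sup>+x. b h x \<partial>variation m) \<longlongrightarrow> 0) (increments u)"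
    unfolding tendsto_at_iff_sequentially
  proof (intro allI impI)
    fix h :: "nat \<Rightarrow> real" assume h: "\<forall>i. h i \<in> {h. u + h \<in> {0..1}} - {0}" "h \<longlonglongrightarrow> 0"
    have hi: "u + h i \<in> {0..1}" "h i \<noteq> 0" for i
      using h(1) by simp_all
    have "(\<lambda>i. \<integral>\<^sup>+x. b (h i) x \<partial>variation m) \<longlonglongrightarrow> (\<integral>\<^sup>+x. 0 \<partial>variation m)"
    proof (rule nn_integral_dominated_convergence[where w = "\<lambda>x. ennreal (C * V x)"])
      show "b (h i) \<in> borel_measurable (variation m)" for i
        using b(1)[OF hi] by (simp add: measurable_cong_sets[OF sets_variation refl])
      show "(\<lambda>x. ennreal (C * V x)) \<in> borel_measurable (variation m)"
        using V(1) by (simp add: measurable_cong_sets[OF sets_variation refl])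
      have "(\<integral>\<^sup>+x. ennreal (C * V x) \<partial>variation m) = ennreal C * vnorm V m"
        using V C by (simp add: vnorm_def ennreal_mult' nn_integral_cmult measurable_cong_sets[OF sets_variation refl])
      also have "\<dots> < \<infinity>"
        using m by (simp add: MV_def ennreal_mult_less_top)
      finally show "(\<integral>\<^sup>+x. ennreal (C * V x) \<partial>variation m) < \<infinity>" .
      show "AE x in variation m. b (h i) x \<le> ennreal (C * V x)" for i
        using b(2)[OF hi] by simp
      show "AE x in variation m. (\<lambda>i. b (h i) x) \<longlonglongrightarrow> 0"
        using b(3)[unfolded tendsto_at_iff_sequentially comp_def, rule_format, OF h(1)[rule_format] h(2)]
        by (rule AE_I2)
    qed simp
    then show "((\<lambda>h. \<integral>\<^sup>+x. b h x \<partial>variation m) \<circ> h) \<longlonglongrightarrow> 0"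
      by (simp add: comp_def)
  qed
  have "eventually (\<lambda>h. vnorm W (X h) \<le> (\<integral>\<^sup>+x. b h x \<partial>variation m)) (increments u)"
    using eventually_increments[of u] by eventually_elim (rule X, auto)
  then show ?thesis
    unfolding vnull_def by (rule tendsto_sandwich[OF always_eventually _ tendsto_const lim, rotated]) simp
qed

section \<open>Smooth families of Markov kernels\<close>

text \<open>The sequence enumerates the rationals of the unit interval. It is chosen before the
  function, so one sequence will serve all pairs (x, y).\<close>

lemma zero_if_zero_on_dense_sequence:
  "\<exists>q :: nat \<Rightarrow> real. range q \<subseteq> {0..1} \<and>
    (\<forall>\<phi> :: real \<Rightarrow> real. continuous_on {0..1} \<phi> \<longrightarrow> (\<forall>n. \<phi> (q n) = 0) \<longrightarrow> (\<forall>u\<in>{0..1}. \<phi> u = 0))"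
proof -
  define X :: "real set" where "X = {0..1} \<inter> \<rat>"
  have "0 \<in> X"
    by (simp add: X_def)
  then have X: "countable X" "X \<noteq> {}"
    by (simp add: X_def countable_rat, blast)
  define q where "q = from_nat_into X"
  have q: "range q = X"
    unfolding q_def using X by (rule range_from_nat_into[rotated])
  show ?thesis
  proof (intro exI[of _ q] conjI allI impI)
    show "range q \<subseteq> {0..1}"
      by (auto simp: q X_def)
    fix \<phi> :: "real \<Rightarrow> real" assume \<phi>: "continuous_on {0..1} \<phi>" "\<forall>n. \<phi> (q n) = 0"
    show "\<forall>u\<in>{0..1}. \<phi> u = 0"
    proof (rule ballI, rule ccontr)
      fix u :: real assume u: "u \<in> {0..1}" "\<phi> u \<noteq> 0"
      obtain d where d: "d > 0" "\<forall>v\<in>{0..1}. dist v u < d \<longrightarrow> dist (\<phi> v) (\<phi> u) < \<bar>\<phi> u\<bar>"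
        using \<phi>(1)[unfolded continuous_on_iff, rule_format, OF u(1), of "\<bar>\<phi> u\<bar>"] u(2) by auto
      \<comment> \<open>Cutting the neighbourhood at 0 and 1 leaves a nonempty open interval also
        when u is an endpoint.\<close>
      have "max 0 (u - d) < min 1 (u + d)"
        using u(1) d(1) by auto
      then obtain r where r: "r \<in> \<rat>" "max 0 (u - d) < r" "r < min 1 (u + d)"
        using Rats_dense_in_real by blast
      then have "r \<in> X"
        by (simp add: X_def)
      then have "\<phi> r = 0"
        using \<phi>(2) unfolding q[symmetric] by auto
      moreover have "dist (\<phi> r) (\<phi> u) < \<bar>\<phi> u\<bar>"
        using r d(2) by (auto simp: dist_real_def)
      ultimately show False
        by (simp add: dist_real_def)
    qed
  qed
qed

locale smooth_markov =
  fixes \<gamma> :: "'a::topological_space \<Rightarrow> 'a measure"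
    and f :: "real \<Rightarrow> 'a \<Rightarrow> 'a \<Rightarrow> real"
    and df :: "nat \<Rightarrow> real \<Rightarrow> 'a \<Rightarrow> 'a \<Rightarrow> real"
    and P :: "real \<Rightarrow> 'a \<Rightarrow> 'a measure"
    and \<mu> :: "real \<Rightarrow> 'a measure"
    and V :: "nat \<Rightarrow> 'a \<Rightarrow> real"
    and k :: nat
  assumes gamma: "measure_kernel \<gamma>"
    and f_meas: "(\<lambda>(u, x, y). f u x y) \<in>
          borel_measurable (restrict_space borel {0..1} \<Otimes>\<^sub>M borel \<Otimes>\<^sub>M borel)"
    and f_nonneg: "\<And>u x y. u \<in> {0..1} \<Longrightarrow> 0 \<le> f u x y"
    and P_def: "P = (\<lambda>u x. density (\<gamma> x) (\<lambda>y. ennreal (f u x y)))"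
    and P_markov: "\<And>u. u \<in> {0..1} \<Longrightarrow> P u \<in> borel \<rightarrow>\<^sub>M prob_algebra borel"
    and k: "1 \<le> k"
    and V_meas: "\<And>l. l \<le> k \<Longrightarrow> V l \<in> borel_measurable borel"
    and V_ge1: "\<And>l x. l \<le> k \<Longrightarrow> 1 \<le> V l x"
    and V_Suc: "\<And>l x. l < k \<Longrightarrow> V l x \<le> V (Suc l) x"
    and B1_inv: "\<And>u. u \<in> {0..1} \<Longrightarrow> invariant_prob (P u) (\<mu> u)"
    and B1_int: "\<And>u. u \<in> {0..1} \<Longrightarrow> (\<integral>\<^sup>+x. ennreal (V k x) \<partial>\<mu> u) < \<infinity>"
    and B1_erg: "\<And>l. l \<le> k \<Longrightarrow> \<exists>\<kappa>::real. 0 < \<kappa> \<and> \<kappa> < 1 \<and> (\<exists>c>0. \<forall>\<^sub>F n in sequentially.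
          (SUP u\<in>{0..1}. SUP x. vnorm (V l) ((kernel_op (\<lambda>x A. measure (P u x) A) ^^ n) (dirac x) - of_measure (\<mu> u)) / ennreal (V l x))
            \<le> ennreal (c * \<kappa> ^ n))"
    and B2_zero: "\<And>u x y. u \<in> {0..1} \<Longrightarrow> df 0 u x y = f u x y"
    and B2_deriv: "\<And>l u x y. l < k \<Longrightarrow> u \<in> {0..1} \<Longrightarrow>
          ((\<lambda>v. df l v x y) has_real_derivative df (Suc l) u x y) (at u within {0..1})"
    and B2_cont: "\<And>x y. continuous_on {0..1} (\<lambda>u. df k u x y)"
    and B3_bound: "\<exists>C>0. \<forall>s l x. s + l \<le> k \<longrightarrow>
          (SUP u\<in>{0..1}. \<integral>\<^sup>+y. ennreal (\<bar>df l u x y\<bar> * V s y) \<partial>\<gamma> x) \<le> ennreal (C * V (s + l) x)"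
    and B3_cont: "\<And>u x s. u \<in> {0..1} \<Longrightarrow> s \<le> k \<Longrightarrow>
          ((\<lambda>h. \<integral>\<^sup>+y. ennreal (\<bar>df (k - s) (u + h) x y - df (k - s) u x y\<bar> * V s y) \<partial>\<gamma> x) \<longlongrightarrow> 0)
            (increments u)"
begin

abbreviation T :: "real \<Rightarrow> 'a signed_measure \<Rightarrow> 'a signed_measure" where
  "T u \<equiv> kernel_op (\<lambda>x A. measure (P u x) A)"

definition D :: "nat \<Rightarrow> real \<Rightarrow> 'a signed_measure \<Rightarrow> 'a signed_measure" where
  "D l u = (if l = 0 then T u else kernel_op (\<lambda>x A. LINT y:A|\<gamma> x. df l u x y))"

text \<open>The kernels behind \<open>D\<close> as maps into signed measures. By \<open>D_eq\<close>
  both \<open>T\<close> and its derivatives become instances of \<open>kop\<close>, so one calculus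
  covers them.\<close>

definition Q :: "nat \<Rightarrow> real \<Rightarrow> 'a \<Rightarrow> 'a signed_measure" where
  "Q l u x = density_measure (\<gamma> x) (df l u x)"

definition C :: real where
  "C = (SOME C. 0 < C \<and> (\<forall>s l x. s + l \<le> k \<longrightarrow>
     (SUP u\<in>{0..1}. \<integral>\<^sup>+y. ennreal (\<bar>df l u x y\<bar> * V s y) \<partial>\<gamma> x) \<le> ennreal (C * V (s + l) x)))"

lemma C_pos: "0 < C"
  and df_bound: "s + l \<le> k \<Longrightarrow> u \<in> {0..1} \<Longrightarrow>
    (\<integral>\<^sup>+y. ennreal (\<bar>df l u x y\<bar> * V s y) \<partial>\<gamma> x) \<le> ennreal (C * V (s + l) x)"
proof -
  have *: "0 < C \<and> (\<forall>s l x. s + l \<le> k \<longrightarrow>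
     (SUP u\<in>{0..1}. \<integral>\<^sup>+y. ennreal (\<bar>df l u x y\<bar> * V s y) \<partial>\<gamma> x) \<le> ennreal (C * V (s + l) x))"
    unfolding C_def by (rule someI_ex) (use B3_bound in blast)
  then show "0 < C"
    by simp
  assume "s + l \<le> k" and u: "u \<in> {0..1}"
  then have "(SUP u\<in>{0..1}. \<integral>\<^sup>+y. ennreal (\<bar>df l u x y\<bar> * V s y) \<partial>\<gamma> x) \<le> ennreal (C * V (s + l) x)"
    using * by blast
  then show "(\<integral>\<^sup>+y. ennreal (\<bar>df l u x y\<bar> * V s y) \<partial>\<gamma> x) \<le> ennreal (C * V (s + l) x)"
    by (rule order_trans[OF SUP_upper[OF u]])
qed

section \<open>Measurability and integrability of the densities and of their kernels\<close>

lemma sets_gamma [simp, measurable_cong]: "sets (\<gamma> x) = sets borel"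
  using gamma by (simp add: measure_kernel_def)

lemma V_nonneg: "l \<le> k \<Longrightarrow> 0 \<le> V l x"
  using V_ge1[of l x] by simp

lemma V_mono: "i \<le> j \<Longrightarrow> j \<le> k \<Longrightarrow> V i x \<le> V j x"
proof (induction j rule: dec_induct)
  case (step n)
  then show ?case
    using V_Suc[of n x] by simp
qed simp

lemma prob_space_P: "u \<in> {0..1} \<Longrightarrow> prob_space (P u x)"
  and sets_P: "u \<in> {0..1} \<Longrightarrow> sets (P u x) = sets borel"
  using measurable_space[OF P_markov, of u x] by (auto simp: space_prob_algebra)

text \<open>Joint measurability in (x, y) passes from one derivative to the next, because the
  derivative is a pointwise limit of difference quotients along a sequence that does not depend on
  (x, y).\<close>

lemma df_measurable:
  "l \<le> k \<Longrightarrow> u \<in> {0..1} \<Longrightarrow> (\<lambda>z. df l u (fst z) (snd z)) \<in> borel_measurable (borel \<Otimes>\<^sub>M borel)"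
proof (induction l arbitrary: u)
  case 0
  have "(\<lambda>z. (u, z)) \<in> borel \<Otimes>\<^sub>M borel \<rightarrow>\<^sub>M restrict_space borel {0..1} \<Otimes>\<^sub>M borel \<Otimes>\<^sub>M borel"
    using 0 by (intro measurable_Pair1') (simp add: space_restrict_space)
  from measurable_compose[OF this f_meas] show ?case
    using 0 by (simp add: B2_zero split_beta)
next
  case (Suc l)
  \<comment> \<open>An endpoint different from u: the points \<open>v n\<close> move from c towards
    u inside the interval and never reach u.\<close>
  define c :: real where "c = (if u = 0 then 1 else 0)"
  define v where "v n = u + (c - u) * inverse (real (Suc n))" for n
  have v: "v n \<in> {0..1} - {u}" for n
  proof -
    define t where "t = inverse (real (Suc n))"
    have t: "0 < t" "t \<le> 1"
      by (simp_all add: t_def inverse_le_1_iff)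
    have "v n = (1 - t) * u + t * c"
      by (simp add: v_def t_def algebra_simps)
    moreover have "(1 - t) *\<^sub>R u + t *\<^sub>R c \<in> {0..1}"
      using Suc.prems t by (intro convexD convex_real_interval) (auto simp: c_def)
    moreover have "v n \<noteq> u"
      using t by (auto simp: v_def c_def simp flip: t_def)
    ultimately show ?thesis
      by simp
  qed
  have vlim: "v \<longlonglongrightarrow> u"
    unfolding v_def using tendsto_add[OF tendsto_const tendsto_mult[OF tendsto_const LIMSEQ_inverse_real_of_nat], of u "c - u"]
    by simp
  show ?case
  proof (rule borel_measurable_LIMSEQ_real)
    fix z
    have "((\<lambda>w. (df l w (fst z) (snd z) - df l u (fst z) (snd z)) / (w - u)) \<longlongrightarrow> df (Suc l) u (fst z) (snd z)) (at u within {0..1})"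
      using B2_deriv[of l u "fst z" "snd z"] Suc.prems by (simp add: has_field_derivative_iff)
    then show "(\<lambda>n. (df l (v n) (fst z) (snd z) - df l u (fst z) (snd z)) / (v n - u)) \<longlonglongrightarrow> df (Suc l) u (fst z) (snd z)"
      unfolding tendsto_at_iff_sequentially comp_def using v vlim by simp
  next
    fix n
    show "(\<lambda>z. (df l (v n) (fst z) (snd z) - df l u (fst z) (snd z)) / (v n - u)) \<in> borel_measurable (borel \<Otimes>\<^sub>M borel)"
      using Suc.IH[of "v n"] Suc.IH[of u] v[of n] Suc.prems by (intro borel_measurable_divide borel_measurable_diff) auto
  qed
qed

lemma df_measurable_snd:
  assumes "l \<le> k" "u \<in> {0..1}"
  shows "df l u x \<in> borel_measurable borel"
  using measurable_compose[OF measurable_Pair1'[of x borel borel] df_measurable[OF assms]] by simp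

lemma df_continuous: "l \<le> k \<Longrightarrow> continuous_on {0..1} (\<lambda>u. df l u x y)"
proof (cases "l = k")
  case False
  assume "l \<le> k"
  with False show ?thesis
    by (intro DERIV_continuous_on[where D = "\<lambda>u. df (Suc l) u x y"] B2_deriv) auto
qed (simp add: B2_cont)

text \<open>Integrals against \<open>\<gamma>\<close> are shown measurable for integrands that
  vanish wherever all \<open>f u\<close> vanish; this lets the derivatives qualify.\<close>

lemma df_zero:
  assumes "\<forall>u\<in>{0..1}. f u x y = 0"
  shows "l \<le> k \<Longrightarrow> u \<in> {0..1} \<Longrightarrow> df l u x y = 0"
proof (induction l arbitrary: u)
  case 0
  then show ?case
    using assms by (simp add: B2_zero)
next
  case (Suc l)
  have "((\<lambda>w. (df l w x y - df l u x y) / (w - u)) \<longlongrightarrow> df (Suc l) u x y) (at u within {0..1})"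
    using B2_deriv[of l u x y] Suc.prems by (simp add: has_field_derivative_iff)
  moreover have "eventually (\<lambda>w. (df l w x y - df l u x y) / (w - u) = 0) (at u within {0..1})"
    using Suc by (auto simp: eventually_at_filter)
  ultimately have "((\<lambda>w. 0) \<longlongrightarrow> df (Suc l) u x y) (at u within {0..1})"
    by (rule Lim_transform_eventually)
  moreover have "at u within {0..1} \<noteq> bot"
    using Suc.prems by (simp add: trivial_limit_within)
  ultimately show ?case
    by (simp add: tendsto_const_iff)
qed

text \<open>
  A kernel \<open>\<gamma>\<close> need not be \<open>s\<close>-finite, but it is so where some \<open>f u\<close> is nonzero: there \<open>\<gamma>\<close> is a
  countable sum of measures with densities \<open>1 / f (q n)\<close> with respect to the probability kernels
  \<open>P (q n)\<close>, where \<open>q\<close> is dense in the unit interval.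
\<close>

lemma nn_integral_gamma_measurable:
  fixes G :: "'a \<Rightarrow> 'a \<Rightarrow> ennreal"
  assumes G [measurable]: "(\<lambda>z. G (fst z) (snd z)) \<in> borel_measurable (borel \<Otimes>\<^sub>M borel)"
    and G0: "\<And>x y. \<forall>u\<in>{0..1}. f u x y = 0 \<Longrightarrow> G x y = 0"
  shows "(\<lambda>x. \<integral>\<^sup>+y. G x y \<partial>\<gamma> x) \<in> borel_measurable borel"
proof -
  obtain q :: "nat \<Rightarrow> real" where q': "range q \<subseteq> {0..1} \<and>
      (\<forall>\<phi> :: real \<Rightarrow> real. continuous_on {0..1} \<phi> \<longrightarrow> (\<forall>n. \<phi> (q n) = 0) \<longrightarrow> (\<forall>u\<in>{0..1}. \<phi> u = 0))"
    using zero_if_zero_on_dense_sequence by (rule exE)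
  note q = conjunct1[OF q'] and qd = conjunct2[OF q']
  have qI: "q n \<in> {0..1}" for n
    using subsetD[OF q rangeI] .
  have fm [measurable]: "(\<lambda>z. f (q n) (fst z) (snd z)) \<in> borel_measurable (borel \<Otimes>\<^sub>M borel)" for n
    using df_measurable[of 0 "q n"] qI[of n] by (simp add: B2_zero)
  \<comment> \<open>\<open>H n\<close> is active only where n is the first index with
    \<open>f (q n)\<close> nonzero, so at each (x, y) at most one term of the series
    survives.\<close>
  define H where "H n x y = (if 0 < f (q n) x y \<and> (\<forall>m<n. f (q m) x y = 0) then G x y / ennreal (f (q n) x y) else 0)" for n x y
  have Hm [measurable]: "(\<lambda>z. H n (fst z) (snd z)) \<in> borel_measurable (borel \<Otimes>\<^sub>M borel)" for n
    unfolding H_def by measurable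
  have "G x y = (\<Sum>n. ennreal (f (q n) x y) * H n x y)" for x y
  proof (cases "\<forall>n. f (q n) x y = 0")
    case True
    have "continuous_on {0..1} (\<lambda>u. f u x y)"
      by (rule continuous_on_eq[OF df_continuous[of 0 x y]]) (simp_all add: B2_zero)
    then have "\<forall>u\<in>{0..1}. f u x y = 0"
      using spec[OF qd, of "\<lambda>u. f u x y"] True by blast
    then have "G x y = 0"
      by (rule G0)
    then show ?thesis
      using True by simp
  next
    case False
    define N where "N = (LEAST n. f (q n) x y \<noteq> 0)"
    have N: "f (q N) x y \<noteq> 0"
      unfolding N_def by (rule LeastI_ex) (use False in simp)
    have Nm: "f (q m) x y = 0" if "m < N" for m
      using not_less_Least[OF that[unfolded N_def]] by simp
    have pos: "0 < f (q N) x y"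
      using N f_nonneg[OF qI, of N x y] by simp
    have "(\<Sum>n. ennreal (f (q n) x y) * H n x y) = (\<Sum>n\<in>{N}. ennreal (f (q n) x y) * H n x y)"
    proof (rule suminf_finite)
      fix n assume "n \<notin> {N}"
      then consider "n < N" | "N < n"
        by fastforce
      then show "ennreal (f (q n) x y) * H n x y = 0"
      proof cases
        case 2
        then show ?thesis
          using N by (auto simp: H_def)
      qed (simp add: Nm)
    qed simp
    also have "\<dots> = ennreal (f (q N) x y) * (G x y / ennreal (f (q N) x y))"
      using Nm pos by (simp add: H_def)
    also have "\<dots> = G x y"
      using pos by (simp add: ennreal_times_divide mult.commute[of _ "G x y"] ennreal_mult_divide_eq)
    finally show ?thesis
      by simp
  qed
  moreover have "(\<lambda>y. H n x y) \<in> borel_measurable borel" "(\<lambda>y. f (q n) x y) \<in> borel_measurable borel" for n x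
    using measurable_compose[OF measurable_Pair1'[of x borel borel] Hm[of n]]
      measurable_compose[OF measurable_Pair1'[of x borel borel] fm[of n]] by simp_all
  \<comment> \<open>Integrating term by term, the factor \<open>f (q n)\<close> is absorbed into the
    Markov kernel \<open>P (q n)\<close>, whose integrals depend measurably on x.\<close>
  ultimately have "(\<integral>\<^sup>+y. G x y \<partial>\<gamma> x) = (\<Sum>n. \<integral>\<^sup>+y. H n x y \<partial>P (q n) x)" for x
    by (simp add: nn_integral_suminf P_def nn_integral_density measurable_cong_sets[OF sets_gamma refl])
  moreover have "(\<lambda>x. \<integral>\<^sup>+y. H n x y \<partial>P (q n) x) \<in> borel_measurable borel" for n
    using Hm[of n] measurable_prob_algebraD[OF P_markov[OF qI[of n]]]
    by (intro nn_integral_measurable_subprob_algebra2) (auto simp: split_beta)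
  ultimately show ?thesis
    by simp
qed

lemma integrable_df:
  assumes "l \<le> k" "u \<in> {0..1}"
  shows "integrable (\<gamma> x) (df l u x)"
proof -
  have "(\<integral>\<^sup>+y. ennreal (norm (df l u x y)) \<partial>\<gamma> x) \<le> (\<integral>\<^sup>+y. ennreal (\<bar>df l u x y\<bar> * V 0 y) \<partial>\<gamma> x)"
    using V_ge1[of 0] by (intro nn_integral_mono ennreal_leI) (simp add: mult_le_cancel_left1)
  also have "\<dots> \<le> ennreal (C * V (0 + l) x)"
    using assms by (intro df_bound) auto
  also have "\<dots> < \<infinity>"
    by simp
  finally show ?thesis
    using df_measurable_snd[OF assms, of x] by (simp add: integrable_iff_bounded measurable_cong_sets[OF sets_gamma refl])
qed

lemma sval_Q: "l \<le> k \<Longrightarrow> u \<in> {0..1} \<Longrightarrow> A \<in> sets borel \<Longrightarrow> sval (Q l u x) A = (LINT y:A|\<gamma> x. df l u x y)"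
  unfolding Q_def by (intro sval_density_measure integrable_df sets_gamma)

lemma sval_Q_0:
  assumes "u \<in> {0..1}" "A \<in> sets borel"
  shows "sval (Q 0 u x) A = measure (P u x) A"
proof -
  have "integrable (\<gamma> x) (df 0 u x)"
    using assms by (intro integrable_df) auto
  moreover have "(\<lambda>y. ennreal (- df 0 u x y)) = (\<lambda>y. 0)"
    using f_nonneg[OF assms(1)] by (simp add: B2_zero[OF assms(1)] ennreal_neg)
  moreover have "density (\<gamma> x) (\<lambda>y. ennreal (df 0 u x y)) = P u x"
    by (simp add: P_def B2_zero[OF assms(1)])
  ultimately show ?thesis
    using assms density_finite[of "\<gamma> x" "df 0 u x"] sets_P[OF assms(1)]
    by (simp add: Q_def density_measure_def sval_of_measure Sigma_Algebra.measure_def emeasure_density)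
qed

lemma D_eq:
  assumes "l \<le> k" "u \<in> {0..1}"
  shows "D l u = kop (Q l u)"
proof (cases "l = 0")
  case True
  then show ?thesis
    using assms by (simp add: D_def sval_Q_0 cong: kernel_op_cong)
next
  case False
  then show ?thesis
    using assms by (simp add: D_def sval_Q cong: kernel_op_cong)
qed

text \<open>The factor c will be 1 and -1: after truncation by \<open>ennreal\<close> these give the
  positive and the negative part of the derivative.\<close>

lemma nn_integral_df_measurable:
  assumes "l \<le> k" "u \<in> {0..1}" "A \<in> sets borel"
  shows "(\<lambda>x. \<integral>\<^sup>+y. ennreal (c * df l u x y) * indicator A y \<partial>\<gamma> x) \<in> borel_measurable borel"
proof (rule nn_integral_gamma_measurable)
  note [measurable] = df_measurable[OF assms(1,2)] assms(3)
  show "(\<lambda>z. ennreal (c * df l u (fst z) (snd z)) * indicator A (snd z)) \<in> borel_measurable (borel \<Otimes>\<^sub>M borel)"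
    by measurable
  show "ennreal (c * df l u x y) * indicator A y = 0" if "\<forall>u\<in>{0..1}. f u x y = 0" for x y
    using df_zero[OF that assms(1,2)] by simp
qed

lemma sval_Q_measurable:
  assumes "l \<le> k" "u \<in> {0..1}" "A \<in> sets borel"
  shows "(\<lambda>x. sval (Q l u x) A) \<in> borel_measurable borel"
proof -
  have "sval (Q l u x) A = enn2real (\<integral>\<^sup>+y. ennreal (1 * df l u x y) * indicator A y \<partial>\<gamma> x)
      - enn2real (\<integral>\<^sup>+y. ennreal (- 1 * df l u x y) * indicator A y \<partial>\<gamma> x)" for x
    using assms density_finite[OF sets_gamma integrable_df[OF assms(1,2)], of x] df_measurable_snd[OF assms(1,2), of x]
    by (simp add: Q_def density_measure_def sval_of_measure Sigma_Algebra.measure_def emeasure_density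
        measurable_cong_sets[OF sets_gamma refl])
  then show ?thesis
    using nn_integral_df_measurable[OF assms, of 1] nn_integral_df_measurable[OF assms, of "-1"] by simp
qed

lemma vnorm_Q:
  assumes "s + l \<le> k" "u \<in> {0..1}"
  shows "vnorm (V s) (Q l u x) \<le> ennreal (C * V (s + l) x)"
proof -
  have "vnorm (V s) (Q l u x) \<le> (\<integral>\<^sup>+y. ennreal (\<bar>df l u x y\<bar> * V s y) \<partial>\<gamma> x)"
    unfolding Q_def using assms by (intro vnorm_density_measure_le integrable_df V_meas V_nonneg sets_gamma) auto
  also have "\<dots> \<le> ennreal (C * V (s + l) x)"
    by (rule df_bound[OF assms])
  finally show ?thesis .
qed

lemma signed_kernel_Q:
  assumes "l \<le> j" "j \<le> k" "u \<in> {0..1}"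
  shows "signed_kernel (V j) (Q l u)"
proof -
  have "vnorm (\<lambda>_. 1) (Q l u x) \<le> ennreal (C * V l x)" for x
  proof -
    have "vnorm (\<lambda>_. 1) (Q l u x) \<le> vnorm (V 0) (Q l u x)"
      using V_ge1[of 0] by (intro vnorm_mono) simp
    also have "\<dots> \<le> ennreal (C * V l x)"
      using vnorm_Q[of 0 l u x] assms by simp
    finally show ?thesis .
  qed
  then have "signed_kernel (V l) (Q l u)"
    using sval_Q_measurable[of l u] assms C_pos by (auto simp: signed_kernel_def intro!: exI[of _ C])
  then show ?thesis
    by (rule signed_kernel_weaken) (use V_mono assms in auto)
qed

section \<open>Uniform bounds, strong continuity and strong derivatives of the operators\<close>

lemma D_bound:
  assumes "s + l \<le> k" "u \<in> {0..1}" "m \<in> MV (V (s + l))"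
  shows "vnorm (V s) (D l u m) \<le> ennreal C * vnorm (V (s + l)) m"
proof -
  have sl: "l \<le> k" "s \<le> k" "l \<le> s + l"
    using assms by auto
  show ?thesis
    unfolding D_eq[OF sl(1) assms(2)]
    by (rule vnorm_kernel_op_le[OF V_meas[OF assms(1)] V_ge1[OF assms(1)] assms(3)
        signed_kernel_Q[OF sl(3) assms(1,2)] V_meas[OF sl(2)] V_nonneg[OF sl(2)] less_imp_le[OF C_pos] vnorm_Q[OF assms(1,2)]])
qed

lemma D_linear:
  assumes "l \<le> k" "u \<in> {0..1}"
  shows "linear_map_on (MV (V l)) (D l u)"
  unfolding linear_map_on_def D_eq[OF assms]
  using kernel_op_plus[OF V_meas[OF assms(1)] V_ge1[OF assms(1)] signed_kernel_Q[OF order_refl assms]]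
    kernel_op_scaleR[OF V_meas[OF assms(1)] V_ge1[OF assms(1)] signed_kernel_Q[OF order_refl assms]]
  by blast

lemma df_diff_bound:
  assumes "s + l \<le> k" "u \<in> {0..1}" "v \<in> {0..1}"
  shows "(\<integral>\<^sup>+y. ennreal (\<bar>df l v x y - df l u x y\<bar> * V s y) \<partial>\<gamma> x) \<le> ennreal (2 * C * V (s + l) x)"
proof -
  have sl: "l \<le> k" "s \<le> k"
    using assms by auto
  note [measurable] = df_measurable_snd[OF sl(1) assms(2), of x] df_measurable_snd[OF sl(1) assms(3), of x] V_meas[OF sl(2)]
  have "\<bar>df l v x y - df l u x y\<bar> * V s y \<le> \<bar>df l v x y\<bar> * V s y + \<bar>df l u x y\<bar> * V s y" for y
    using mult_right_mono[OF abs_triangle_ineq4[of "df l v x y" "df l u x y"] V_nonneg[OF sl(2), of y]]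
    by (simp add: distrib_right)
  then have "(\<integral>\<^sup>+y. ennreal (\<bar>df l v x y - df l u x y\<bar> * V s y) \<partial>\<gamma> x)
      \<le> (\<integral>\<^sup>+y. ennreal (\<bar>df l v x y\<bar> * V s y) + ennreal (\<bar>df l u x y\<bar> * V s y) \<partial>\<gamma> x)"
    using V_nonneg[OF sl(2)] by (intro nn_integral_mono) (simp flip: ennreal_plus)
  also have "\<dots> = (\<integral>\<^sup>+y. ennreal (\<bar>df l v x y\<bar> * V s y) \<partial>\<gamma> x) + (\<integral>\<^sup>+y. ennreal (\<bar>df l u x y\<bar> * V s y) \<partial>\<gamma> x)"
    by (rule nn_integral_add) measurable
  also have "\<dots> \<le> ennreal (C * V (s + l) x) + ennreal (C * V (s + l) x)"
    by (intro add_mono df_bound assms)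
  also have "\<dots> = ennreal (2 * C * V (s + l) x)"
    using C_pos V_nonneg[OF assms(1), of x] by (simp flip: ennreal_plus)
  finally show ?thesis .
qed

text \<open>(B3) gives continuity of order l in the heaviest admissible weight
  \<open>V (k - l)\<close>; the lighter weights follow by monotonicity.\<close>

lemma df_diff_tendsto:
  assumes "s + l \<le> k" "u \<in> {0..1}"
  shows "((\<lambda>h. \<integral>\<^sup>+y. ennreal (\<bar>df l (u + h) x y - df l u x y\<bar> * V s y) \<partial>\<gamma> x) \<longlongrightarrow> 0) (increments u)"
proof (rule tendsto_sandwich[OF _ _ tendsto_const])
  have "k - (k - l) = l"
    using assms by simp
  then show "((\<lambda>h. \<integral>\<^sup>+y. ennreal (\<bar>df l (u + h) x y - df l u x y\<bar> * V (k - l) y) \<partial>\<gamma> x) \<longlongrightarrow> 0) (increments u)"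
    using B3_cont[OF assms(2), of "k - l" x] by (simp only: diff_le_self)
  show "eventually (\<lambda>h. (\<integral>\<^sup>+y. ennreal (\<bar>df l (u + h) x y - df l u x y\<bar> * V s y) \<partial>\<gamma> x)
      \<le> (\<integral>\<^sup>+y. ennreal (\<bar>df l (u + h) x y - df l u x y\<bar> * V (k - l) y) \<partial>\<gamma> x)) (increments u)"
    using assms by (intro always_eventually allI nn_integral_mono ennreal_leI mult_left_mono V_mono) auto
qed simp

lemma nn_integral_abs_measurable:
  assumes F: "(\<lambda>z. F (fst z) (snd z)) \<in> borel_measurable (borel \<Otimes>\<^sub>M borel)"
    and F0: "\<And>x y. \<forall>u\<in>{0..1}. f u x y = 0 \<Longrightarrow> F x y = 0" and s: "s \<le> k"
  shows "(\<lambda>x. \<integral>\<^sup>+y. ennreal (\<bar>F x y\<bar> * V s y) \<partial>\<gamma> x) \<in> borel_measurable borel"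
proof (rule nn_integral_gamma_measurable)
  note [measurable] = F V_meas[OF s]
  show "(\<lambda>z. ennreal (\<bar>F (fst z) (snd z)\<bar> * V s (snd z))) \<in> borel_measurable (borel \<Otimes>\<^sub>M borel)"
    by measurable
  show "ennreal (\<bar>F x y\<bar> * V s y) = 0" if "\<forall>u\<in>{0..1}. f u x y = 0" for x y
    using F0[OF that] by simp
qed

lemma D_continuous:
  assumes sl: "s + l \<le> k" and u: "u \<in> {0..1}" and m: "m \<in> MV (V (s + l))"
  shows "vnull u (V s) (\<lambda>h. D l (u + h) m - D l u m)"
proof (rule vnull_dominated[OF m V_meas[OF sl] V_nonneg[OF sl], of "2 * C"])
  have lk: "l \<le> k" "s \<le> k" "l \<le> s + l"
    using sl by auto
  \<comment> \<open>The weighted distance of the densities at x. It majorizes the norm of the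
    increment of the kernel, is at most 2 C V, and tends to 0 for each x.\<close>
  define b where "b h x = (\<integral>\<^sup>+y. ennreal (\<bar>df l (u + h) x y - df l u x y\<bar> * V s y) \<partial>\<gamma> x)" for h x
  show "0 \<le> 2 * C"
    using C_pos by simp
  show "((\<lambda>h. b h x) \<longlongrightarrow> 0) (increments u)" for x
    unfolding b_def by (rule df_diff_tendsto[OF sl u])
  fix h assume h: "u + h \<in> {0..1}"
  show b_meas: "b h \<in> borel_measurable borel"
    unfolding b_def
    by (rule nn_integral_abs_measurable[OF borel_measurable_diff[OF df_measurable[OF lk(1) h] df_measurable[OF lk(1) u]] _ lk(2)])
      (simp add: df_zero[OF _ lk(1) h] df_zero[OF _ lk(1) u])
  show "b h x \<le> ennreal (2 * C * V (s + l) x)" for x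
    unfolding b_def by (rule df_diff_bound[OF sl u h])
  note kern = signed_kernel_Q[OF lk(3) sl]
  have "D l (u + h) m - D l u m = kop (\<lambda>x. Q l (u + h) x - Q l u x) m"
    unfolding D_eq[OF lk(1) h] D_eq[OF lk(1) u]
    by (rule kernel_op_minus_kernel[symmetric, OF V_meas[OF sl] V_ge1[OF sl] kern[OF h] kern[OF u] m])
  also have "vnorm (V s) \<dots> \<le> (\<integral>\<^sup>+x. b h x \<partial>variation m)"
  proof (rule vnorm_kernel_op[OF V_meas[OF sl] V_ge1[OF sl] m signed_kernel_minus[OF kern[OF h] kern[OF u] V_ge1[OF sl]]
        V_meas[OF lk(2)] b_meas V_nonneg[OF lk(2)]])
    fix x
    have "Q l (u + h) x - Q l u x = density_measure (\<gamma> x) (\<lambda>y. df l (u + h) x y - df l u x y)"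
      unfolding Q_def by (rule density_measure_diff[symmetric, OF sets_gamma integrable_df[OF lk(1) h] integrable_df[OF lk(1) u]])
    also have "vnorm (V s) \<dots> \<le> b h x"
      unfolding b_def
      by (rule vnorm_density_measure_le[OF sets_gamma Bochner_Integration.integrable_diff[OF integrable_df[OF lk(1) h] integrable_df[OF lk(1) u]]
            V_meas[OF lk(2)] V_nonneg[OF lk(2)]])
    finally show "vnorm (V s) (Q l (u + h) x - Q l u x) \<le> b h x" .
  qed
  finally show "vnorm (V s) (D l (u + h) m - D l u m) \<le> (\<integral>\<^sup>+x. b h x \<partial>variation m)" .
qed

lemma increments_scale:
  assumes "u \<in> {0..1}" "u + h \<in> {0..1}" "t \<in> {0..1}"
  shows "u + h * t \<in> {0..1::real}"
proof -
  have "(1 - t) *\<^sub>R u + t *\<^sub>R (u + h) \<in> {0..1}"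
    using assms by (intro convexD convex_real_interval) auto
  moreover have "(1 - t) *\<^sub>R u + t *\<^sub>R (u + h) = u + h * t"
    by (simp add: algebra_simps)
  ultimately show ?thesis
    by simp
qed

definition quot :: "nat \<Rightarrow> real \<Rightarrow> real \<Rightarrow> 'a \<Rightarrow> 'a \<Rightarrow> real" where
  "quot l u h x y = (df l (u + h) x y - df l u x y) / h - df (Suc l) u x y"

text \<open>The remainder of a difference quotient is a mean of increments of the next derivative
  over the segment from u to u + h, so a bound for all these increments is inherited.\<close>

lemma quot_le:
  assumes sl: "s + Suc l \<le> k" and u: "u \<in> {0..1}" and h: "u + h \<in> {0..1}" "h \<noteq> 0"
    and K: "\<And>t. t \<in> {0..1} \<Longrightarrow> (\<integral>\<^sup>+y. ennreal (\<bar>df (Suc l) (u + h * t) x y - df (Suc l) u x y\<bar> * V s y) \<partial>\<gamma> x) \<le> K"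
  shows "(\<integral>\<^sup>+y. ennreal (\<bar>quot l u h x y\<bar> * V s y) \<partial>\<gamma> x) \<le> K"
  unfolding quot_def
proof (rule nn_integral_difference_quotient_le[OF u h, where g = "\<lambda>v y. df (Suc l) v x y"])
  have lk: "Suc l \<le> k" "l < k" "s \<le> k"
    using sl by auto
  show "((\<lambda>v. df l v x y) has_real_derivative df (Suc l) v x y) (at v within {0..1})" if "v \<in> {0..1}" for v y
    using B2_deriv[OF lk(2) that] .
  show "continuous_on {0..1} (\<lambda>v. df (Suc l) v x y)" for y
    by (rule df_continuous[OF lk(1)])
  show "df (Suc l) v x \<in> borel_measurable (\<gamma> x)" if "v \<in> {0..1}" for v
    using df_measurable_snd[OF lk(1) that] by (simp add: measurable_cong_sets[OF sets_gamma refl])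
  show "V s \<in> borel_measurable (\<gamma> x)"
    using V_meas[OF lk(3)] by (simp add: measurable_cong_sets[OF sets_gamma refl])
  show "0 \<le> V s y" for y
    by (rule V_nonneg[OF lk(3)])
qed (rule K)

lemma quot_tendsto:
  assumes sl: "s + Suc l \<le> k" and u: "u \<in> {0..1}"
  shows "((\<lambda>h. \<integral>\<^sup>+y. ennreal (\<bar>quot l u h x y\<bar> * V s y) \<partial>\<gamma> x) \<longlongrightarrow> 0) (increments u)"
proof (rule order_tendstoI)
  fix e :: ennreal assume "0 < e"
  \<comment> \<open>\<open>quot_le\<close> delivers only a weak inequality, so room is left below
    e.\<close>
  then obtain e' where e': "0 < e'" "e' < e"
    using dense by blast
  define \<phi> where "\<phi> h = (\<integral>\<^sup>+y. ennreal (\<bar>df (Suc l) (u + h) x y - df (Suc l) u x y\<bar> * V s y) \<partial>\<gamma> x)" for h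
  have "eventually (\<lambda>h. \<phi> h < e') (increments u)"
    using order_tendstoD(2)[OF df_diff_tendsto[OF sl u, of x] e'(1)] unfolding \<phi>_def .
  then obtain d where d: "0 < d" "\<And>h. u + h \<in> {0..1} \<Longrightarrow> h \<noteq> 0 \<Longrightarrow> dist h 0 < d \<Longrightarrow> \<phi> h < e'"
    unfolding eventually_at by auto
  show "eventually (\<lambda>h. (\<integral>\<^sup>+y. ennreal (\<bar>quot l u h x y\<bar> * V s y) \<partial>\<gamma> x) < e) (increments u)"
    unfolding eventually_at
  proof (intro exI[of _ d] conjI ballI impI)
    fix h assume h: "h \<in> {h. u + h \<in> {0..1}}" "h \<noteq> 0 \<and> dist h 0 < d"
    then have hI: "u + h \<in> {0..1}" "h \<noteq> 0"
      by simp_all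
    have "(\<integral>\<^sup>+y. ennreal (\<bar>quot l u h x y\<bar> * V s y) \<partial>\<gamma> x) \<le> e'"
    proof (rule quot_le[OF sl u hI])
      fix t :: real assume t: "t \<in> {0..1}"
      \<comment> \<open>The filter of increments says nothing about the increment 0, which occurs
        for t = 0; there the integrand is 0.\<close>
      have "\<phi> (h * t) \<le> e'"
      proof (cases "t = 0")
        case True
        then show ?thesis
          by (simp add: \<phi>_def)
      next
        case False
        have "dist (h * t) 0 \<le> dist h 0"
          using t by (simp add: abs_mult mult_left_le)
        then have "\<phi> (h * t) < e'"
          using False h by (intro d(2) increments_scale[OF u hI(1) t]) auto
        then show ?thesis
          by simp
      qed
      then show "(\<integral>\<^sup>+y. ennreal (\<bar>df (Suc l) (u + h * t) x y - df (Suc l) u x y\<bar> * V s y) \<partial>\<gamma> x) \<le> e'"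
        by (simp only: \<phi>_def)
    qed
    then show "(\<integral>\<^sup>+y. ennreal (\<bar>quot l u h x y\<bar> * V s y) \<partial>\<gamma> x) < e"
      using e'(2) by (rule le_less_trans)
  qed (rule d)
qed simp

lemma D_derivative:
  assumes sl: "s + Suc l \<le> k" and u: "u \<in> {0..1}" and m: "m \<in> MV (V (s + Suc l))"
  shows "vnull u (V s) (\<lambda>h. (D l (u + h) m - D l u m) /\<^sub>R h - D (Suc l) u m)"
proof (rule vnull_dominated[OF m V_meas[OF sl] V_nonneg[OF sl], of "2 * C"])
  have lk: "l \<le> k" "Suc l \<le> k" "s \<le> k" "l \<le> s + Suc l" "Suc l \<le> s + Suc l"
    using sl by auto
  define b where "b h x = (\<integral>\<^sup>+y. ennreal (\<bar>quot l u h x y\<bar> * V s y) \<partial>\<gamma> x)" for h x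
  show "0 \<le> 2 * C"
    using C_pos by simp
  show "((\<lambda>h. b h x) \<longlongrightarrow> 0) (increments u)" for x
    unfolding b_def by (rule quot_tendsto[OF sl u])
  fix h assume h: "u + h \<in> {0..1}" "h \<noteq> 0"
  note df_meas = df_measurable[OF lk(1) h(1)] df_measurable[OF lk(1) u] df_measurable[OF lk(2) u]
  show b_meas: "b h \<in> borel_measurable borel"
    unfolding b_def
  proof (rule nn_integral_abs_measurable[OF _ _ lk(3)])
    show "(\<lambda>z. quot l u h (fst z) (snd z)) \<in> borel_measurable (borel \<Otimes>\<^sub>M borel)"
      unfolding quot_def
      by (rule borel_measurable_diff[OF borel_measurable_divide[OF borel_measurable_diff[OF df_meas(1,2)] borel_measurable_const] df_meas(3)])
    show "quot l u h x y = 0" if "\<forall>u\<in>{0..1}. f u x y = 0" for x y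
      unfolding quot_def df_zero[OF that lk(1) h(1)] df_zero[OF that lk(1) u] df_zero[OF that lk(2) u] by simp
  qed
  \<comment> \<open>The majorant for increments of the next derivative is inherited through
    \<open>quot_le\<close>, so the division by h costs nothing.\<close>
  show "b h x \<le> ennreal (2 * C * V (s + Suc l) x)" for x
    unfolding b_def by (rule quot_le[OF sl u h df_diff_bound[OF sl u increments_scale[OF u h(1)]]])
  note kern = signed_kernel_Q[OF lk(4) sl h(1)] signed_kernel_Q[OF lk(4) sl u] signed_kernel_Q[OF lk(5) sl u]
  note VV = V_meas[OF sl] V_ge1[OF sl]
  note kern' = signed_kernel_minus[OF kern(1,2) VV(2)]
  note kern'' = signed_kernel_scaleR[OF kern', of "inverse h"]
  have "(D l (u + h) m - D l u m) /\<^sub>R h - D (Suc l) u m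
      = kop (\<lambda>x. (Q l (u + h) x - Q l u x) /\<^sub>R h - Q (Suc l) u x) m"
    unfolding D_eq[OF lk(1) h(1)] D_eq[OF lk(1) u] D_eq[OF lk(2) u]
      kernel_op_minus_kernel[OF VV kern'' kern(3) m] kernel_op_scaleR_kernel[OF VV kern' m]
      kernel_op_minus_kernel[OF VV kern(1,2) m] ..
  also have "vnorm (V s) \<dots> \<le> (\<integral>\<^sup>+x. b h x \<partial>variation m)"
  proof (rule vnorm_kernel_op[OF VV m signed_kernel_minus[OF kern'' kern(3) VV(2)] V_meas[OF lk(3)] b_meas V_nonneg[OF lk(3)]])
    fix x
    note int = integrable_df[OF lk(1) h(1), of x] integrable_df[OF lk(1) u, of x] integrable_df[OF lk(2) u, of x]
    note int' = Bochner_Integration.integrable_diff[OF int(1,2)]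
    note int'' = integrable_mult_right[OF int', of "inverse h"]
    have "(Q l (u + h) x - Q l u x) /\<^sub>R h - Q (Suc l) u x
        = density_measure (\<gamma> x) (\<lambda>y. inverse h * (df l (u + h) x y - df l u x y) - df (Suc l) u x y)"
      unfolding Q_def density_measure_diff[OF sets_gamma int'' int(3)] density_measure_scaleR[OF sets_gamma int']
        density_measure_diff[OF sets_gamma int(1,2)] ..
    also have "vnorm (V s) \<dots> \<le> (\<integral>\<^sup>+y. ennreal (\<bar>inverse h * (df l (u + h) x y - df l u x y) - df (Suc l) u x y\<bar> * V s y) \<partial>\<gamma> x)"
      by (rule vnorm_density_measure_le[OF sets_gamma Bochner_Integration.integrable_diff[OF int'' int(3)] V_meas[OF lk(3)] V_nonneg[OF lk(3)]])
    also have "\<dots> = b h x"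
      by (simp add: b_def quot_def divide_inverse mult.commute)
    finally show "vnorm (V s) ((Q l (u + h) x - Q l u x) /\<^sub>R h - Q (Suc l) u x) \<le> b h x" .
  qed
  finally show "vnorm (V s) ((D l (u + h) m - D l u m) /\<^sub>R h - D (Suc l) u m) \<le> (\<integral>\<^sup>+x. b h x \<partial>variation m)" .
qed

end

context smooth_markov
begin

section \<open>Mass, powers and invariant measures of the Markov operators\<close>

lemma D_0: "D 0 u = T u"
  by (simp add: D_def)

lemma T_eq: "u \<in> {0..1} \<Longrightarrow> T u = kop (Q 0 u)"
  using D_eq[of 0 u] by (simp add: D_0)

text \<open>Invariance is tested on all probability measures, including those of infinite weighted
  norm. For these the constant weight 1 has to suffice, and it does because transition probabilities
  have mass 1.\<close>

lemma signed_kernel_Q_0: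
  assumes u: "u \<in> {0..1}"
  shows "signed_kernel (\<lambda>_. 1) (Q 0 u)"
proof -
  have "vnorm (\<lambda>_. 1) (Q 0 u x) \<le> ennreal (1 * 1)" for x
  proof -
    have int: "integrable (\<gamma> x) (df 0 u x)"
      using u by (intro integrable_df) auto
    have "vnorm (\<lambda>_. 1) (Q 0 u x) \<le> (\<integral>\<^sup>+y. ennreal (\<bar>df 0 u x y\<bar> * 1) \<partial>\<gamma> x)"
      unfolding Q_def by (rule vnorm_density_measure_le[OF sets_gamma int]) auto
    also have "\<dots> = (\<integral>\<^sup>+y. ennreal (f u x y) * 1 \<partial>\<gamma> x)"
      using f_nonneg[OF u] by (simp add: B2_zero[OF u])
    also have "\<dots> = (\<integral>\<^sup>+y. 1 \<partial>P u x)"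
    proof -
      have "df 0 u x = f u x"
        using B2_zero[OF u] by (intro ext)
      then have "f u x \<in> borel_measurable borel"
        using df_measurable_snd[of 0 u x] u by simp
      then show ?thesis
        unfolding P_def by (subst nn_integral_density) (auto simp: measurable_cong_sets[OF sets_gamma refl])
    qed
    also have "\<dots> = 1"
      using prob_space.emeasure_space_1[OF prob_space_P[OF u]] by simp
    finally show ?thesis
      by simp
  qed
  then show ?thesis
    using sval_Q_measurable[of 0 u] u by (auto simp: signed_kernel_def intro!: exI[of _ 1])
qed

lemma sval_T:
  assumes "u \<in> {0..1}" "m \<in> MV (\<lambda>_. 1)" "A \<in> sets borel"
  shows "sval (T u m) A = signed_integral m (\<lambda>x. measure (P u x) A)"
  unfolding T_eq[OF assms(1)]
  using sval_kernel_op[of "\<lambda>_. 1" m "Q 0 u" A] signed_kernel_Q_0[OF assms(1)] assms by (simp add: sval_Q_0)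

lemma sval_T_UNIV:
  assumes u: "u \<in> {0..1}" and m: "m \<in> MV (V 0)"
  shows "sval (T u m) UNIV = sval m UNIV"
proof -
  have "m \<in> MV (\<lambda>_. 1)"
    using MV_mono[of "\<lambda>_. 1" "V 0"] V_ge1[of 0] m by blast
  moreover have "measure (P u x) UNIV = 1" for x
    using prob_space.prob_space[OF prob_space_P[OF u, of x]] sets_eq_imp_space_eq[OF sets_P[OF u, of x]] by simp
  ultimately show ?thesis
    using sval_T[OF u, of m UNIV] signed_integral_const[of m 1] by simp
qed

lemma vnorm_dirac_le:
  assumes "l \<le> k"
  shows "vnorm (V l) (dirac x) \<le> ennreal (V l x)"
proof -
  have "finite_measure (return borel x)"
    by (intro prob_space.finite_measure prob_space_return) simp
  then have "vnorm (V l) (dirac x) \<le> (\<integral>\<^sup>+y. ennreal (V l y) \<partial>return borel x)"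
    using assms by (intro vnorm_of_measure_le V_meas V_nonneg) auto
  also have "\<dots> = ennreal (V l x)"
    using V_meas[OF assms] by (subst nn_integral_return) auto
  finally show ?thesis .
qed

lemma sval_dirac: "A \<in> sets borel \<Longrightarrow> sval (dirac x) A = indicator A x"
  using prob_space.finite_measure[OF prob_space_return[of x borel]]
  by (simp add: sval_of_measure measure_return)

text \<open>Powers of \<open>T u\<close> are given by the kernels \<open>x \<mapsto> (T u)\<^sup>n \<delta>\<^sub>x\<close>, to which (B1) applies.\<close>

lemma T_power_kernel:
  assumes l: "l \<le> k" and u: "u \<in> {0..1}"
  shows "(\<forall>x. vnorm (V l) ((T u ^^ n) (dirac x)) \<le> ennreal (C ^ n * V l x)) \<and>
    signed_kernel (V l) (\<lambda>x. (T u ^^ n) (dirac x)) \<and>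
    (\<forall>m\<in>MV (V l). (T u ^^ n) m = kop (\<lambda>x. (T u ^^ n) (dirac x)) m)"
proof (induction n)
  case 0
  have sk: "signed_kernel (V l) dirac"
    unfolding signed_kernel_def
  proof (intro conjI ballI exI[of _ 1] allI)
    show "(\<lambda>x. sval (dirac x) A) \<in> borel_measurable borel" if "A \<in> sets borel" for A :: "'a set"
      using that by (simp add: sval_dirac)
    have "vnorm (\<lambda>_. 1) (dirac x) \<le> vnorm (V l) (dirac x)" for x
      using V_ge1[OF l] by (rule vnorm_mono)
    then show "vnorm (\<lambda>_. 1) (dirac x) \<le> ennreal (1 * V l x)" for x
      using order_trans[OF _ vnorm_dirac_le[OF l]] by simp
  qed simp
  moreover have "m = kop dirac m" if "m \<in> MV (V l)" for m
  proof (rule signed_measure_eqI)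
    fix A :: "'a set" assume A: "A \<in> sets borel"
    have "sval (kop dirac m) A = signed_integral m (indicator A)"
      unfolding sval_kernel_op[OF V_meas[OF l] V_ge1[OF l] that sk] using A by (simp add: sval_dirac)
    then show "sval m A = sval (kop dirac m) A"
      using A by (simp add: signed_integral_indicator)
  qed
  ultimately show ?case
    using vnorm_dirac_le[OF l] by simp
next
  case (Suc n)
  define p where "p x = (T u ^^ n) (dirac x)" for x
  have p: "vnorm (V l) (p x) \<le> ennreal (C ^ n * V l x)" "signed_kernel (V l) p" for x
    using Suc by (auto simp: p_def[abs_def])
  have pm: "(T u ^^ n) m = kop p m" if "m \<in> MV (V l)" for m
    using Suc that by (auto simp: p_def)
  note VV = V_meas[OF l] V_ge1[OF l]
  have kern: "signed_kernel (V l) (Q 0 u)"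
    by (rule signed_kernel_Q[OF _ l u]) simp
  have Cn: "0 \<le> C ^ n"
    using C_pos by simp
  have MV_p: "p x \<in> MV (V l)" for x
    using p(1)[of x] by (auto simp: MV_def intro: le_less_trans)
  have MV_kop: "kop p m \<in> MV (V l)" if m: "m \<in> MV (V l)" for m
  proof -
    have "vnorm (V l) (kop p m) \<le> ennreal (C ^ n) * vnorm (V l) m"
      by (rule vnorm_kernel_op_le[OF VV m p(2) V_meas[OF l] V_nonneg[OF l] Cn p(1)])
    also have "\<dots> < \<infinity>"
      using m by (simp add: MV_def ennreal_mult_less_top)
    finally show ?thesis
      by (simp add: MV_def)
  qed
  \<comment> \<open>As functions of x the transition probabilities are bounded by 1, hence
    admissible test functions in Fubini's identity for the kernel \<open>p\<close>.\<close>
  define \<phi> where "\<phi> A x = sval (Q 0 u x) A" for A x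
  have \<phi>: "\<phi> A \<in> borel_measurable borel" "\<bar>\<phi> A x\<bar> \<le> 1" if "A \<in> sets borel" for A x
    using sval_Q_measurable[of 0 u A] u that prob_space.prob_le_1[OF prob_space_P[OF u, of x], of A]
    by (auto simp: \<phi>_def[abs_def] sval_Q_0)
  have sval_Tp: "sval (T u (p x)) A = signed_integral (p x) (\<phi> A)" for x A
    unfolding T_eq[OF u] \<phi>_def using sval_kernel_op[OF VV MV_p kern, of x A] .
  have norm: "vnorm (V l) (T u (p x)) \<le> ennreal (C ^ Suc n * V l x)" for x
  proof -
    have "vnorm (V l) (T u (p x)) \<le> ennreal C * vnorm (V l) (p x)"
      using D_bound[of l 0 u "p x"] l u MV_p[of x] by (simp add: D_0)
    also have "\<dots> \<le> ennreal C * ennreal (C ^ n * V l x)"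
      by (intro mult_left_mono p) simp
    also have "\<dots> = ennreal (C ^ Suc n * V l x)"
      using C_pos by (simp add: ennreal_mult'[symmetric] mult.assoc)
    finally show ?thesis .
  qed
  have kern': "signed_kernel (V l) (\<lambda>x. T u (p x))"
    unfolding signed_kernel_def
  proof (intro conjI ballI exI[of _ "C ^ Suc n"] allI)
    \<comment> \<open>Measurability in x does not involve the measure being integrated, so the zero
      measure is supplied for it.\<close>
    show "(\<lambda>x. sval (T u (p x)) A) \<in> borel_measurable borel" if A: "A \<in> sets borel" for A
      unfolding sval_Tp by (rule signed_integral_kernel_op(1)[OF VV zero_in_MV p(2) \<phi>[OF A]])
    show "0 \<le> C ^ Suc n"
      using C_pos by simp
    have "vnorm (\<lambda>_. 1) (T u (p x)) \<le> vnorm (V l) (T u (p x))" for x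
      using V_ge1[OF l] by (rule vnorm_mono)
    then show "vnorm (\<lambda>_. 1) (T u (p x)) \<le> ennreal (C ^ Suc n * V l x)" for x
      using order_trans[OF _ norm] by blast
  qed
  have "T u (kop p m) = kop (\<lambda>x. T u (p x)) m" if m: "m \<in> MV (V l)" for m
  proof (rule signed_measure_eqI)
    fix A :: "'a set" assume A: "A \<in> sets borel"
    have "sval (T u (kop p m)) A = signed_integral (kop p m) (\<phi> A)"
      unfolding T_eq[OF u] \<phi>_def using sval_kernel_op[OF VV MV_kop[OF m] kern, of A] .
    also have "\<dots> = signed_integral m (\<lambda>x. sval (T u (p x)) A)"
      unfolding sval_Tp by (rule signed_integral_kernel_op(2)[OF VV m p(2) \<phi>[OF A]])
    also have "\<dots> = sval (kop (\<lambda>x. T u (p x)) m) A"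
      by (rule sval_kernel_op[OF VV m kern', symmetric])
    finally show "sval (T u (kop p m)) A = sval (kop (\<lambda>x. T u (p x)) m) A" .
  qed
  then show ?case
    using norm kern' pm by (simp add: p_def)
qed

lemma
  assumes u: "u \<in> {0..1}"
  shows prob_space_mu: "prob_space (\<mu> u)" and sets_mu [simp]: "sets (\<mu> u) = sets borel"
  using B1_inv[OF u] by (auto simp: invariant_prob_def space_prob_algebra)

lemma sval_mu: "u \<in> {0..1} \<Longrightarrow> sval (of_measure (\<mu> u)) A = measure (\<mu> u) A"
  by (intro sval_of_measure prob_space.finite_measure prob_space_mu sets_mu)

lemma mu_MV:
  assumes u: "u \<in> {0..1}"
  shows "of_measure (\<mu> u) \<in> MV (V k)"
  using vnorm_of_measure_le[OF prob_space.finite_measure[OF prob_space_mu[OF u]] sets_mu[OF u] V_meas[OF order_refl] V_nonneg[OF order_refl]]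
    B1_int[OF u] by (auto simp: MV_def intro: le_less_trans)

lemma prob_MV_1:
  assumes "prob_space N" "sets N = sets borel"
  shows "of_measure N \<in> MV (\<lambda>_. 1)"
proof -
  have "vnorm (\<lambda>_. 1) (of_measure N) \<le> (\<integral>\<^sup>+x. ennreal 1 \<partial>N)"
    using assms by (intro vnorm_of_measure_le prob_space.finite_measure) auto
  also have "\<dots> < \<infinity>"
    using prob_space.emeasure_space_1[OF assms(1)] by simp
  finally show ?thesis
    by (simp add: MV_def)
qed

lemma sval_T_prob:
  assumes u: "u \<in> {0..1}" and N: "N \<in> space (prob_algebra borel)"
  shows "sval (T u (of_measure N)) A = measure (N \<bind> P u) A"
proof -
  have N': "prob_space N" "sets N = sets borel"
    using N by (auto simp: space_prob_algebra)
  note Pm = measurable_prob_algebraD[OF P_markov[OF u]]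
  have Pm': "P u \<in> N \<rightarrow>\<^sub>M subprob_algebra borel"
    using Pm by (simp add: measurable_cong_sets[OF N'(2) refl])
  show ?thesis
  proof (cases "A \<in> sets borel")
    case True
    have meas: "(\<lambda>x. measure (P u x) A) \<in> borel_measurable borel"
      using measurable_compose[OF Pm measurable_measure_subprob_algebra[OF True]] .
    have "sval (T u (of_measure N)) A = signed_integral (of_measure N) (\<lambda>x. measure (P u x) A)"
      by (rule sval_T[OF u prob_MV_1[OF N'] True])
    also have "\<dots> = (\<integral>x. measure (P u x) A \<partial>N)"
      using prob_space.prob_le_1[OF prob_space_P[OF u], of _ A]
      by (intro signed_integral_of_measure[OF prob_space.finite_measure[OF N'(1)] N'(2) meas, of 1]) simp
    also have "\<dots> = measure (N \<bind> P u) A"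
      by (rule subprob_space.measure_bind[OF prob_space_imp_subprob_space[OF N'(1)] Pm' True, symmetric])
    finally show ?thesis .
  next
    case False
    then show ?thesis
      by (simp add: sval_not_borel measure_notin_sets sets_bind'[OF N P_markov[OF u]])
  qed
qed

text \<open>The bridge between the operator on signed measures and invariance expressed by
  \<open>\<bind>\<close>: one direction makes \<open>\<mu> u\<close> stationary, the other lets the
  uniqueness in (B1) apply to fixed points.\<close>

lemma T_invariant_iff:
  assumes u: "u \<in> {0..1}" and N: "N \<in> space (prob_algebra borel)"
  shows "T u (of_measure N) = of_measure N \<longleftrightarrow> invariant_prob (P u) N"
proof -
  have N': "prob_space N" "sets N = sets borel"
    using N by (auto simp: space_prob_algebra)
  note b' = prob_space_bind'[OF N P_markov[OF u]] sets_bind'[OF N P_markov[OF u]]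
  note sN = sval_of_measure[OF prob_space.finite_measure[OF N'(1)] N'(2)]
  show ?thesis
  proof
    assume eq: "T u (of_measure N) = of_measure N"
    have "N \<bind> P u = N"
    proof (rule measure_eqI)
      fix A
      have "measure (N \<bind> P u) A = measure N A"
        using sval_T_prob[OF u N, of A] sN[of A] by (simp add: eq)
      then show "emeasure (N \<bind> P u) A = emeasure N A"
        by (simp add: finite_measure.emeasure_eq_measure[OF prob_space.finite_measure[OF N'(1)]]
            finite_measure.emeasure_eq_measure[OF prob_space.finite_measure[OF b'(1)]])
    qed (simp add: N' b')
    then show "invariant_prob (P u) N"
      using N by (simp add: invariant_prob_def)
  next
    assume "invariant_prob (P u) N"
    then show "T u (of_measure N) = of_measure N"
      by (intro signed_measure_eqI) (simp add: sval_T_prob[OF u N] sN invariant_prob_def)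
  qed
qed

text \<open>On measures of mass zero the constant kernel with value \<pi> acts as 0, so it may be
  subtracted from the kernel of \<open>T u ^^ n\<close>. What remains is the difference bounded in
  (B1), and integrating the bound produces the norm of m.\<close>

lemma ergodic_bound:
  assumes l: "l \<le> k"
  shows "\<exists>c \<kappa> N. 0 < c \<and> 0 < \<kappa> \<and> \<kappa> < 1 \<and>
    (\<forall>n\<ge>N. \<forall>u\<in>{0..1}. \<forall>m\<in>MV0 (V l). vnorm (V l) ((T u ^^ n) m) \<le> ennreal (c * \<kappa> ^ n) * vnorm (V l) m)"
proof -
  obtain \<kappa> :: real where \<kappa>: "0 < \<kappa>" "\<kappa> < 1" and "\<exists>c>0. \<forall>\<^sub>F n in sequentially.
          (SUP u\<in>{0..1}. SUP x. vnorm (V l) ((T u ^^ n) (dirac x) - of_measure (\<mu> u)) / ennreal (V l x))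
            \<le> ennreal (c * \<kappa> ^ n)"
    using B1_erg[OF l] by blast
  then obtain c :: real where c: "0 < c" and ev: "\<forall>\<^sub>F n in sequentially.
          (SUP u\<in>{0..1}. SUP x. vnorm (V l) ((T u ^^ n) (dirac x) - of_measure (\<mu> u)) / ennreal (V l x))
            \<le> ennreal (c * \<kappa> ^ n)"
    by blast
  obtain N where N: "\<forall>n\<ge>N. (SUP u\<in>{0..1}. SUP x. vnorm (V l) ((T u ^^ n) (dirac x) - of_measure (\<mu> u)) / ennreal (V l x))
            \<le> ennreal (c * \<kappa> ^ n)"
    using ev unfolding eventually_sequentially by blast
  have "vnorm (V l) ((T u ^^ n) m) \<le> ennreal (c * \<kappa> ^ n) * vnorm (V l) m"
    if n: "N \<le> n" and u: "u \<in> {0..1}" and m: "m \<in> MV0 (V l)" for n u m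
  proof -
    define p where "p x = (T u ^^ n) (dirac x)" for x
    have p: "signed_kernel (V l) p" "\<And>m. m \<in> MV (V l) \<Longrightarrow> (T u ^^ n) m = kop p m"
      using T_power_kernel[OF l u, of n] by (auto simp: p_def[abs_def])
    define \<pi> where "\<pi> = of_measure (\<mu> u)"
    note VV = V_meas[OF l] V_ge1[OF l]
    have ck: "0 \<le> c * \<kappa> ^ n"
      using c \<kappa> by simp
    have pb: "vnorm (V l) (p x - \<pi>) \<le> ennreal (c * \<kappa> ^ n * V l x)" for x
    proof -
      have V0: "0 < V l x"
        using V_ge1[OF l, of x] by simp
      have "vnorm (V l) (p x - \<pi>) / ennreal (V l x)
          \<le> (SUP u\<in>{0..1}. SUP x. vnorm (V l) ((T u ^^ n) (dirac x) - of_measure (\<mu> u)) / ennreal (V l x))"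
        unfolding p_def \<pi>_def by (intro SUP_upper2[OF u] SUP_upper2[of x] order_refl) simp
      also have "\<dots> \<le> ennreal (c * \<kappa> ^ n)"
        using N n by blast
      finally have "vnorm (V l) (p x - \<pi>) / ennreal (V l x) * ennreal (V l x) \<le> ennreal (c * \<kappa> ^ n) * ennreal (V l x)"
        by (rule mult_right_mono) simp
      also have "vnorm (V l) (p x - \<pi>) / ennreal (V l x) * ennreal (V l x) = vnorm (V l) (p x - \<pi>)"
        using V0 by (simp add: ennreal_divide_times ennreal_divide_self)
      finally show ?thesis
        using ck by (simp add: ennreal_mult')
    qed
    have sk\<pi>: "signed_kernel (V l) (\<lambda>_. \<pi>)"
      unfolding signed_kernel_def
    proof (intro conjI ballI exI[of _ 1] allI)
      fix x
      have "vnorm (\<lambda>_. 1) \<pi> \<le> (\<integral>\<^sup>+x. ennreal 1 \<partial>\<mu> u)"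
        unfolding \<pi>_def using u
        by (intro vnorm_of_measure_le prob_space.finite_measure prob_space_mu sets_mu) auto
      also have "\<dots> = ennreal 1"
        using prob_space.emeasure_space_1[OF prob_space_mu[OF u]] by simp
      also have "\<dots> \<le> ennreal (1 * V l x)"
        using V_ge1[OF l, of x] by (intro ennreal_leI) simp
      finally show "vnorm (\<lambda>_. 1) \<pi> \<le> ennreal (1 * V l x)" .
    qed auto
    have mV: "m \<in> MV (V l)" "sval m UNIV = 0"
      using m by (auto simp: MV0_def)
    have "kop (\<lambda>_. \<pi>) m = 0"
      by (rule signed_measure_eqI) (simp add: sval_kernel_op[OF VV mV(1) sk\<pi>] signed_integral_const mV(2))
    then have "(T u ^^ n) m = kop (\<lambda>x. p x - \<pi>) m"
      using kernel_op_minus_kernel[OF VV p(1) sk\<pi> mV(1)] p(2)[OF mV(1)] by simp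
    also have "vnorm (V l) \<dots> \<le> ennreal (c * \<kappa> ^ n) * vnorm (V l) m"
      by (rule vnorm_kernel_op_le[OF VV mV(1) signed_kernel_minus[OF p(1) sk\<pi> VV(2)] V_meas[OF l] V_nonneg[OF l] ck pb])
    finally show ?thesis .
  qed
  then show ?thesis
    using c \<kappa> by (intro exI[of _ c] exI[of _ \<kappa>] exI[of _ N]) blast
qed

lemma ergodic_family: "ergodic_family V k D (\<lambda>u. of_measure (\<mu> u))"
proof
  show "\<exists>C\<ge>0. \<forall>s l u m. s + l \<le> k \<longrightarrow> u \<in> {0..1} \<longrightarrow> m \<in> MV (V (s + l)) \<longrightarrow>
      vnorm (V s) (D l u m) \<le> ennreal C * vnorm (V (s + l)) m"
    using D_bound C_pos by (intro exI[of _ C]) auto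
  show "\<exists>c \<kappa> N. 0 < c \<and> 0 < \<kappa> \<and> \<kappa> < 1 \<and>
      (\<forall>n\<ge>N. \<forall>u\<in>{0..1}. \<forall>m\<in>MV0 (V l). vnorm (V l) ((D 0 u ^^ n) m) \<le> ennreal (c * \<kappa> ^ n) * vnorm (V l) m)"
    if "l \<le> k" for l
    unfolding D_0 by (rule ergodic_bound[OF that])
  fix u :: real assume u: "u \<in> {0..1}"
  show "D 0 u (of_measure (\<mu> u)) = of_measure (\<mu> u)"
    unfolding D_0 using B1_inv[OF u] T_invariant_iff[OF u, of "\<mu> u"] by (simp add: invariant_prob_def)
  show "sval (of_measure (\<mu> u)) UNIV = 1"
    using prob_space.prob_space[OF prob_space_mu[OF u]] sets_eq_imp_space_eq[OF sets_mu[OF u]] by (simp add: sval_mu[OF u])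
  show "sval (D 0 u m) UNIV = sval m UNIV" if "m \<in> MV (V 0)" for m
    unfolding D_0 by (rule sval_T_UNIV[OF u that])
  show "of_measure (\<mu> u) \<in> MV (V k)"
    by (rule mu_MV[OF u])
next
  fix s l and u :: real and m assume "s + l \<le> k" "u \<in> {0..1}" "m \<in> MV (V (s + l))"
  then show "vnull u (V s) (\<lambda>h. D l (u + h) m - D l u m)"
    by (rule D_continuous)
next
  fix s l and u :: real and m assume "s + Suc l \<le> k" "u \<in> {0..1}" "m \<in> MV (V (s + Suc l))"
  then show "vnull u (V s) (\<lambda>h. (D l (u + h) m - D l u m) /\<^sub>R h - D (Suc l) u m)"
    by (rule D_derivative)
qed (fact V_meas V_ge1 V_mono D_linear)+

end

section \<open>Operator norms and smooth paths\<close>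

lemma opnorm_le:
  assumes "\<And>m. m \<in> MV V \<Longrightarrow> vnorm W (T m) \<le> ennreal C * vnorm V m"
  shows "opnorm V W T \<le> ennreal C"
  unfolding opnorm_def
proof (rule SUP_least)
  fix m assume m: "m \<in> {m \<in> MV V. vnorm V m \<le> 1}"
  then have "vnorm W (T m) \<le> ennreal C * vnorm V m"
    using assms by simp
  also have "\<dots> \<le> ennreal C * 1"
    using m by (intro mult_left_mono) auto
  finally show "vnorm W (T m) \<le> ennreal C"
    by simp
qed

lemma opnorm0_le:
  assumes "\<And>m. m \<in> MV0 V \<Longrightarrow> vnorm W (T m) \<le> ennreal C * vnorm V m"
  shows "opnorm0 V W T \<le> ennreal C"
  unfolding opnorm0_def
proof (rule SUP_least)
  fix m assume m: "m \<in> {m \<in> MV0 V. vnorm V m \<le> 1}"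
  then have "vnorm W (T m) \<le> ennreal C * vnorm V m"
    using assms by simp
  also have "\<dots> \<le> ennreal C * 1"
    using m by (intro mult_left_mono) auto
  finally show "vnorm W (T m) \<le> ennreal C"
    by simp
qed

lemma continuous_map_onI:
  assumes C: "0 \<le> C"
    and "\<And>m n. m \<in> S \<Longrightarrow> n \<in> S \<Longrightarrow> vnorm W (T n - T m) \<le> ennreal C * vnorm V (n - m)"
  shows "continuous_map_on V W S T"
  unfolding continuous_map_on_def
proof (intro ballI allI impI)
  fix m and e :: real assume m: "m \<in> S" and e: "0 < e"
  \<comment> \<open>The denominator C + 1 covers C = 0 and keeps the final inequality
    strict.\<close>
  show "\<exists>d>0. \<forall>n\<in>S. vnorm V (n - m) < ennreal d \<longrightarrow> vnorm W (T n - T m) < ennreal e"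
  proof (intro exI[of _ "e / (C + 1)"] conjI ballI impI)
    show "0 < e / (C + 1)"
      using C e by simp
    fix n assume n: "n \<in> S" "vnorm V (n - m) < ennreal (e / (C + 1))"
    have "vnorm W (T n - T m) \<le> ennreal C * vnorm V (n - m)"
      using assms(2) m n by simp
    also have "\<dots> \<le> ennreal C * ennreal (e / (C + 1))"
      using n by (intro mult_left_mono) auto
    also have "\<dots> = ennreal (C * (e / (C + 1)))"
      by (rule ennreal_mult'[OF C, symmetric])
    also have "\<dots> < ennreal e"
      using C e by (intro ennreal_lessI) (auto simp: field_simps)
    finally show "vnorm W (T n - T m) < ennreal e" .
  qed
qed

section \<open>Operator norms and paths: the results in the form of the stated conclusions\<close>

context ergodic_family
begin

lemma D_bound':
  obtains C where "0 \<le> C" "\<forall>s l. s + l \<le> k \<longrightarrow> (\<forall>u\<in>{0..1}. \<forall>m\<in>MV (V (s + l)).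
    vnorm (V s) (D l u m) \<le> ennreal C * vnorm (V (s + l)) m)"
  using D_bound by blast

lemma opnorm_D_finite:
  assumes "s + l \<le> k"
  shows "(SUP u\<in>{0..1}. opnorm (V (s + l)) (V s) (D l u)) < \<infinity>"
proof -
  obtain C where C: "\<forall>s l. s + l \<le> k \<longrightarrow> (\<forall>u\<in>{0..1}. \<forall>m\<in>MV (V (s + l)).
      vnorm (V s) (D l u m) \<le> ennreal C * vnorm (V (s + l)) m)"
    by (rule D_bound')
  have "(SUP u\<in>{0..1}. opnorm (V (s + l)) (V s) (D l u)) \<le> ennreal C"
    using C assms by (intro SUP_least opnorm_le) blast
  then show ?thesis
    by (rule le_less_trans) simp
qed

lemma continuous_path_D:
  assumes "s + l \<le> k" "m \<in> MV (V (s + l))"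
  shows "continuous_path (V s) (MV (V s)) (\<lambda>u. D l u m)"
  unfolding continuous_path_def
  using D_mem[OF assms(1) _ assms(2)] D_cont[OF assms(1) _ assms(2), unfolded vnull_def] by blast

text \<open>The contraction constant is \<open>c * \<kappa> ^ n\<close> itself, for an n that is at
  least 1 and \<open>N\<close> and large enough to bring it below 1.\<close>

lemma opnorm0_T_power_le:
  assumes "l \<le> k"
  shows "\<exists>n\<ge>1. \<exists>\<kappa>::real. 0 < \<kappa> \<and> \<kappa> < 1 \<and> (SUP u\<in>{0..1}. opnorm0 (V l) (V l) (T u ^^ n)) \<le> ennreal \<kappa>"
proof -
  obtain c \<kappa> N where c: "0 < c" "0 < \<kappa>" "\<kappa> < 1"
    and N: "\<forall>n\<ge>N. \<forall>u\<in>{0..1}. \<forall>m\<in>MV0 (V l). vnorm (V l) ((D 0 u ^^ n) m) \<le> ennreal (c * \<kappa> ^ n) * vnorm (V l) m"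
    using ergodic[OF assms] by blast
  have "(\<lambda>n. c * \<kappa> ^ n) \<longlonglongrightarrow> c * 0"
    using c by (intro tendsto_intros LIMSEQ_power_zero) simp
  then have "eventually (\<lambda>n. c * \<kappa> ^ n < 1) sequentially"
    by (rule order_tendstoD(2)) simp
  then have "eventually (\<lambda>n. c * \<kappa> ^ n < 1 \<and> N \<le> n \<and> 1 \<le> n) sequentially"
    by (intro eventually_conj eventually_ge_at_top)
  then obtain n where n: "c * \<kappa> ^ n < 1" "N \<le> n" "1 \<le> n"
    by (auto simp: eventually_sequentially)
  have "(SUP u\<in>{0..1}. opnorm0 (V l) (V l) (T u ^^ n)) \<le> ennreal (c * \<kappa> ^ n)"
    using N n(2) by (intro SUP_least opnorm0_le) blast
  then show ?thesis
    using n c by (intro exI[of _ n] conjI exI[of _ "c * \<kappa> ^ n"]) auto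
qed

lemma condition_A1:
  "\<forall>l\<le>k. (\<forall>u\<in>{0..1}. T u ` MV (V l) \<subseteq> MV (V l)) \<and>
    (\<exists>m\<ge>1. \<exists>\<kappa>::real. 0 < \<kappa> \<and> \<kappa> < 1 \<and> (SUP u\<in>{0..1}. opnorm0 (V l) (V l) (T u ^^ m)) \<le> ennreal \<kappa>) \<and>
    (SUP u\<in>{0..1}. opnorm (V l) (V l) (T u)) < \<infinity> \<and>
    (\<forall>m\<in>MV (V l). continuous_path (V l) (MV (V l)) (\<lambda>u. T u m))"
  using T_mem opnorm0_T_power_le opnorm_D_finite[of _ 0] continuous_path_D[of _ 0]
  by (intro allI impI conjI) (simp_all add: image_subset_iff del: atLeastAtMost_iff)

lemma condition_A2:
  "\<forall>l\<in>{1..k}. (\<forall>u\<in>{0..1}. D l u ` MV (V l) \<subseteq> MV (V 0) \<and> linear_map_on (MV (V l)) (D l u) \<and>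
      continuous_map_on (V l) (V 0) (MV (V l)) (D l u)) \<and>
    (\<forall>s. s + l \<le> k \<longrightarrow>
      (\<forall>u\<in>{0..1}. D l u ` MV (V (s + l)) \<subseteq> MV (V s)) \<and>
      (SUP u\<in>{0..1}. opnorm (V (s + l)) (V s) (D l u)) < \<infinity> \<and>
      (\<forall>m\<in>MV (V (s + l)).
        differentiable_path (V s) (MV (V s)) (\<lambda>u. D (l - 1) u m) (\<lambda>u. D l u m) \<and>
        continuous_path (V s) (MV (V s)) (\<lambda>u. D l u m)))"
proof
  fix l assume l: "l \<in> {1..k}"
  have lk: "0 + l \<le> k" "l \<le> k" and l1: "Suc (l - 1) = l"
    using l by auto
  have mem: "D l u ` MV (V (s + l)) \<subseteq> MV (V s)" if "s + l \<le> k" "u \<in> {0..1}" for s u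
    using D_mem[OF that] by blast
  obtain C where C: "0 \<le> C" "\<forall>s l. s + l \<le> k \<longrightarrow> (\<forall>u\<in>{0..1}. \<forall>m\<in>MV (V (s + l)).
      vnorm (V s) (D l u m) \<le> ennreal C * vnorm (V (s + l)) m)"
    by (rule D_bound')
  have "continuous_map_on (V l) (V 0) (MV (V l)) (D l u)" if u: "u \<in> {0..1}" for u
  proof (rule continuous_map_onI[OF C(1)])
    fix m n assume mn: "m \<in> MV (V l)" "n \<in> MV (V l)"
    then have "n - m \<in> MV (V (0 + l))"
      using MV_minus[OF V_meas[OF lk(2)]] by simp
    then have "vnorm (V 0) (D l u (n - m)) \<le> ennreal C * vnorm (V l) (n - m)"
      using C(2)[rule_format, OF lk(1) u, of "n - m"] by simp
    then show "vnorm (V 0) (D l u n - D l u m) \<le> ennreal C * vnorm (V l) (n - m)"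
      using D_linear'(2)[OF lk(1) u, of n m] mn by simp
  qed
  moreover have "differentiable_path (V s) (MV (V s)) (\<lambda>u. D (l - 1) u m) (\<lambda>u. D l u m)"
    if s: "s + l \<le> k" and m: "m \<in> MV (V (s + l))" for s m
    unfolding differentiable_path_def path_deriv_def
  proof (intro conjI ballI)
    fix u :: real assume u: "u \<in> {0..1}"
    have "m \<in> MV (V (s + (l - 1)))"
      by (rule MV_V_mono[OF m]) (use s in auto)
    then show "D (l - 1) u m \<in> MV (V s)"
      using s u by (intro D_mem) auto
    show "D l u m \<in> MV (V s)"
      by (rule D_mem[OF s u m])
    show "((\<lambda>h. vnorm (V s) ((D (l - 1) (u + h) m - D (l - 1) u m) /\<^sub>R h - D l u m)) \<longlongrightarrow> 0) (increments u)"
      using D_deriv[of s "l - 1" u m, unfolded l1 vnull_def, OF s u m] .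
  qed
  ultimately show "(\<forall>u\<in>{0..1}. D l u ` MV (V l) \<subseteq> MV (V 0) \<and> linear_map_on (MV (V l)) (D l u) \<and>
      continuous_map_on (V l) (V 0) (MV (V l)) (D l u)) \<and>
    (\<forall>s. s + l \<le> k \<longrightarrow>
      (\<forall>u\<in>{0..1}. D l u ` MV (V (s + l)) \<subseteq> MV (V s)) \<and>
      (SUP u\<in>{0..1}. opnorm (V (s + l)) (V s) (D l u)) < \<infinity> \<and>
      (\<forall>m\<in>MV (V (s + l)).
        differentiable_path (V s) (MV (V s)) (\<lambda>u. D (l - 1) u m) (\<lambda>u. D l u m) \<and>
        continuous_path (V s) (MV (V s)) (\<lambda>u. D l u m)))"
    using mem mem[of 0] lk D_linear[OF lk(2)] opnorm_D_finite continuous_path_D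
    by (intro conjI allI impI ballI) simp_all
qed

lemma R_isomorphism:
  assumes l: "l \<le> k" and u: "u \<in> {0..1}"
  shows "isomorphism_on (V l) (MV0 (V l)) (\<lambda>m. m - T u m)"
  unfolding isomorphism_on_def
proof (intro conjI)
  obtain C where C: "0 \<le> C" "\<forall>s l. s + l \<le> k \<longrightarrow> (\<forall>u\<in>{0..1}. \<forall>m\<in>MV (V (s + l)).
      vnorm (V s) (D l u m) \<le> ennreal C * vnorm (V (s + l)) m)"
    by (rule D_bound')
  show "linear_map_on (MV0 (V l)) (\<lambda>m. m - T u m)"
    unfolding linear_map_on_def by (intro conjI ballI allI T_diff_linear(1,3)[OF l u] MV0_D(1))
  show "bij_betw (\<lambda>m. m - T u m) (MV0 (V l)) (MV0 (V l))"
    by (rule bij_resolvent[OF l u])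
  show "continuous_map_on (V l) (V l) (MV0 (V l)) (\<lambda>m. m - T u m)"
  proof (rule continuous_map_onI[where C = "1 + C"])
    fix m n assume mn: "m \<in> MV0 (V l)" "n \<in> MV0 (V l)"
    then have nm: "n - m \<in> MV (V (l + 0))"
      using MV0_minus[OF V_meas[OF l]] by (simp add: MV0_D)
    have "n - T u n - (m - T u m) = (n - m) - T u (n - m)"
      using T_diff_linear(2)[OF l u, of n m] mn by (simp add: MV0_D)
    also have "vnorm (V l) \<dots> \<le> vnorm (V l) (n - m) + vnorm (V l) (T u (n - m))"
      by (rule vnorm_diff_le[OF V_meas[OF l]])
    also have "\<dots> \<le> vnorm (V l) (n - m) + ennreal C * vnorm (V l) (n - m)"
      using C(2)[rule_format, OF _ u nm] l by (intro add_left_mono) simp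
    also have "\<dots> = ennreal (1 + C) * vnorm (V l) (n - m)"
      using C(1) by (simp add: distrib_right)
    finally show "vnorm (V l) (n - T u n - (m - T u m)) \<le> ennreal (1 + C) * vnorm (V l) (n - m)" .
  qed (use C(1) in simp)
  obtain B where B: "0 \<le> B" "\<forall>l\<le>k. \<forall>u\<in>{0..1}. \<forall>m\<in>MV0 (V l). vnorm (V l) (R l u m) \<le> ennreal B * vnorm (V l) m"
    using R_bound by blast
  show "continuous_map_on (V l) (V l) (MV0 (V l)) (R l u)"
  proof (rule continuous_map_onI[OF B(1)])
    fix m n assume mn: "m \<in> MV0 (V l)" "n \<in> MV0 (V l)"
    then have "R l u n - R l u m = R l u (n - m)" "n - m \<in> MV0 (V l)"
      using R_linear(2)[OF l u, of n m] MV0_minus[OF V_meas[OF l], of n m] by simp_all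
    then show "vnorm (V l) (R l u n - R l u m) \<le> ennreal B * vnorm (V l) (n - m)"
      using B(2) l u by simp
  qed
qed

lemma opnorm0_R_series:
  assumes l: "l \<le> k" and u: "u \<in> {0..1}"
  shows "(\<lambda>n. opnorm0 (V l) (V l) (\<lambda>m. (\<Sum>i<n. (T u ^^ i) m) - R l u m)) \<longlonglongrightarrow> 0"
proof -
  obtain b where b: "b \<longlonglongrightarrow> 0" "\<forall>u\<in>{0..1}. \<forall>m\<in>MV0 (V l). \<forall>n.
      vnorm (V l) ((\<Sum>i<n. (T u ^^ i) m) - R l u m) \<le> ennreal (b n) * vnorm (V l) m"
    using R_series[OF l] by blast
  have lim: "(\<lambda>n. ennreal (b n)) \<longlonglongrightarrow> 0"
    using tendsto_ennrealI[OF b(1)] by simp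
  have "opnorm0 (V l) (V l) (\<lambda>m. (\<Sum>i<n. (T u ^^ i) m) - R l u m) \<le> ennreal (b n)" for n
    using b(2) u by (intro opnorm0_le) blast
  then show ?thesis
    by (intro tendsto_sandwich[OF _ _ tendsto_const lim] always_eventually allI) auto
qed

lemma continuous_path_R:
  assumes l: "l \<le> k" and m: "m \<in> MV0 (V l)"
  shows "continuous_path (V l) (MV (V l)) (\<lambda>u. R l u m)"
  unfolding continuous_path_def
  using MV0_D(1)[OF R_mem0[OF l _ m]] R_continuous[OF l _ m, unfolded vnull_def] by blast

lemma opnorm0_R_finite: "(MAX l\<in>{0..k}. SUP u\<in>{0..1}. opnorm0 (V l) (V l) (R l u)) < \<infinity>"
proof -
  obtain B where B: "\<forall>l\<le>k. \<forall>u\<in>{0..1}. \<forall>m\<in>MV0 (V l). vnorm (V l) (R l u m) \<le> ennreal B * vnorm (V l) m"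
    using R_bound by blast
  have "(SUP u\<in>{0..1}. opnorm0 (V l) (V l) (R l u)) < \<infinity>" if "l \<le> k" for l
  proof -
    have "(SUP u\<in>{0..1}. opnorm0 (V l) (V l) (R l u)) \<le> ennreal B"
      using B that by (intro SUP_least opnorm0_le) blast
    then show ?thesis
      by (rule le_less_trans) simp
  qed
  then show ?thesis
    by (subst Max_less_iff) auto
qed

lemma differentiable_path_R:
  assumes l: "Suc l \<le> k" and m: "m \<in> MV0 (V (Suc l))"
  shows "differentiable_path (V l) (MV (V l)) (\<lambda>u. R (Suc l) u m) (\<lambda>u. R l u (D 1 u (R (Suc l) u m)))"
  unfolding differentiable_path_def path_deriv_def
proof (intro conjI ballI)
  fix u :: real assume u: "u \<in> {0..1}"
  have r: "R (Suc l) u m \<in> MV0 (V (Suc l))"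
    by (rule R_mem0[OF l u m])
  have lk: "l + Suc 0 \<le> k" "l \<le> k"
    using l by auto
  show "R (Suc l) u m \<in> MV (V l)"
    by (rule MV_V_mono[OF MV0_D(1)[OF r]]) (use l in auto)
  have "D 1 u (R (Suc l) u m) \<in> MV0 (V l)"
    using D_mem0[OF lk(1) u, of "R (Suc l) u m"] r by (simp add: MV0_D)
  then show "R l u (D 1 u (R (Suc l) u m)) \<in> MV (V l)"
    by (intro MV0_D(1)[OF R_mem0[OF lk(2) u]])
  show "((\<lambda>h. vnorm (V l) ((R (Suc l) (u + h) m - R (Suc l) u m) /\<^sub>R h - R l u (D 1 u (R (Suc l) u m)))) \<longlongrightarrow> 0) (increments u)"
    using R_derivative[OF l u m, unfolded vnull_def] .
qed

lemma continuous_path_pi: "continuous_path (V k) (MV (V k)) \<pi>"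
  unfolding continuous_path_def using stationary(1) pi_continuous[unfolded vnull_def] by blast

lemma derivatives_pi:
  "(\<forall>u\<in>{0..1}. g 0 u = \<pi> u) \<and>
    (\<forall>l\<in>{1..k}. continuous_path (V (k - l)) (MV0 (V (k - l))) (g l) \<and>
      path_deriv (V (k - l)) (g (l - 1)) (g l) \<and>
      (\<forall>u\<in>{0..1}. g l u = (\<Sum>s=1..l. real (l choose s) *\<^sub>R R (k - l) u (D s u (g (l - s) u)))))"
proof (intro conjI ballI)
  fix l assume "l \<in> {1..k}"
  then have l: "l \<le> k" "0 < l"
    by auto
  note gl = g_properties[OF l(1), rule_format]
  show "continuous_path (V (k - l)) (MV0 (V (k - l))) (g l)"
    unfolding continuous_path_def using gl l(2) by (simp add: vnull_def del: atLeastAtMost_iff)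
  show "path_deriv (V (k - l)) (g (l - 1)) (g l)"
    unfolding path_deriv_def using gl l(2) by (simp add: vnull_def del: atLeastAtMost_iff)
  fix u
  show "g l u = (\<Sum>s=1..l. real (l choose s) *\<^sub>R R (k - l) u (D s u (g (l - s) u)))"
    using l(2) g.simps(2)[of "l - 1" u] by simp
qed simp

end

theorem corollary1:
  fixes \<gamma> :: "'a::topological_space \<Rightarrow> 'a measure"
    and f :: "real \<Rightarrow> 'a \<Rightarrow> 'a \<Rightarrow> real"
    and df :: "nat \<Rightarrow> real \<Rightarrow> 'a \<Rightarrow> 'a \<Rightarrow> real"
    and P :: "real \<Rightarrow> 'a \<Rightarrow> 'a measure"
    and \<mu> :: "real \<Rightarrow> 'a measure"
    and V :: "nat \<Rightarrow> 'a \<Rightarrow> real"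
    and k :: nat
    and F F0 :: "nat \<Rightarrow> 'a signed_measure set"
    and T :: "real \<Rightarrow> 'a signed_measure \<Rightarrow> 'a signed_measure"
    and D :: "nat \<Rightarrow> real \<Rightarrow> 'a signed_measure \<Rightarrow> 'a signed_measure"
    and R :: "nat \<Rightarrow> real \<Rightarrow> 'a signed_measure \<Rightarrow> 'a signed_measure"
  assumes gamma: "measure_kernel \<gamma>"
    and f_meas: "(\<lambda>(u, x, y). f u x y) \<in>
          borel_measurable (restrict_space borel {0..1} \<Otimes>\<^sub>M borel \<Otimes>\<^sub>M borel)"
    and f_nonneg: "\<And>u x y. u \<in> {0..1} \<Longrightarrow> 0 \<le> f u x y"
    and P_def: "P = (\<lambda>u x. density (\<gamma> x) (\<lambda>y. ennreal (f u x y)))"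
    and P_markov: "\<And>u. u \<in> {0..1} \<Longrightarrow> P u \<in> borel \<rightarrow>\<^sub>M prob_algebra borel"
    and k: "1 \<le> k"
    and V_meas: "\<And>l. l \<le> k \<Longrightarrow> V l \<in> borel_measurable borel"
    and V_ge1: "\<And>l x. l \<le> k \<Longrightarrow> 1 \<le> V l x"
    and V_mono: "\<And>l x. l < k \<Longrightarrow> V l x \<le> V (Suc l) x"
    \<comment> \<open>notation\<close>
    and F_def: "F = (\<lambda>l. MV (V l))"
    and F0_def: "F0 = (\<lambda>l. MV0 (V l))"
    and T_def: "T = (\<lambda>u. kernel_op (\<lambda>x A. measure (P u x) A))"
    and D_def: "D = (\<lambda>l u. if l = 0 then T u
          else kernel_op (\<lambda>x A. LINT y:A|\<gamma> x. df l u x y))"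
    and R_def: "R = (\<lambda>l u. inv_into (F0 l) (\<lambda>m. m - T u m))"
    \<comment> \<open>(B1)\<close>
    and B1_inv: "\<And>u. u \<in> {0..1} \<Longrightarrow> invariant_prob (P u) (\<mu> u)"
    and B1_unique: "\<And>u N. u \<in> {0..1} \<Longrightarrow> invariant_prob (P u) N \<Longrightarrow> N = \<mu> u"
    and B1_int: "\<And>u. u \<in> {0..1} \<Longrightarrow> (\<integral>\<^sup>+x. ennreal (V k x) \<partial>\<mu> u) < \<infinity>"
    and B1_erg: "\<And>l. l \<le> k \<Longrightarrow> \<exists>\<kappa>::real. 0 < \<kappa> \<and> \<kappa> < 1 \<and> (\<exists>c>0. \<forall>\<^sub>F n in sequentially.
          (SUP u\<in>{0..1}. SUP x. vnorm (V l) ((T u ^^ n) (dirac x) - of_measure (\<mu> u)) / ennreal (V l x))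
            \<le> ennreal (c * \<kappa> ^ n))"
    \<comment> \<open>(B2)\<close>
    and B2_zero: "\<And>u x y. u \<in> {0..1} \<Longrightarrow> df 0 u x y = f u x y"
    and B2_deriv: "\<And>l u x y. l < k \<Longrightarrow> u \<in> {0..1} \<Longrightarrow>
          ((\<lambda>v. df l v x y) has_real_derivative df (Suc l) u x y) (at u within {0..1})"
    and B2_cont: "\<And>x y. continuous_on {0..1} (\<lambda>u. df k u x y)"
    \<comment> \<open>(B3)\<close>
    and B3_bound: "\<exists>C>0. \<forall>s l x. s + l \<le> k \<longrightarrow>
          (SUP u\<in>{0..1}. \<integral>\<^sup>+y. ennreal (\<bar>df l u x y\<bar> * V s y) \<partial>\<gamma> x) \<le> ennreal (C * V (s + l) x)"
    and B3_cont: "\<And>u x s. u \<in> {0..1} \<Longrightarrow> s \<le> k \<Longrightarrow>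
          ((\<lambda>h. \<integral>\<^sup>+y. ennreal (\<bar>df (k - s) (u + h) x y - df (k - s) u x y\<bar> * V s y) \<partial>\<gamma> x) \<longlongrightarrow> 0)
            (increments u)"
  shows
    \<comment> \<open>(A1)\<close>
    "(\<forall>l\<le>k.
        (\<forall>u\<in>{0..1}. T u ` F l \<subseteq> F l) \<and>
        (\<exists>m\<ge>1. \<exists>\<kappa>::real. 0 < \<kappa> \<and> \<kappa> < 1 \<and>
           (SUP u\<in>{0..1}. opnorm0 (V l) (V l) (T u ^^ m)) \<le> ennreal \<kappa>) \<and>
        (SUP u\<in>{0..1}. opnorm (V l) (V l) (T u)) < \<infinity> \<and>
        (\<forall>m\<in>F l. continuous_path (V l) (F l) (\<lambda>u. T u m)))
     \<and>
     \<comment> \<open>(A2)\<close>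
     (\<forall>l\<in>{1..k}.
        (\<forall>u\<in>{0..1}. D l u ` F l \<subseteq> F 0 \<and> linear_map_on (F l) (D l u) \<and>
           continuous_map_on (V l) (V 0) (F l) (D l u)) \<and>
        (\<forall>s. s + l \<le> k \<longrightarrow>
           (\<forall>u\<in>{0..1}. D l u ` F (s + l) \<subseteq> F s) \<and>
           (SUP u\<in>{0..1}. opnorm (V (s + l)) (V s) (D l u)) < \<infinity> \<and>
           (\<forall>m\<in>F (s + l).
              differentiable_path (V s) (F s) (\<lambda>u. D (l - 1) u m) (\<lambda>u. D l u m) \<and>
              continuous_path (V s) (F s) (\<lambda>u. D l u m))))
     \<and>
     \<comment> \<open>1.\<close>
     (\<forall>l\<le>k.
        (\<forall>u\<in>{0..1}. isomorphism_on (V l) (F0 l) (\<lambda>m. m - T u m) \<and>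
           (\<lambda>n. opnorm0 (V l) (V l) (\<lambda>m. (\<Sum>i<n. (T u ^^ i) m) - R l u m)) \<longlonglongrightarrow> 0) \<and>
        (\<forall>m\<in>F0 l. continuous_path (V l) (F l) (\<lambda>u. R l u m))) \<and>
     (MAX l\<in>{0..k}. SUP u\<in>{0..1}. opnorm0 (V l) (V l) (R l u)) < \<infinity> \<and>
     (\<forall>l<k. \<forall>m\<in>F0 (l + 1).
        differentiable_path (V l) (F l) (\<lambda>u. R (l + 1) u m) (\<lambda>u. R l u (D 1 u (R (l + 1) u m))))
     \<and>
     \<comment> \<open>2.\<close>
     (\<forall>u\<in>{0..1}.
        \<mu> u \<in> space (prob_algebra borel) \<and> T u (of_measure (\<mu> u)) = of_measure (\<mu> u) \<and>
        (\<forall>N\<in>space (prob_algebra borel). T u (of_measure N) = of_measure N \<longrightarrow> N = \<mu> u) \<and>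
        of_measure (\<mu> u) \<in> F k)
     \<and>
     \<comment> \<open>3.\<close>
     continuous_path (V k) (F k) (\<lambda>u. of_measure (\<mu> u)) \<and>
     (\<exists>g :: nat \<Rightarrow> real \<Rightarrow> 'a signed_measure.
        (\<forall>u\<in>{0..1}. g 0 u = of_measure (\<mu> u)) \<and>
        (\<forall>l\<in>{1..k}.
           continuous_path (V (k - l)) (F0 (k - l)) (g l) \<and>
           path_deriv (V (k - l)) (g (l - 1)) (g l) \<and>
           (\<forall>u\<in>{0..1}. g l u =
              (\<Sum>s=1..l. real (l choose s) *\<^sub>R R (k - l) u (D s u (g (l - s) u))))))"
proof -
  interpret S: smooth_markov \<gamma> f df P \<mu> V k
    by (rule smooth_markov.intro)
      (fact gamma f_meas f_nonneg P_def P_markov k V_meas V_ge1 V_mono B1_inv B1_int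
        B1_erg[unfolded T_def] B2_zero B2_deriv B2_cont B3_bound B3_cont)+
  interpret E: ergodic_family V k S.D "\<lambda>u. of_measure (\<mu> u)"
    by (rule S.ergodic_family)
  have D_eq: "D = S.D"
    by (intro ext) (simp add: D_def S.D_def T_def)
  have T_eq: "T = S.D 0"
    by (intro ext) (simp add: S.D_def T_def)
  have R_props: "\<forall>l\<le>k. (\<forall>u\<in>{0..1}. isomorphism_on (V l) (MV0 (V l)) (\<lambda>m. m - S.D 0 u m) \<and>
        (\<lambda>n. opnorm0 (V l) (V l) (\<lambda>m. (\<Sum>i<n. (S.D 0 u ^^ i) m) - E.R l u m)) \<longlonglongrightarrow> 0) \<and>
      (\<forall>m\<in>MV0 (V l). continuous_path (V l) (MV (V l)) (\<lambda>u. E.R l u m))"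
    by (intro allI impI conjI ballI E.R_isomorphism E.opnorm0_R_series E.continuous_path_R)
  have R_deriv: "\<forall>l<k. \<forall>m\<in>MV0 (V (l + 1)).
      differentiable_path (V l) (MV (V l)) (\<lambda>u. E.R (l + 1) u m) (\<lambda>u. E.R l u (S.D 1 u (E.R (l + 1) u m)))"
    using E.differentiable_path_R by (simp only: Suc_le_eq Suc_eq_plus1[symmetric]) blast
  have inv: "\<forall>u\<in>{0..1}. \<mu> u \<in> space (prob_algebra borel) \<and> S.D 0 u (of_measure (\<mu> u)) = of_measure (\<mu> u) \<and>
      (\<forall>N\<in>space (prob_algebra borel). S.D 0 u (of_measure N) = of_measure N \<longrightarrow> N = \<mu> u) \<and>
      of_measure (\<mu> u) \<in> MV (V k)"
  proof (intro ballI conjI impI)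
    fix u :: real assume u: "u \<in> {0..1}"
    show "\<mu> u \<in> space (prob_algebra borel)"
      using B1_inv[OF u] by (simp add: invariant_prob_def)
    show "S.D 0 u (of_measure (\<mu> u)) = of_measure (\<mu> u)" "of_measure (\<mu> u) \<in> MV (V k)"
      using E.stationary[OF u] by simp_all
    fix N assume "N \<in> space (prob_algebra borel)" "S.D 0 u (of_measure N) = of_measure N"
    \<comment> \<open>A fixed probability measure is invariant by \<open>T_invariant_iff\<close>, so
      the uniqueness in (B1) decides.\<close>
    then show "N = \<mu> u"
      using S.T_invariant_iff[OF u] by (intro B1_unique[OF u]) (simp add: S.D_0)
  qed
  show ?thesis
    unfolding R_def F_def F0_def T_eq D_eq
    by (intro conjI, fact E.condition_A1, fact E.condition_A2, fact R_props, fact E.opnorm0_R_finite, fact R_deriv, fact inv,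
        fact E.continuous_path_pi, rule exI, fact E.derivatives_pi)
qed

end
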